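(* There is a polynomial-time algorithm which, given a connected cubic bipartite graph $G$ with $n$ vertices, computes a spanning Eulerian multigraph $H$ in $G$ with at most $\frac{9}{7}n$ edges.
   Context: A graph is cubic if every vertex has degree $3$. A spanning Eulerian multigraph in $G$ is a multigraph $H$ on the vertex set $V(G)$ each of whose edges is a copy of an edge of $G$ (edges of $G$ may be used with multiplicity), such that $H$ is connected and every vertex has even degree in $H$. (Such an $H$ corresponds to a Graphic TSP tour of $G$ with $|E(H)|$ edges.) *)

theory Defs
  imports Complex_Main "HOL-Library.Multiset" "HOL-Computational_Algebra.Polynomial"
begin

section \<open>Polynomial time\<close>

text \<open>
  The model of computation is a small Turing-complete language whose data are binary trees
  (S-expressions over a single atom). A program maps a tree to a tree; \<open>Leaf\<close> plays the
  role of the empty list and of the truth value false, every other tree counts as true.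
\<close>

datatype tree = Leaf | Node tree tree

datatype prog =
    Ident
  | Empty
  | Head
  | Tail
  | Join prog prog
  | Seq prog prog
  | Cond prog prog prog
  | Loop prog prog

fun head :: "tree \<Rightarrow> tree" where
  "head Leaf = Leaf"
| "head (Node a b) = a"

fun tail :: "tree \<Rightarrow> tree" where
  "tail Leaf = Leaf"
| "tail (Node a b) = b"

text \<open>
  \<open>cost x y\<close> is charged whenever a construct is run on input \<open>x\<close> with result \<open>y\<close>, in addition
  to the cost of the programs run inside it. It pays for copying \<open>x\<close> and \<open>y\<close> in full, so that
  no tree can be duplicated for free: a run of cost \<open>t\<close> only ever handles trees of size at most
  \<open>t\<close>, and each construct is a linear-time operation of a multi-tape Turing machine.
  Conversely a single step of a Turing machine is simulated at a cost linear in the length of its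
  tapes. Hence polynomial cost in this model is the usual polynomial time.
\<close>

definition cost :: "tree \<Rightarrow> tree \<Rightarrow> nat" where
  "cost x y = 1 + size x + size y"

text \<open>\<open>runs p x y t\<close>: on input \<open>x\<close> the program \<open>p\<close> halts with result \<open>y\<close> after time \<open>t\<close>.\<close>

inductive runs :: "prog \<Rightarrow> tree \<Rightarrow> tree \<Rightarrow> nat \<Rightarrow> bool" where
  Ident: "runs Ident x x (cost x x)"
| Empty: "runs Empty x Leaf (cost x Leaf)"
| Head: "runs Head x (head x) (cost x (head x))"
| Tail: "runs Tail x (tail x) (cost x (tail x))"
| Join: "runs p x y s \<Longrightarrow> runs q x z t
    \<Longrightarrow> runs (Join p q) x (Node y z) (s + t + cost x (Node y z))"
| Seq: "runs p x y s \<Longrightarrow> runs q y z t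
    \<Longrightarrow> runs (Seq p q) x z (s + t + cost x z)"
| Cond_true: "runs b x c r \<Longrightarrow> c \<noteq> Leaf \<Longrightarrow> runs p x y s
    \<Longrightarrow> runs (Cond b p q) x y (r + s + cost x y)"
| Cond_false: "runs b x Leaf r \<Longrightarrow> runs q x y s
    \<Longrightarrow> runs (Cond b p q) x y (r + s + cost x y)"
| Loop_true: "runs b x c r \<Longrightarrow> c \<noteq> Leaf \<Longrightarrow> runs p x y s \<Longrightarrow> runs (Loop b p) y z t
    \<Longrightarrow> runs (Loop b p) x z (r + s + t + cost x z)"
| Loop_false: "runs b x Leaf r
    \<Longrightarrow> runs (Loop b p) x x (r + cost x x)"

inductive_cases runs_IdentE: "runs Ident x y t"
inductive_cases runs_EmptyE: "runs Empty x y t"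
inductive_cases runs_HeadE: "runs Head x y t"
inductive_cases runs_TailE: "runs Tail x y t"
inductive_cases runs_JoinE: "runs (Join p q) x y t"
inductive_cases runs_SeqE: "runs (Seq p q) x y t"
inductive_cases runs_CondE: "runs (Cond b p q) x y t"
inductive_cases runs_LoopE: "runs (Loop b p) x y t"

lemma runs_deterministic:
  assumes "runs p x y t" and "runs p x y' t'"
  shows "y' = y \<and> t' = t"
  using assms
proof (induction arbitrary: y' t' rule: runs.induct)
  case (Ident x)
  then show ?case by (auto elim: runs_IdentE)
next
  case (Empty x)
  then show ?case by (auto elim: runs_EmptyE)
next
  case (Head x)
  then show ?case by (auto elim: runs_HeadE)
next
  case (Tail x)
  then show ?case by (auto elim: runs_TailE)
next
  case (Join p x y s q z t)
  show ?case by (rule runs_JoinE[OF Join.prems]) (use Join.IH in blast)+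
next
  case (Seq p x y s q z t)
  show ?case by (rule runs_SeqE[OF Seq.prems]) (use Seq.IH in blast)+
next
  case (Cond_true b x c r p y s q)
  show ?case by (rule runs_CondE[OF Cond_true.prems]) (use Cond_true.IH Cond_true.hyps in blast)+
next
  case (Cond_false b x r q y s p)
  show ?case by (rule runs_CondE[OF Cond_false.prems]) (use Cond_false.IH Cond_false.hyps in blast)+
next
  case (Loop_true b x c r p y s z t)
  show ?case by (rule runs_LoopE[OF Loop_true.prems]) (use Loop_true.IH Loop_true.hyps in blast)+
next
  case (Loop_false b x r p)
  show ?case by (rule runs_LoopE[OF Loop_false.prems]) (use Loop_false.IH Loop_false.hyps in blast)+
qed

section \<open>Graphs\<close>

definition simple_graph :: "'a set \<Rightarrow> 'a set set \<Rightarrow> bool" where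
  "simple_graph V E \<longleftrightarrow> finite V \<and> (\<forall>e\<in>E. e \<subseteq> V \<and> card e = 2)"

definition connected_graph :: "'a set \<Rightarrow> 'a set set \<Rightarrow> bool" where
  "connected_graph V E \<longleftrightarrow>
     V \<noteq> {} \<and> (\<forall>u\<in>V. \<forall>v\<in>V. (u, v) \<in> {(x, y). {x, y} \<in> E}\<^sup>*)"

definition cubic_graph :: "'a set \<Rightarrow> 'a set set \<Rightarrow> bool" where
  "cubic_graph V E \<longleftrightarrow> (\<forall>v\<in>V. card {e \<in> E. v \<in> e} = 3)"

definition bipartite_graph :: "'a set \<Rightarrow> 'a set set \<Rightarrow> bool" where
  "bipartite_graph V E \<longleftrightarrow>
     (\<exists>A B. A \<union> B = V \<and> A \<inter> B = {} \<and> (\<forall>e\<in>E. \<exists>a\<in>A. \<exists>b\<in>B. e = {a, b}))"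

text \<open>
  A multigraph on \<open>V\<close> is given by the multiset of its edges. Copies of edges of a simple graph are
  never loops, so the degree of \<open>v\<close> is the number of edges containing \<open>v\<close>, with multiplicity.
\<close>

definition multi_degree :: "'a set multiset \<Rightarrow> 'a \<Rightarrow> nat" where
  "multi_degree H v = size {#e \<in># H. v \<in> e#}"

definition spanning_eulerian_multigraph :: "'a set \<Rightarrow> 'a set set \<Rightarrow> 'a set multiset \<Rightarrow> bool" where
  "spanning_eulerian_multigraph V E H \<longleftrightarrow>
     set_mset H \<subseteq> E \<and> connected_graph V (set_mset H) \<and> (\<forall>v\<in>V. even (multi_degree H v))"

section \<open>Encodings\<close>

fun tree_of_list :: "tree list \<Rightarrow> tree" where
  "tree_of_list [] = Leaf"
| "tree_of_list (x # xs) = Node x (tree_of_list xs)"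

text \<open>Binary representation, least significant bit first.\<close>

fun tree_of_nat :: "nat \<Rightarrow> tree" where
  "tree_of_nat n = (if n = 0 then Leaf
     else Node (if odd n then Node Leaf Leaf else Leaf) (tree_of_nat (n div 2)))"

declare tree_of_nat.simps [simp del]

definition tree_of_edges :: "(nat \<times> nat) list \<Rightarrow> tree" where
  "tree_of_edges es = tree_of_list (map (\<lambda>(u, v). Node (tree_of_nat u) (tree_of_nat v)) es)"

definition tree_of_graph :: "nat list \<Rightarrow> (nat \<times> nat) list \<Rightarrow> tree" where
  "tree_of_graph vs es = Node (tree_of_list (map tree_of_nat vs)) (tree_of_edges es)"

definition edge_mset :: "('a \<times> 'a) list \<Rightarrow> 'a set multiset" where
  "edge_mset es = mset (map (\<lambda>(u, v). {u, v}) es)"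

text \<open>
  The graph \<open>(V, E)\<close> is presented by listing its vertices and its edges, each exactly once; the
  order of the lists and the orientation of the pairs are arbitrary.
\<close>

definition lists_graph ::
    "nat list \<Rightarrow> (nat \<times> nat) list \<Rightarrow> nat set \<Rightarrow> nat set set \<Rightarrow> bool" where
  "lists_graph vs es V E \<longleftrightarrow> mset vs = mset_set V \<and> edge_mset es = mset_set E"

end

theory Submission
  imports Defs
begin

text \<open>
  A 2-factor with \<open>k\<close> cycles, completed by doubled edges joining its cycles, has \<open>n + 2 (k - 1)\<close> edges,
  so it suffices to find one with \<open>k - 1 \<le> n / 7\<close>. Colour the edges with three colours (Koenig, by Kempe
  exchanges) and consider the 2-factors \<open>F\<close> and \<open>F'\<close> formed by the colours 1, 2 and by the colours
  1, 3. Sequences of at most three Kempe exchanges are applied as long as they decrease the pair of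
  cycle numbers of \<open>F'\<close> and \<open>F\<close> lexicographically.

  If \<open>m\<^sub>i\<close> maps a vertex to its neighbour along colour \<open>i\<close>, then on one side \<open>X\<close> of the bipartition the
  cycles of \<open>F\<close> and \<open>F'\<close> are the orbits of the permutations \<open>\<sigma> = m\<^sub>2 \<circ> m\<^sub>1\<close> and \<open>\<tau> = m\<^sub>3 \<circ> m\<^sub>1\<close>.
  In the bipartite intersection graph of these orbits an orbit of size \<open>l\<close> has at most \<open>l - 1\<close>
  neighbours, and at most \<open>l - 2\<close> if \<open>l \<ge> 4\<close>, since otherwise exchanging along it merges
  orbits. Together with connectedness this alone gives about \<open>n / 6\<close> cycles; the loss is due to
  orbits of size 2 and 3, each of which shares exactly two points with another orbit. Local
  optimality prevents an orbit from being charged too often in this way, and the average orbit size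
  of \<open>\<sigma>\<close> and \<open>\<tau>\<close> together is at least \<open>7 / 2\<close>, up to a constant.
\<close>

section \<open>Polynomial-time functions\<close>

text \<open>The two cycle numbers do not enter symmetrically. Exchanging colours 1 and 2 keeps the
  cycles of \<open>F\<close> and changes those of \<open>F'\<close>; exchanging 1 and 3 does the
  reverse. The worst configurations yield only after one or two cycles of \<open>F'\<close> have
  been inverted, and this may split cycles of \<open>F\<close>. Comparing \<open>F'\<close> first
  makes that loss irrelevant: whatever the preparation does to \<open>F\<close>, a following
  exchange of colours 1 and 2 must not lower the cycle number of \<open>F'\<close>. Two preparatory
  exchanges and a final one make three. Origin of 7: let \<open>a\<close> and \<open>b\<close> be
  the numbers of orbits and \<open>m\<close> the number of edges of the intersection graph, so a + b
  \<le> m + 1. If every orbit of size l with d neighbours satisfied 2 d + 3 \<le> 2 l, summing over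
  both sides would give 3 (a + b) + 4 m \<le> 4 |X|, hence 7 (a + b) \<le> 4 |X| + 4 = 2 n + 4, and
  the smaller of a and b is at most (n + 2) / 7. Orbits of size at least 4 satisfy the inequality
  with a unit to spare; orbits of size 2 and 3 can miss it by one unit, which an orbit of the other
  side has to supply.\<close>

lemma poly_nat_mono: "m \<le> n \<Longrightarrow> poly (q :: nat poly) m \<le> poly q n"
  by (induction q) (auto intro: add_mono mult_mono)

text \<open>Running times are written down as they arise, as arbitrary functions below some
  polynomial; \<open>pb_intros\<close> then finds the polynomial.\<close>

definition poly_bounded :: "(nat \<Rightarrow> nat) \<Rightarrow> bool" where
  "poly_bounded b \<longleftrightarrow> (\<exists>q. \<forall>n. b n \<le> poly q n)"

named_theorems pb_intros

lemma pb_poly_self [pb_intros]: "poly_bounded (\<lambda>n. poly q n)"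
  unfolding poly_bounded_def by auto

lemma pb_const [pb_intros]: "poly_bounded (\<lambda>n. c)"
  unfolding poly_bounded_def by (intro exI[of _ "[:c:]"]) auto

lemma pb_id [pb_intros]: "poly_bounded (\<lambda>n. n)"
  unfolding poly_bounded_def by (intro exI[of _ "[:0, 1:]"]) auto

lemma pb_add [pb_intros]:
  assumes "poly_bounded f" "poly_bounded g"
  shows "poly_bounded (\<lambda>n. f n + g n)"
proof -
  obtain p q where "\<forall>n. f n \<le> poly p n" "\<forall>n. g n \<le> poly q n"
    using assms unfolding poly_bounded_def by auto
  then show ?thesis unfolding poly_bounded_def by (intro exI[of _ "p + q"]) (simp add: add_mono)
qed

lemma pb_mult [pb_intros]:
  assumes "poly_bounded f" "poly_bounded g"
  shows "poly_bounded (\<lambda>n. f n * g n)"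
proof -
  obtain p q where "\<forall>n. f n \<le> poly p n" "\<forall>n. g n \<le> poly q n"
    using assms unfolding poly_bounded_def by auto
  then show ?thesis unfolding poly_bounded_def by (intro exI[of _ "p * q"]) (simp add: mult_mono)
qed

lemma pb_poly [pb_intros]:
  assumes "poly_bounded f"
  shows "poly_bounded (\<lambda>n. poly q (f n))"
proof -
  obtain p where "\<forall>n. f n \<le> poly p n" using assms unfolding poly_bounded_def by auto
  then show ?thesis unfolding poly_bounded_def
    by (intro exI[of _ "pcompose q p"]) (simp add: poly_pcompose poly_nat_mono)
qed

lemma runs_cost: "runs p x y t \<Longrightarrow> cost x y \<le> t"
  by (induction rule: runs.induct) auto

lemma runs_size: "runs p x y t \<Longrightarrow> size y \<le> t"
  using runs_cost[of p x y t] by (simp add: cost_def)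

lemma run_le: "runs p x y t \<Longrightarrow> t \<le> b \<Longrightarrow> \<exists>t. runs p x y t \<and> t \<le> b"
  by blast

section \<open>Data as trees and their sizes\<close>

class enc =
  fixes enc :: "'a \<Rightarrow> tree"

definition sz :: "'a::enc \<Rightarrow> nat" where
  "sz x = size (enc x)"

instantiation bool :: enc
begin
definition enc_bool :: "bool \<Rightarrow> tree" where "enc_bool b = (if b then Node Leaf Leaf else Leaf)"
instance ..
end

instantiation nat :: enc
begin
definition enc_nat :: "nat \<Rightarrow> tree" where "enc_nat n = tree_of_nat n"
instance ..
end

instantiation prod :: (enc, enc) enc
begin
definition enc_prod :: "'a \<times> 'b \<Rightarrow> tree" where "enc_prod p = Node (enc (fst p)) (enc (snd p))"
instance ..
end

instantiation list :: (enc) enc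
begin
definition enc_list :: "'a list \<Rightarrow> tree" where "enc_list xs = tree_of_list (map enc xs)"
instance ..
end

lemma enc_Pair: "enc (a, b) = Node (enc a) (enc b)"
  by (simp add: enc_prod_def)

lemma enc_Nil: "enc [] = Leaf" and enc_Cons: "enc (x # xs) = Node (enc x) (enc xs)"
  by (simp_all add: enc_list_def)

lemma sz_Pair [simp]: "sz (a, b) = sz a + sz b + 1"
  by (simp add: sz_def enc_Pair)

lemma sz_Nil [simp]: "sz [] = 0" and sz_Cons [simp]: "sz (x # xs) = sz x + sz xs + 1"
  by (simp_all add: sz_def enc_Nil enc_Cons)

lemma sz_append [simp]: "sz (xs @ ys) = sz xs + sz ys"
  by (induction xs) auto

lemma sz_bool: "sz (b :: bool) \<le> 1"
  by (simp add: sz_def enc_bool_def)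

lemma length_le_sz: "length xs \<le> sz xs"
  by (induction xs) auto

lemma sz_le_of_mem: "x \<in> set xs \<Longrightarrow> sz x \<le> sz xs"
  by (induction xs) auto

lemma sz_filter_split: "sz (filter P xs) + sz (filter (\<lambda>x. \<not> P x) xs) = sz xs"
  by (induction xs) auto

lemma sz_concat: "sz (concat xss) \<le> sz xss"
  by (induction xss) auto

text \<open>Functions of several arguments are treated as functions of one environment that packs
  the arguments into pairs. The closure rules in \<open>ptime_intros\<close> then follow the syntax
  of a function body.\<close>

definition ptime :: "('a::enc \<Rightarrow> 'b::enc) \<Rightarrow> bool" where
  "ptime f \<longleftrightarrow> (\<exists>p q. \<forall>x. \<exists>t. runs p (enc x) (enc (f x)) t \<and> t \<le> poly q (sz x))"

named_theorems ptime_intros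

lemma ptimeE:
  assumes "ptime f"
  obtains p q where "\<And>x. \<exists>t. runs p (enc x) (enc (f x)) t \<and> t \<le> poly q (sz x)"
  using assms unfolding ptime_def by blast

lemma ptimeI:
  assumes "poly_bounded b" "\<And>x. \<exists>t. runs p (enc x) (enc (f x)) t \<and> t \<le> b (sz x)"
  shows "ptime f"
proof -
  obtain q where q: "\<And>n. b n \<le> poly q n" using assms(1) unfolding poly_bounded_def by auto
  show ?thesis unfolding ptime_def
    by (intro exI[of _ p] exI[of _ q] allI) (use assms(2) q order_trans in blast)
qed

lemma ptime_sz:
  assumes "ptime f"
  obtains q where "\<And>x. sz (f x) \<le> poly q (sz x)"
proof -
  obtain p q where pq: "\<And>x. \<exists>t. runs p (enc x) (enc (f x)) t \<and> t \<le> poly q (sz x)"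
    using ptimeE[OF assms] by blast
  have "sz (f x) \<le> poly q (sz x)" for x
    using pq[of x] runs_size unfolding sz_def by (meson order_trans)
  then show ?thesis using that by blast
qed

lemma ptime_id [ptime_intros]: "ptime (\<lambda>x. x)"
proof (rule ptimeI[where p = Ident and b = "\<lambda>n. 1 + n + n"])
  fix x :: 'a
  show "\<exists>t. runs Ident (enc x) (enc x) t \<and> t \<le> 1 + sz x + sz x"
    by (rule run_le[OF runs.Ident]) (simp add: cost_def sz_def)
qed (intro pb_intros)

lemma ptime_comp:
  assumes "ptime g" "ptime f"
  shows "ptime (\<lambda>x. g (f x))"
proof -
  obtain p q where f: "\<And>x. \<exists>t. runs p (enc x) (enc (f x)) t \<and> t \<le> poly q (sz x)"
    using ptimeE[OF assms(2)] by blast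
  obtain p' q' where g: "\<And>x. \<exists>t. runs p' (enc x) (enc (g x)) t \<and> t \<le> poly q' (sz x)"
    using ptimeE[OF assms(1)] by blast
  show ?thesis
  proof (rule ptimeI[where p = "Seq p p'"])
    show "poly_bounded (\<lambda>n. poly q n + poly q' (poly q n) + (1 + n + poly q' (poly q n)))"
      by (intro pb_intros)
    fix x
    obtain t where t: "runs p (enc x) (enc (f x)) t" "t \<le> poly q (sz x)" using f by blast
    obtain t' where t': "runs p' (enc (f x)) (enc (g (f x))) t'" "t' \<le> poly q' (sz (f x))" using g by blast
    \<comment> \<open>An output is no larger than the time spent on producing it, so the bound for
      the second program can be taken at a polynomial in the size of the first input.\<close>
    have "sz (f x) \<le> poly q (sz x)" using runs_size[OF t(1)] t(2) by (simp add: sz_def)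
    then have t'': "t' \<le> poly q' (poly q (sz x))" using t'(2) poly_nat_mono order_trans by blast
    have "size (enc (g (f x))) \<le> t'" by (rule runs_size[OF t'(1)])
    then show "\<exists>t. runs (Seq p p') (enc x) (enc (g (f x))) t \<and>
      t \<le> poly q (sz x) + poly q' (poly q (sz x)) + (1 + sz x + poly q' (poly q (sz x)))"
      using t(2) t'' by (intro run_le[OF runs.Seq[OF t(1) t'(1)]]) (simp add: cost_def sz_def)
  qed
qed

lemma ptime_Pair [ptime_intros]:
  assumes "ptime f" "ptime g"
  shows "ptime (\<lambda>x. (f x, g x))"
proof -
  obtain p q where f: "\<And>x. \<exists>t. runs p (enc x) (enc (f x)) t \<and> t \<le> poly q (sz x)"
    using ptimeE[OF assms(1)] by blast
  obtain p' q' where g: "\<And>x. \<exists>t. runs p' (enc x) (enc (g x)) t \<and> t \<le> poly q' (sz x)"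
    using ptimeE[OF assms(2)] by blast
  show ?thesis
  proof (rule ptimeI[where p = "Join p p'"])
    show "poly_bounded (\<lambda>n. poly q n + poly q' n + (2 + n + (poly q n + poly q' n)))"
      by (intro pb_intros)
    fix x
    obtain t where t: "runs p (enc x) (enc (f x)) t" "t \<le> poly q (sz x)" using f by blast
    obtain t' where t': "runs p' (enc x) (enc (g x)) t'" "t' \<le> poly q' (sz x)" using g by blast
    show "\<exists>t. runs (Join p p') (enc x) (enc (f x, g x)) t \<and>
      t \<le> poly q (sz x) + poly q' (sz x) + (2 + sz x + (poly q (sz x) + poly q' (sz x)))"
      unfolding enc_Pair
      using t(2) t'(2) runs_size[OF t(1)] runs_size[OF t'(1)]
      by (intro run_le[OF runs.Join[OF t(1) t'(1)]]) (simp add: cost_def sz_def)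
  qed
qed

lemma ptime_Cons [ptime_intros]:
  assumes "ptime f" "ptime g"
  shows "ptime (\<lambda>x. f x # g x)"
  using ptime_Pair[OF assms] unfolding ptime_def by (simp add: enc_Pair enc_Cons)

lemma ptime_head:
  fixes f :: "'a::enc \<Rightarrow> 'b::enc"
  assumes "\<And>x. enc (f x) = head (enc x)"
  shows "ptime f"
proof (rule ptimeI[where p = Head and b = "\<lambda>n. 1 + n + n"])
  fix x :: 'a
  have "size (head (enc x)) \<le> size (enc x)" by (cases "enc x") auto
  then show "\<exists>t. runs Head (enc x) (enc (f x)) t \<and> t \<le> 1 + sz x + sz x"
    unfolding assms by (intro run_le[OF runs.Head]) (simp add: cost_def sz_def)
qed (intro pb_intros)

lemma ptime_tail:
  fixes f :: "'a::enc \<Rightarrow> 'b::enc"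
  assumes "\<And>x. enc (f x) = tail (enc x)"
  shows "ptime f"
proof (rule ptimeI[where p = Tail and b = "\<lambda>n. 1 + n + n"])
  fix x :: 'a
  have "size (tail (enc x)) \<le> size (enc x)" by (cases "enc x") auto
  then show "\<exists>t. runs Tail (enc x) (enc (f x)) t \<and> t \<le> 1 + sz x + sz x"
    unfolding assms by (intro run_le[OF runs.Tail]) (simp add: cost_def sz_def)
qed (intro pb_intros)

lemma ptime_fst [ptime_intros]: "ptime f \<Longrightarrow> ptime (\<lambda>x. fst (f x))"
  by (rule ptime_comp[of fst]) (rule ptime_head, simp add: enc_prod_def)

lemma ptime_snd [ptime_intros]: "ptime f \<Longrightarrow> ptime (\<lambda>x. snd (f x))"
  by (rule ptime_comp[of snd]) (rule ptime_tail, simp add: enc_prod_def)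

lemma ptime_tl [ptime_intros]:
  fixes f :: "'a::enc \<Rightarrow> 'b::enc list"
  assumes "ptime f"
  shows "ptime (\<lambda>x. tl (f x))"
proof (rule ptime_comp[OF _ assms], rule ptime_tail)
  fix x :: "'b list"
  show "enc (tl x) = tail (enc x)" by (cases x) (simp_all add: enc_Nil enc_Cons)
qed

lemma runs_const: "\<exists>p k. \<forall>x. \<exists>t. runs p x c t \<and> t \<le> k * (1 + size x)"
proof (induction c)
  case Leaf
  have "\<exists>t. runs prog.Empty x Leaf t \<and> t \<le> 1 * (1 + size x)" for x
    by (rule run_le[OF runs.Empty]) (simp add: cost_def)
  then show ?case by blast
next
  case (Node a b)
  then obtain p q k l where p: "\<And>x. \<exists>t. runs p x a t \<and> t \<le> k * (1 + size x)"
    and q: "\<And>x. \<exists>t. runs q x b t \<and> t \<le> l * (1 + size x)" by blast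
  have "\<exists>t. runs (Join p q) x (Node a b) t \<and> t \<le> (k + l + 2 + size a + size b) * (1 + size x)" for x
  proof -
    obtain t where t: "runs p x a t" "t \<le> k * (1 + size x)" using p by blast
    obtain t' where t': "runs q x b t'" "t' \<le> l * (1 + size x)" using q by blast
    show ?thesis
      by (rule run_le[OF runs.Join[OF t(1) t'(1)]]) (use t(2) t'(2) in \<open>simp add: cost_def algebra_simps\<close>)
  qed
  then show ?case by blast
qed

lemma ptime_const [ptime_intros]: "ptime (\<lambda>x. c)"
proof -
  obtain p and k :: nat where p: "\<And>x. \<exists>t. runs p x (enc c) t \<and> t \<le> k * (1 + size x)"
    using runs_const[of "enc c"] by blast
  show ?thesis
    by (rule ptimeI[where p = p and b = "\<lambda>n. k * (1 + n)"]) (use p in \<open>auto intro!: pb_intros simp: sz_def\<close>)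
qed

lemma ptime_branch:
  assumes "ptime b" "ptime f" "ptime g" and B: "\<And>x. enc (b x) = Leaf \<longleftrightarrow> \<not> B x"
  shows "ptime (\<lambda>x. if B x then f x else g x)"
proof -
  obtain p q where b: "\<And>x. \<exists>t. runs p (enc x) (enc (b x)) t \<and> t \<le> poly q (sz x)"
    using ptimeE[OF assms(1)] by blast
  obtain p1 q1 where f: "\<And>x. \<exists>t. runs p1 (enc x) (enc (f x)) t \<and> t \<le> poly q1 (sz x)"
    using ptimeE[OF assms(2)] by blast
  obtain p2 q2 where g: "\<And>x. \<exists>t. runs p2 (enc x) (enc (g x)) t \<and> t \<le> poly q2 (sz x)"
    using ptimeE[OF assms(3)] by blast
  show ?thesis
  proof (rule ptimeI[where p = "Cond p p1 p2"])
    show "poly_bounded (\<lambda>n. poly q n + (poly q1 n + poly q2 n) + (1 + n + (poly q1 n + poly q2 n)))"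
      by (intro pb_intros)
    fix x
    obtain t where t: "runs p (enc x) (enc (b x)) t" "t \<le> poly q (sz x)" using b by blast
    show "\<exists>t. runs (Cond p p1 p2) (enc x) (enc (if B x then f x else g x)) t \<and>
      t \<le> poly q (sz x) + (poly q1 (sz x) + poly q2 (sz x)) + (1 + sz x + (poly q1 (sz x) + poly q2 (sz x)))"
    proof (cases "B x")
      case True
      obtain t' where t': "runs p1 (enc x) (enc (f x)) t'" "t' \<le> poly q1 (sz x)" using f by blast
      have ne: "enc (b x) \<noteq> Leaf" using B True by simp
      have "runs (Cond p p1 p2) (enc x) (enc (if B x then f x else g x)) (t + t' + cost (enc x) (enc (f x)))"
        using runs.Cond_true[OF t(1) ne t'(1)] True by simp
      then show ?thesis using t(2) t'(2) runs_size[OF t'(1)]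
        by (elim run_le) (simp add: cost_def sz_def)
    next
      case False
      obtain t' where t': "runs p2 (enc x) (enc (g x)) t'" "t' \<le> poly q2 (sz x)" using g by blast
      have l: "runs p (enc x) Leaf t" using t(1) B[of x] False by metis
      have "runs (Cond p p1 p2) (enc x) (enc (if B x then f x else g x)) (t + t' + cost (enc x) (enc (g x)))"
        using runs.Cond_false[OF l t'(1)] False by simp
      then show ?thesis using t(2) t'(2) runs_size[OF t'(1)]
        by (elim run_le) (simp add: cost_def sz_def)
    qed
  qed
qed

lemma ptime_if [ptime_intros]:
  "ptime b \<Longrightarrow> ptime f \<Longrightarrow> ptime g \<Longrightarrow> ptime (\<lambda>x. if b x then f x else g x)"
  by (rule ptime_branch[of b]) (simp_all add: enc_bool_def)

lemma ptime_conj [ptime_intros]: "ptime f \<Longrightarrow> ptime g \<Longrightarrow> ptime (\<lambda>x. f x \<and> g x)"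
proof -
  assume "ptime f" "ptime g"
  then have "ptime (\<lambda>x. if f x then g x else False)" by (intro ptime_intros)
  moreover have "(\<lambda>x. if f x then g x else False) = (\<lambda>x. f x \<and> g x)" by auto
  ultimately show ?thesis by simp
qed

lemma ptime_not [ptime_intros]: "ptime f \<Longrightarrow> ptime (\<lambda>x. \<not> f x)"
proof -
  assume "ptime f"
  then have "ptime (\<lambda>x. if f x then False else True)" by (intro ptime_intros)
  moreover have "(\<lambda>x. if f x then False else True) = (\<lambda>x. \<not> f x)" by auto
  ultimately show ?thesis by simp
qed

lemma ptime_disj [ptime_intros]: "ptime f \<Longrightarrow> ptime g \<Longrightarrow> ptime (\<lambda>x. f x \<or> g x)"
proof -
  assume "ptime f" "ptime g"
  then have "ptime (\<lambda>x. if f x then True else g x)" by (intro ptime_intros)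
  moreover have "(\<lambda>x. if f x then True else g x) = (\<lambda>x. f x \<or> g x)" by auto
  ultimately show ?thesis by simp
qed

text \<open>An environment paired with a nonempty list is the same tree as the triple of
  environment, head and tail, so the second branch needs no unpacking, and \<open>Tail\<close> of
  the pair is already the test for a nonempty list.\<close>

lemma ptime_case_list [ptime_intros]:
  assumes xs: "ptime xs" and a: "ptime a" and b: "ptime (\<lambda>p. b (fst p) (fst (snd p)) (snd (snd p)))"
  shows "ptime (\<lambda>e. case xs e of [] \<Rightarrow> a e | y # ys \<Rightarrow> b e y ys)"
proof -
  obtain p q where b': "\<And>x. \<exists>t. runs p (enc x) (enc (b (fst x) (fst (snd x)) (snd (snd x)))) t \<and> t \<le> poly q (sz x)"
    using ptimeE[OF b] by blast
  define b2 where "b2 = (\<lambda>(e, l). case l of [] \<Rightarrow> a e | y # ys \<Rightarrow> b e y ys)"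
  have "ptime b2"
  proof -
    obtain p1 q1 where a1: "\<And>x. \<exists>t. runs p1 (enc x) (enc (a x)) t \<and> t \<le> poly q1 (sz x)"
      using ptimeE[OF a] by blast
    have 1: "\<exists>t. runs Tail (enc x) (enc (snd x)) t \<and> t \<le> 1 + sz x + sz x" for x :: "'a \<times> 'b list"
      by (cases x) (intro exI conjI, use runs.Tail[of "enc x"] in \<open>simp add: enc_prod_def\<close>, simp add: cost_def sz_def enc_prod_def)
    show ?thesis
    proof (rule ptimeI[where p = "Cond Tail p (Seq Head p1)"])
      show "poly_bounded (\<lambda>n. (1 + n + n) + (poly q n + (1 + n + n) + poly q1 n + (1 + n + poly q1 n)) +
          (1 + n + (poly q n + poly q1 n)))"
        by (intro pb_intros)
      fix x :: "'a \<times> 'b list"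
      obtain e l where x: "x = (e, l)" by (cases x)
      obtain t where t: "runs Tail (enc x) (enc l) t" "t \<le> 1 + sz x + sz x" using 1[of x] x by auto
      show "\<exists>t. runs (Cond Tail p (Seq Head p1)) (enc x) (enc (b2 x)) t \<and> t \<le> (1 + sz x + sz x) +
        (poly q (sz x) + (1 + sz x + sz x) + poly q1 (sz x) + (1 + sz x + poly q1 (sz x))) +
          (1 + sz x + (poly q (sz x) + poly q1 (sz x)))"
      proof (cases l)
        case Nil
        have h: "runs Head (enc x) (enc e) (cost (enc x) (enc e))"
          using runs.Head[of "enc x"] by (simp add: x enc_Pair)
        obtain s where s: "runs p1 (enc e) (enc (a e)) s" "s \<le> poly q1 (sz e)" using a1 by blast
        have se: "sz e \<le> sz x" by (simp add: x)
        have s': "s \<le> poly q1 (sz x)" using s(2) poly_nat_mono[OF se, of q1] by linarith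
        have l: "runs Tail (enc x) Leaf t" using t(1) Nil by (simp add: enc_Nil)
        have "runs (Cond Tail p (Seq Head p1)) (enc x) (enc (a e))
          (t + (cost (enc x) (enc e) + s + cost (enc x) (enc (a e))) + cost (enc x) (enc (a e)))"
          by (intro runs.Cond_false[OF l] runs.Seq[OF h s(1)])
        then have "runs (Cond Tail p (Seq Head p1)) (enc x) (enc (b2 x))
          (t + (cost (enc x) (enc e) + s + cost (enc x) (enc (a e))) + cost (enc x) (enc (a e)))"
          by (simp add: x b2_def Nil)
        then show ?thesis using t(2) s' runs_size[OF s(1)] se
          by (elim run_le) (simp add: cost_def sz_def)
      next
        case (Cons y ys)
        obtain s where s: "runs p (enc x) (enc (b e y ys)) s" "s \<le> poly q (sz x)"
          using b'[of "(e, y, ys)"] by (auto simp: x Cons enc_Pair enc_Cons sz_def)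
        have l: "enc l \<noteq> Leaf" using Cons by (simp add: enc_Cons)
        have "runs (Cond Tail p (Seq Head p1)) (enc x) (enc (b2 x)) (t + s + cost (enc x) (enc (b e y ys)))"
          using runs.Cond_true[OF t(1) l s(1), of "Seq Head p1"] by (simp add: x b2_def Cons)
        then show ?thesis using t(2) s(2) runs_size[OF s(1)]
          by (elim run_le) (simp add: cost_def sz_def)
      qed
    qed
  qed
  from ptime_comp[OF this ptime_Pair[OF ptime_id xs]] show ?thesis
    unfolding b2_def by simp
qed

section \<open>Iteration over lists\<close>

lemma sz_foldl_take: "(\<And>n. sz (foldl f a (take n (x # xs))) \<le> S) \<Longrightarrow> sz (foldl f (f a x) (take n xs)) \<le> S"
  by (metis foldl_Cons take_Suc_Cons)

text \<open>The loop state consists of the remaining list, the environment and the accumulator.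
  \<open>Head\<close> of the state is the remaining list, which is \<open>Leaf\<close> exactly when
  it is empty, so it serves as the guard. \<open>S\<close> bounds all states that occur, and a round
  costs the guard, the body and the charge for the loop itself.\<close>

lemma loop_foldl:
  fixes step :: "'e::enc \<Rightarrow> 'a::enc \<Rightarrow> 'x::enc \<Rightarrow> 'a"
  assumes body: "\<And>x xs a. \<exists>t. runs p (enc (x # xs, e, a)) (enc (xs, e, step e a x)) t \<and> t \<le> poly q (sz (x # xs, e, a))"
    and S: "sz xs + sz e + 2 + T \<le> S" and T: "\<And>n. sz (foldl (step e) a (take n xs)) \<le> T"
  shows "\<exists>t. runs (Loop Head p) (enc (xs, e, a)) (enc ([] :: 'x list, e, foldl (step e) a xs)) t \<and>
    t \<le> (length xs + 1) * (4 * S + 4 + poly q S)"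
  using S T
proof (induction xs arbitrary: a)
  case Nil
  have "runs Head (enc ([] :: 'x list, e, a)) Leaf (cost (enc ([] :: 'x list, e, a)) Leaf)"
    using runs.Head[of "enc ([] :: 'x list, e, a)"] by (simp add: enc_Pair enc_Nil)
  note r = runs.Loop_false[OF this, of p]
  have "sz a \<le> T" using Nil(2)[of 0] by simp
  then have "cost (enc ([] :: 'x list, e, a)) Leaf + cost (enc ([] :: 'x list, e, a)) (enc ([] :: 'x list, e, a))
    \<le> (length ([] :: 'x list) + 1) * (4 * S + 4 + poly q S)"
    using Nil(1) by (simp add: cost_def sz_def enc_Pair enc_Nil)
  with r show ?case unfolding foldl_Nil by (rule run_le)
next
  case (Cons x xs)
  let ?s = "enc (x # xs, e, a)"
  have h: "runs Head ?s (enc (x # xs)) (cost ?s (enc (x # xs)))"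
    using runs.Head[of ?s] by (simp add: enc_Pair)
  have ne: "enc (x # xs) \<noteq> Leaf" by (simp add: enc_Cons)
  obtain t where t: "runs p ?s (enc (xs, e, step e a x)) t" "t \<le> poly q (sz (x # xs, e, a))"
    using body by blast
  have T': "sz (foldl (step e) (step e a x) (take n xs)) \<le> T" for n
    by (rule sz_foldl_take) (rule Cons.prems(2))
  obtain t' where t': "runs (Loop Head p) (enc (xs, e, step e a x)) (enc ([] :: 'x list, e, foldl (step e) (step e a x) xs)) t'"
    "t' \<le> (length xs + 1) * (4 * S + 4 + poly q S)"
    using Cons.IH[OF _ T'] Cons.prems(1) by auto
  have "sz a \<le> T" using Cons.prems(2)[of 0] by simp
  then have s1: "sz (x # xs, e, a) \<le> S" using Cons.prems(1) by simp
  then have tq: "t \<le> poly q S" using t(2) poly_nat_mono order_trans by blast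
  have "sz (foldl (step e) (step e a x) xs) \<le> T" using T'[of "length xs"] by simp
  then have s2: "sz ([] :: 'x list, e, foldl (step e) (step e a x) xs) \<le> S" using Cons.prems(1) by simp
  have s3: "sz (x # xs) \<le> S" using Cons.prems(1) by simp
  show ?case unfolding foldl_Cons using s1 s2 s3 tq t'(2)
    by (intro run_le[OF runs.Loop_true[OF h ne t(1) t'(1)]]) (simp add: cost_def sz_def)
qed

text \<open>The bound on all intermediate accumulators cannot come from \<open>step\<close> alone: a
  step that doubles its accumulator runs in polynomial time, yet iterating it gives exponential
  size.\<close>

lemma ptime_foldl:
  fixes step :: "'e::enc \<Rightarrow> 'a::enc \<Rightarrow> 'x::enc \<Rightarrow> 'a"
  assumes xs: "ptime xs" and a: "ptime a"
    and step: "ptime (\<lambda>p. step (fst p) (fst (snd p)) (snd (snd p)))"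
    and bound: "\<exists>b. poly_bounded b \<and> (\<forall>e n. sz (foldl (step e) (a e) (take n (xs e))) \<le> b (sz e))"
  shows "ptime (\<lambda>e. foldl (step e) (a e) (xs e))"
proof -
  obtain b where b: "poly_bounded b" "\<And>e n. sz (foldl (step e) (a e) (take n (xs e))) \<le> b (sz e)"
    using bound by blast
  define body where "body = (\<lambda>s :: 'x list \<times> 'e \<times> 'a. case fst s of [] \<Rightarrow> s
    | x # l \<Rightarrow> (l, fst (snd s), step (fst (snd s)) (snd (snd s)) x))"
  have "ptime body" unfolding body_def
  proof (rule ptime_case_list)
    have "ptime (\<lambda>p :: ('x list \<times> 'e \<times> 'a) \<times> 'x \<times> 'x list. (fst (snd (fst p)), snd (snd (fst p)), fst (snd p)))"
      by (intro ptime_intros)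
    from ptime_comp[OF step this]
    show "ptime (\<lambda>p :: ('x list \<times> 'e \<times> 'a) \<times> 'x \<times> 'x list. (snd (snd p), fst (snd (fst p)),
        step (fst (snd (fst p))) (snd (snd (fst p))) (fst (snd p))))"
      by (intro ptime_intros) simp
  qed (intro ptime_intros)+
  then obtain p q where pq: "\<And>x. \<exists>t. runs p (enc x) (enc (body x)) t \<and> t \<le> poly q (sz x)"
    using ptimeE by blast
  have pq': "\<exists>t. runs p (enc (x # l, e, s)) (enc (l, e, step e s x)) t \<and> t \<le> poly q (sz (x # l, e, s))" for x l e s
    using pq[of "(x # l, e, s)"] by (simp add: body_def)
  have "ptime (\<lambda>e. (xs e, e, a e))" by (intro ptime_intros xs a)
  then obtain p1 q1 where init: "\<And>e. \<exists>t. runs p1 (enc e) (enc (xs e, e, a e)) t \<and> t \<le> poly q1 (sz e)"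
    using ptimeE by blast
  let ?S = "\<lambda>n. poly q1 n + b n + 2"
  let ?L = "\<lambda>n. (poly q1 n + 1) * (4 * ?S n + 4 + poly q (?S n))"
  have "ptime (\<lambda>e. ([] :: 'x list, e, foldl (step e) (a e) (xs e)))"
  proof (rule ptimeI[where p = "Seq p1 (Loop Head p)"])
    show "poly_bounded (\<lambda>n. poly q1 n + ?L n + (1 + n + ?L n))" by (intro pb_intros b(1))
    fix e
    obtain t where t: "runs p1 (enc e) (enc (xs e, e, a e)) t" "t \<le> poly q1 (sz e)" using init by blast
    have szi: "sz (xs e, e, a e) \<le> poly q1 (sz e)" using runs_size[OF t(1)] t(2) by (simp add: sz_def)
    then have "sz (xs e) + sz e + 2 + b (sz e) \<le> ?S (sz e)" by simp
    from loop_foldl[where p = p and step = step, OF pq' this b(2)]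
    obtain t' where t': "runs (Loop Head p) (enc (xs e, e, a e)) (enc ([] :: 'x list, e, foldl (step e) (a e) (xs e))) t'"
      "t' \<le> (length (xs e) + 1) * (4 * ?S (sz e) + 4 + poly q (?S (sz e)))" by blast
    have "length (xs e) \<le> poly q1 (sz e)" using length_le_sz[of "xs e"] szi by simp
    then have "(length (xs e) + 1) * (4 * ?S (sz e) + 4 + poly q (?S (sz e))) \<le> ?L (sz e)"
      by (intro mult_right_mono) auto
    then have "t' \<le> ?L (sz e)" using t'(2) by linarith
    then have "t + t' + cost (enc e) (enc ([] :: 'x list, e, foldl (step e) (a e) (xs e)))
      \<le> poly q1 (sz e) + ?L (sz e) + (1 + sz e + ?L (sz e))"
      using t(2) runs_size[OF t'(1)] unfolding cost_def sz_def by linarith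
    then show "\<exists>t. runs (Seq p1 (Loop Head p)) (enc e) (enc ([] :: 'x list, e, foldl (step e) (a e) (xs e))) t \<and>
      t \<le> poly q1 (sz e) + ?L (sz e) + (1 + sz e + ?L (sz e))"
      using runs.Seq[OF t(1) t'(1)] by blast
  qed
  then have "ptime (\<lambda>e. snd (snd ([] :: 'x list, e, foldl (step e) (a e) (xs e))))"
    by (intro ptime_snd)
  then show ?thesis by simp
qed

text \<open>The usual way to meet the size bound: if a round adds an amount that depends on the
  environment and the list element but not on the accumulator, the total growth is at most the
  number of rounds times a polynomial.\<close>

lemma ptime_foldl_additive:
  fixes step :: "'e::enc \<Rightarrow> 'a::enc \<Rightarrow> 'x::enc \<Rightarrow> 'a"
  assumes xs: "ptime xs" and a: "ptime a"
    and step: "ptime (\<lambda>p. step (fst p) (fst (snd p)) (snd (snd p)))"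
    and c: "poly_bounded c" "\<And>e s x. sz (step e s x) \<le> sz s + c (sz e + sz x)"
  shows "ptime (\<lambda>e. foldl (step e) (a e) (xs e))"
proof (rule ptime_foldl[OF xs a step])
  obtain q where q: "\<And>n. c n \<le> poly q n" using c(1) unfolding poly_bounded_def by blast
  obtain q1 where q1: "\<And>e. sz (xs e) \<le> poly q1 (sz e)" using ptime_sz[OF xs] by blast
  obtain q2 where q2: "\<And>e. sz (a e) \<le> poly q2 (sz e)" using ptime_sz[OF a] by blast
  let ?b = "\<lambda>n. poly q2 n + poly q1 n * poly q (n + poly q1 n)"
  have fold: "sz (foldl (step e) s l) \<le> sz s + length l * poly q (sz e + m)"
    if "\<And>x. x \<in> set l \<Longrightarrow> sz x \<le> m" for e s l m
    using that
  proof (induction l arbitrary: s)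
    case (Cons x l)
    have "sz (step e s x) \<le> sz s + poly q (sz e + sz x)" using c(2)[of e s x] q order_trans add_left_mono by blast
    also have "\<dots> \<le> sz s + poly q (sz e + m)" using Cons.prems[of x] by (intro add_left_mono poly_nat_mono) simp
    finally show ?case using Cons.IH[of "step e s x"] Cons.prems by simp
  qed simp
  have "sz (foldl (step e) (a e) (take n (xs e))) \<le> ?b (sz e)" for e n
  proof -
    have m: "sz x \<le> poly q1 (sz e)" if "x \<in> set (take n (xs e))" for x
      using sz_le_of_mem[OF in_set_takeD[OF that]] q1[of e] by linarith
    have l: "length (take n (xs e)) \<le> poly q1 (sz e)" using length_le_sz[of "xs e"] q1[of e] by simp
    have "sz (foldl (step e) (a e) (take n (xs e))) \<le> sz (a e) + length (take n (xs e)) * poly q (sz e + poly q1 (sz e))"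
      by (rule fold) (rule m)
    also have "\<dots> \<le> ?b (sz e)" using q2[of e] l by (intro add_mono mult_right_mono) auto
    finally show ?thesis .
  qed
  then show "\<exists>b. poly_bounded b \<and> (\<forall>e n. sz (foldl (step e) (a e) (take n (xs e))) \<le> b (sz e))"
    by (intro exI[of _ ?b] conjI pb_intros) auto
qed

lemma ptime_comp2:
  assumes "ptime (\<lambda>p. h (fst p) (snd p))" "ptime f" "ptime g"
  shows "ptime (\<lambda>x. h (f x) (g x))"
  using ptime_comp[OF assms(1) ptime_Pair[OF assms(2,3)]] by simp

lemma ptime_comp3:
  assumes "ptime (\<lambda>p. h (fst p) (fst (snd p)) (snd (snd p)))" "ptime f" "ptime g" "ptime k"
  shows "ptime (\<lambda>x. h (f x) (g x) (k x))"
  using ptime_comp[OF assms(1) ptime_Pair[OF assms(2) ptime_Pair[OF assms(3,4)]]] by simp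

section \<open>Elementary functions on lists and numbers\<close>

lemma ptime_rev [ptime_intros]:
  fixes f :: "'a::enc \<Rightarrow> 'b::enc list"
  assumes "ptime f"
  shows "ptime (\<lambda>x. rev (f x))"
proof -
  have "ptime (\<lambda>x. foldl (\<lambda>l y. y # l) [] (f x))"
    by (rule ptime_foldl_additive[where c = "\<lambda>n. n + 1"]) (intro ptime_intros pb_intros assms | simp)+
  moreover have "foldl (\<lambda>l y. y # l) acc xs = rev xs @ acc" for acc and xs :: "'b list"
    by (induction xs arbitrary: acc) auto
  ultimately show ?thesis by simp
qed

lemma ptime_append [ptime_intros]:
  fixes f :: "'a::enc \<Rightarrow> 'b::enc list"
  assumes "ptime f" "ptime g"
  shows "ptime (\<lambda>x. f x @ g x)"
proof -
  have "ptime (\<lambda>x. foldl (\<lambda>l y. y # l) (g x) (rev (f x)))"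
    by (rule ptime_foldl_additive[where c = "\<lambda>n. n + 1"]) (intro ptime_intros pb_intros assms | simp)+
  moreover have "foldl (\<lambda>l y. y # l) acc xs = rev xs @ acc" for acc and xs :: "'b list"
    by (induction xs arbitrary: acc) auto
  ultimately show ?thesis by simp
qed

lemma ptime_map [ptime_intros]:
  fixes f :: "'e::enc \<Rightarrow> 'a::enc \<Rightarrow> 'b::enc"
  assumes f: "ptime (\<lambda>p. f (fst p) (snd p))" and xs: "ptime xs"
  shows "ptime (\<lambda>e. map (f e) (xs e))"
proof -
  obtain q where q: "\<And>p. sz (f (fst p) (snd p)) \<le> poly q (sz p)" using ptime_sz[OF f] by blast
  have q': "sz (f e x) \<le> poly q (sz e + sz x + 1)" for e x using q[of "(e, x)"] by simp
  have s: "ptime (\<lambda>p :: 'e \<times> 'b list \<times> 'a. f (fst p) (snd (snd p)))"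
    by (rule ptime_comp2[OF f]) (intro ptime_intros)+
  have "ptime (\<lambda>e. rev (foldl (\<lambda>l y. f e y # l) [] (xs e)))"
    by (rule ptime_rev, rule ptime_foldl_additive[where c = "\<lambda>n. poly q (n + 1) + 1"])
      (intro ptime_intros pb_intros xs s | simp add: q'[simplified])+
  moreover have "foldl (\<lambda>l y. g y # l) acc l = rev (map g l) @ acc" for acc and l :: "'a list" and g :: "'a \<Rightarrow> 'b"
    by (induction l arbitrary: acc) auto
  ultimately show ?thesis by simp
qed

lemma ptime_filter [ptime_intros]:
  fixes f :: "'e::enc \<Rightarrow> 'a::enc \<Rightarrow> bool"
  assumes f: "ptime (\<lambda>p. f (fst p) (snd p))" and xs: "ptime xs"
  shows "ptime (\<lambda>e. filter (f e) (xs e))"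
proof -
  have s: "ptime (\<lambda>p :: 'e \<times> 'a list \<times> 'a. f (fst p) (snd (snd p)))"
    by (rule ptime_comp2[OF f]) (intro ptime_intros)+
  have "ptime (\<lambda>e. rev (foldl (\<lambda>l y. if f e y then y # l else l) [] (xs e)))"
    by (rule ptime_rev, rule ptime_foldl_additive[where c = "\<lambda>n. n + 1"])
      (intro ptime_intros pb_intros xs s | simp)+
  moreover have "foldl (\<lambda>l y. if g y then y # l else l) acc l = rev (filter g l) @ acc" for acc and l :: "'a list" and g
    by (induction l arbitrary: acc) auto
  ultimately show ?thesis by simp
qed

lemma ptime_concat [ptime_intros]:
  fixes f :: "'e::enc \<Rightarrow> 'a::enc list list"
  assumes "ptime f"
  shows "ptime (\<lambda>e. concat (f e))"
proof -
  have "ptime (\<lambda>e. foldl (\<lambda>l y. l @ y) [] (f e))"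
    by (rule ptime_foldl_additive[where c = "\<lambda>n. n"]) (intro ptime_intros pb_intros assms | simp)+
  moreover have "foldl (\<lambda>l y. l @ y) acc l = acc @ concat l" for acc and l :: "'a list list"
    by (induction l arbitrary: acc) auto
  ultimately show ?thesis by simp
qed

lemma ptime_bex [ptime_intros]:
  fixes P :: "'e::enc \<Rightarrow> 'a::enc \<Rightarrow> bool"
  assumes P: "ptime (\<lambda>p. P (fst p) (snd p))" and xs: "ptime xs"
  shows "ptime (\<lambda>e. \<exists>x\<in>set (xs e). P e x)"
proof -
  have s: "ptime (\<lambda>p :: 'e \<times> bool \<times> 'a. P (fst p) (snd (snd p)))"
    by (rule ptime_comp2[OF P]) (intro ptime_intros)+
  have "ptime (\<lambda>e. foldl (\<lambda>b y. b \<or> P e y) False (xs e))"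
    by (rule ptime_foldl_additive[where c = "\<lambda>n. 1"])
      (intro ptime_intros pb_intros xs s | rule trans_le_add2[OF sz_bool])+
  moreover have "foldl (\<lambda>b y. b \<or> g y) b l \<longleftrightarrow> b \<or> (\<exists>x\<in>set l. g x)" for b and l :: "'a list" and g
    by (induction l arbitrary: b) auto
  ultimately show ?thesis by simp
qed

text \<open>No arithmetic is involved: one element of the second list is dropped for each element of
  the first, and the test is whether anything is left.\<close>

lemma ptime_length_less [ptime_intros]:
  fixes f :: "'e::enc \<Rightarrow> 'a::enc list" and g :: "'e \<Rightarrow> 'b::enc list"
  assumes "ptime f" "ptime g"
  shows "ptime (\<lambda>e. length (f e) < length (g e))"
proof -
  have t: "sz (tl l) \<le> sz l" for l :: "'b list" by (cases l) auto
  have "ptime (\<lambda>e. foldl (\<lambda>l y. tl l) (g e) (f e))"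
    by (rule ptime_foldl_additive[where c = "\<lambda>n. 0"]) (intro ptime_intros pb_intros assms | simp add: t)+
  then have "ptime (\<lambda>e. case foldl (\<lambda>l y. tl l) (g e) (f e) of [] \<Rightarrow> False | y # ys \<Rightarrow> True)"
    by (intro ptime_intros)
  moreover have "foldl (\<lambda>l y. tl l) l xs = drop (length xs) l" for l :: "'b list" and xs :: "'a list"
    by (induction xs arbitrary: l) (auto simp: drop_Suc)
  moreover have "(case drop (length (f e)) (g e) of [] \<Rightarrow> False | y # ys \<Rightarrow> True) \<longleftrightarrow> length (f e) < length (g e)" for e
    using drop_eq_Nil[of "length (f e)" "g e"] by (cases "drop (length (f e)) (g e)") auto
  ultimately show ?thesis by simp
qed

fun bits :: "nat \<Rightarrow> bool list" where
  "bits n = (if n = 0 then [] else odd n # bits (n div 2))"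

declare bits.simps [simp del]

text \<open>A number and the list of its bits are the same tree, so passing from one to the other
  costs nothing.\<close>

lemma enc_bits: "enc (bits n) = enc n"
proof (induction n rule: less_induct)
  case (less n)
  show ?case
  proof (cases "n = 0")
    case False
    then have "enc (bits (n div 2)) = enc (n div 2)" by (intro less) simp
    then show ?thesis using False
      unfolding enc_nat_def bits.simps[of n] tree_of_nat.simps[of n] by (simp add: enc_Cons enc_bool_def)
  qed (simp add: bits.simps enc_nat_def tree_of_nat.simps enc_Nil)
qed

lemma bits_inj: "bits m = bits n \<Longrightarrow> m = n"
proof (induction m arbitrary: n rule: less_induct)
  case (less m)
  show ?case
  proof (cases "m = 0 \<or> n = 0")
    case True
    then show ?thesis using less.prems by (auto simp: bits.simps split: if_splits)
  next
    case False
    then have "odd m = odd n" "bits (m div 2) = bits (n div 2)"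
      using less.prems by (simp_all add: bits.simps[of m] bits.simps[of n])
    moreover then have "m div 2 = n div 2" using False by (intro less.IH) auto
    ultimately show ?thesis by (metis bit_eq_rec)
  qed
qed

lemma ptime_nat_eq [ptime_intros]:
  fixes f g :: "'e::enc \<Rightarrow> nat"
  assumes f: "ptime f" and g: "ptime g"
  shows "ptime (\<lambda>e. f e = g e)"
proof -
  have b: "ptime (\<lambda>e. bits (h e))" if "ptime h" for h :: "'e \<Rightarrow> nat"
    using that unfolding ptime_def by (simp add: enc_bits)
  \<comment> \<open>The state holds the result so far and the unread bits of the first number. If
    these run out too early the result becomes False for good; bits left over at the end are
    detected afterwards.\<close>
  define step :: "bool \<times> bool list \<Rightarrow> bool \<Rightarrow> bool \<times> bool list"
    where "step = (\<lambda>s x. case snd s of [] \<Rightarrow> (False, []) | y # ys \<Rightarrow> (fst s \<and> (if x then y else \<not> y), ys))"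
  have sz_step: "sz (step s x) \<le> sz s + 2" for s x
  proof (cases "snd s")
    case Nil
    then show ?thesis using sz_bool[of False] by (cases s) (simp add: step_def)
  next
    case (Cons y ys)
    then show ?thesis using sz_bool[of "fst s \<and> (if x then y else \<not> y)"] by (cases s) (simp add: step_def)
  qed
  have "ptime (\<lambda>e. foldl (\<lambda>s x. step s x) (True, bits (f e)) (bits (g e)))"
    unfolding step_def
    by (rule ptime_foldl_additive[where c = "\<lambda>n. 2"])
      (intro ptime_intros pb_intros b f g | rule sz_step[unfolded step_def])+
  then have main: "ptime (\<lambda>e. fst (foldl step (True, bits (f e)) (bits (g e))) \<and>
    (case snd (foldl step (True, bits (f e)) (bits (g e))) of [] \<Rightarrow> True | y # ys \<Rightarrow> False))"
    by (intro ptime_intros) simp_all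
  have corr: "(fst (foldl step (ok, l) l') \<and> snd (foldl step (ok, l) l') = []) \<longleftrightarrow> ok \<and> l = l'" for ok l l'
  proof (induction l' arbitrary: ok l)
    case (Cons x l')
    have F: "\<not> fst (foldl step (False, l) m)" for l m
    proof (induction m arbitrary: l)
      case (Cons x m) then show ?case by (cases l) (auto simp: step_def)
    qed simp
    show ?case
    proof (cases l)
      case Nil then show ?thesis using F by (simp add: step_def)
    next
      case (Cons y ys) then show ?thesis using Cons.IH by (auto simp: step_def)
    qed
  qed simp
  have "(fst (foldl step (True, bits (f e)) (bits (g e))) \<and>
    (case snd (foldl step (True, bits (f e)) (bits (g e))) of [] \<Rightarrow> True | y # ys \<Rightarrow> False)) \<longleftrightarrow> f e = g e" for e
    using bits_inj[of "f e" "g e"] corr[of True "bits (f e)" "bits (g e)"] by (auto split: list.split)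
  with main show ?thesis by simp
qed

lemma ptime_mem [ptime_intros]:
  fixes f :: "'e::enc \<Rightarrow> nat"
  assumes "ptime f" "ptime g"
  shows "ptime (\<lambda>e. f e \<in> set (g e))"
proof (rule ptime_comp2[OF _ assms])
  have "ptime (\<lambda>p :: nat \<times> nat list. \<exists>y\<in>set (snd p). y = fst p)" by (intro ptime_intros)
  then show "ptime (\<lambda>p :: nat \<times> nat list. fst p \<in> set (snd p))" by simp
qed

section \<open>Connected components\<close>

definition component :: "('a \<times> 'a) set \<Rightarrow> 'a \<Rightarrow> 'a set" where
  "component R v = R\<^sup>* `` {v}"

definition num_comps :: "'a set \<Rightarrow> ('a \<times> 'a) set \<Rightarrow> nat" where
  "num_comps V R = card (component R ` V)"

lemma component_self [simp]: "v \<in> component R v"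
  by (auto simp: component_def)

lemma component_closed: "x \<in> S \<Longrightarrow> R `` S \<subseteq> S \<Longrightarrow> component R x \<subseteq> S"
  unfolding component_def using Image_closed_trancl[of R S] by blast

lemma component_subset:
  "x \<in> S \<Longrightarrow> (\<And>v w. v \<in> S \<Longrightarrow> (v, w) \<in> R \<Longrightarrow> w \<in> S) \<Longrightarrow> component R x \<subseteq> S"
  by (rule component_closed) auto

lemma component_step: "y \<in> component R x \<Longrightarrow> (y, z) \<in> R \<Longrightarrow> z \<in> component R x"
  unfolding component_def by (auto intro: rtrancl_into_rtrancl)

lemma component_sym:
  assumes "sym R" "y \<in> component R x"
  shows "component R y = component R x"
proof -
  have "(x, y) \<in> R\<^sup>*" using assms(2) by (simp add: component_def)
  moreover have "(y, x) \<in> R\<^sup>*" using sym_rtrancl[OF assms(1)] calculation by (rule symD)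
  ultimately show ?thesis unfolding component_def by (auto intro: rtrancl_trans)
qed

lemma component_insert:
  assumes R: "sym R"
  shows "component (R \<union> {(u, v), (v, u)}) x =
    (if x \<in> component R u \<union> component R v then component R u \<union> component R v else component R x)"
proof -
  let ?R = "R \<union> {(u, v), (v, u)}" and ?S = "component R u \<union> component R v"
  have R': "sym ?R" using R by (auto simp: sym_def)
  have mono: "component R y \<subseteq> component ?R y" for y
    unfolding component_def by (intro Image_mono rtrancl_mono) auto
  show ?thesis
  proof (cases "x \<in> ?S")
    case True
    have "component ?R x \<subseteq> ?S"
    proof (rule component_closed[OF True])
      show "?R `` ?S \<subseteq> ?S" by (auto intro: component_step)
    qed
    moreover have "v \<in> component ?R u" by (rule component_step[OF component_self]) simp
    then have e: "component ?R v = component ?R u" by (rule component_sym[OF R'])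
    then have S: "?S \<subseteq> component ?R u" using mono[of u] mono[of v] by auto
    then have "component ?R x = component ?R u" using True by (intro component_sym[OF R']) auto
    ultimately show ?thesis using S True by auto
  next
    case False
    have "u \<notin> component R x" "v \<notin> component R x" using False component_sym[OF R] component_self by fastforce+
    then have "component ?R x \<subseteq> component R x" by (intro component_closed) (auto intro: component_step)
    then show ?thesis using mono[of x] False by auto
  qed
qed

lemma component_image_insert:
  assumes R: "sym R" and V: "u \<in> V" "v \<in> V"
  shows "component (R \<union> {(u, v), (v, u)}) ` V = insert (component R u \<union> component R v) (component R ` V - {component R u, component R v})"
proof -
  let ?R = "R \<union> {(u, v), (v, u)}" and ?S = "component R u \<union> component R v"
  let ?K = "component R ` V - {component R u, component R v}"
  show ?thesis
  proof (intro equalityI subsetI)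
    fix K assume "K \<in> component ?R ` V"
    then obtain x where x: "x \<in> V" "K = component ?R x" by auto
    show "K \<in> insert ?S ?K"
    proof (cases "x \<in> ?S")
      case True
      then show ?thesis using x component_insert[OF R, of u v x] by simp
    next
      case False
      have "component R x \<noteq> component R u" "component R x \<noteq> component R v" using False component_self[of x R] by auto
      then show ?thesis using x component_insert[OF R, of u v x] False by simp
    qed
  next
    fix K assume "K \<in> insert ?S ?K"
    then consider "K = ?S" | x where "x \<in> V" "K = component R x" "K \<noteq> component R u" "K \<noteq> component R v" by auto
    then show "K \<in> component ?R ` V"
    proof cases
      case 1
      have "component ?R u = ?S" using component_insert[OF R, of u v u] by simp
      then show ?thesis using 1 V by (intro image_eqI[of _ _ u]) auto
    next
      case 2
      have "x \<notin> ?S" using 2 component_sym[OF R] by blast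
      then show ?thesis using 2 component_insert[OF R, of u v x] by (intro image_eqI[of _ _ x]) auto
    qed
  qed
qed

lemma component_union_new:
  assumes R: "sym R"
  shows "component R u \<union> component R v \<notin> component R ` V - {component R u, component R v}"
proof
  assume "component R u \<union> component R v \<in> component R ` V - {component R u, component R v}"
  then obtain x where x: "component R u \<union> component R v = component R x" "component R x \<noteq> component R u" by auto
  have "u \<in> component R x" using x(1) component_self[of u R] by auto
  from component_sym[OF R this] x(2) show False by simp
qed

lemma num_comps_insert:
  assumes R: "sym R" and V: "finite V" "u \<in> V" "v \<in> V" and n: "v \<notin> component R u"
  shows "num_comps V R = num_comps V (R \<union> {(u, v), (v, u)}) + 1"
proof -
  let ?K = "component R ` V - {component R u, component R v}"
  have ne: "component R u \<noteq> component R v" using n component_self[of v R] by auto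
  have "num_comps V (R \<union> {(u, v), (v, u)}) = card ?K + 1"
    unfolding num_comps_def component_image_insert[OF R V(2,3)] using V(1) component_union_new[OF R, of u v V] by simp
  moreover have "card ?K = card (component R ` V) - 2"
    using V ne by (subst card_Diff_subset) auto
  moreover have "card {component R u, component R v} \<le> card (component R ` V)" using V by (intro card_mono) auto
  ultimately show ?thesis using ne unfolding num_comps_def by simp
qed

lemma component_insert_same:
  assumes R: "sym R" and n: "v \<in> component R u"
  shows "component (R \<union> {(u, v), (v, u)}) = component R"
proof
  fix x
  have uv: "component R v = component R u" by (rule component_sym[OF R n])
  show "component (R \<union> {(u, v), (v, u)}) x = component R x"
  proof (cases "x \<in> component R u")
    case True
    then have "component R x = component R u" by (rule component_sym[OF R])
    then show ?thesis using component_insert[OF R, of u v x] uv True by simp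
  next
    case False
    then show ?thesis using component_insert[OF R, of u v x] uv by simp
  qed
qed

text \<open>Starting from \<open>card V\<close> singletons, each edge lowers the number of
  components by at most one.\<close>

lemma card_le_num_comps:
  assumes "finite F" "F \<subseteq> V \<times> V" "finite V"
  shows "card V \<le> num_comps V (F \<union> F\<inverse>) + card F"
  using assms(1,2)
proof (induction rule: finite_induct)
  case empty
  have "component {} x = {x}" for x :: 'a by (auto simp: component_def)
  then show ?case by (simp add: num_comps_def inj_on_def card_image)
next
  case (insert e F)
  obtain u v where e: "e = (u, v)" by (cases e)
  have s: "sym (F \<union> F\<inverse>)" by (auto simp: sym_def)
  have eq: "insert e F \<union> (insert e F)\<inverse> = (F \<union> F\<inverse>) \<union> {(u, v), (v, u)}" unfolding e by auto
  have "num_comps V (F \<union> F\<inverse>) \<le> num_comps V (insert e F \<union> (insert e F)\<inverse>) + 1"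
  proof (cases "v \<in> component (F \<union> F\<inverse>) u")
    case True
    show ?thesis unfolding eq num_comps_def component_insert_same[OF s True] by simp
  next
    case False
    show ?thesis unfolding eq using num_comps_insert[OF s assms(3) _ _ False] insert.prems e by simp
  qed
  then show ?case using insert by simp
qed

text \<open>Used for the intersection graph of the orbits of two permutations and, in the colouring
  argument, for a two-coloured component.\<close>

lemma connected_card_le:
  assumes "finite F" "F \<subseteq> V \<times> V" "finite V" and c: "\<And>u v. u \<in> V \<Longrightarrow> v \<in> V \<Longrightarrow> (u, v) \<in> (F \<union> F\<inverse>)\<^sup>*"
  shows "card V \<le> card F + 1"
proof -
  have s: "sym (F \<union> F\<inverse>)" by (auto simp: sym_def)
  have "num_comps V (F \<union> F\<inverse>) \<le> 1"
  proof (cases "V = {}")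
    case False
    then obtain u where u: "u \<in> V" by auto
    have "component (F \<union> F\<inverse>) v = component (F \<union> F\<inverse>) u" if v: "v \<in> V" for v
      by (rule component_sym[OF s]) (use c[OF u v] in \<open>simp add: component_def\<close>)
    then have "component (F \<union> F\<inverse>) ` V \<subseteq> {component (F \<union> F\<inverse>) u}" by blast
    then show ?thesis unfolding num_comps_def using card_mono[of "{component (F \<union> F\<inverse>) u}"] by simp
  qed (simp add: num_comps_def)
  then show ?thesis using card_le_num_comps[OF assms(1-3)] by linarith
qed

section \<open>Exchanges between two permutations\<close>

text \<open>Only forward powers are taken. On a finite set a permutation returns to its starting
  point, so these sets are the full cycles and inverses are avoided.\<close>

definition cls :: "('a \<Rightarrow> 'a) \<Rightarrow> 'a \<Rightarrow> 'a set" where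
  "cls f x = range (\<lambda>k. (f ^^ k) x)"

lemma cls_self [simp]: "x \<in> cls f x"
  unfolding cls_def by (metis funpow_0 rangeI)

lemma cls_step: "y \<in> cls f x \<Longrightarrow> f y \<in> cls f x"
  unfolding cls_def by (auto intro: range_eqI[where x = "Suc _"])

lemma cls_funpow: "(f ^^ k) x \<in> cls f x"
  unfolding cls_def by blast

lemma cls_induct [consumes 1, case_names base step]:
  assumes "y \<in> cls f x" "P x" "\<And>z. z \<in> cls f x \<Longrightarrow> P z \<Longrightarrow> P (f z)"
  shows "P y"
proof -
  have "P ((f ^^ k) x)" for k
    by (induction k) (auto simp: assms cls_funpow)
  then show ?thesis using assms(1) unfolding cls_def by auto
qed

lemma cls_subset: "x \<in> S \<Longrightarrow> (\<And>z. z \<in> S \<Longrightarrow> f z \<in> S) \<Longrightarrow> cls f x \<subseteq> S"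
  by (rule subsetI, erule cls_induct) auto

definition num_cls :: "('a \<Rightarrow> 'a) \<Rightarrow> 'a set \<Rightarrow> nat" where
  "num_cls f X = card (cls f ` X)"

lemma bij_betw_in: "bij_betw f X X \<Longrightarrow> x \<in> X \<Longrightarrow> f x \<in> X"
  by (auto simp: bij_betw_def)

lemma cls_in: "bij_betw f X X \<Longrightarrow> x \<in> X \<Longrightarrow> cls f x \<subseteq> X"
  by (rule cls_subset) (auto simp: bij_betw_in)

lemma funpow_in: "bij_betw f X X \<Longrightarrow> x \<in> X \<Longrightarrow> (f ^^ k) x \<in> X"
  using cls_in cls_funpow by fastforce

lemma cls_return:
  assumes "finite X" "bij_betw f X X" "x \<in> X"
  shows "\<exists>k>0. (f ^^ k) x = x"
proof -
  have "\<not> inj (\<lambda>k. (f ^^ k) x)"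
  proof
    assume "inj (\<lambda>k. (f ^^ k) x)"
    then have "infinite (cls f x)" unfolding cls_def by (simp add: finite_image_iff)
    then show False using cls_in[OF assms(2,3)] assms(1) finite_subset by blast
  qed
  then obtain i j where ij: "i < j" "(f ^^ i) x = (f ^^ j) x"
    unfolding inj_def by (metis linorder_neqE_nat)
  have "(f ^^ i) x = (f ^^ i) ((f ^^ (j - i)) x)"
    using ij by (metis comp_apply funpow_add le_add_diff_inverse less_imp_le_nat)
  moreover have "inj_on (f ^^ i) X"
    using bij_betw_funpow[OF assms(2)] by (auto simp: bij_betw_def)
  ultimately have "(f ^^ (j - i)) x = x"
    using funpow_in[OF assms(2,3)] assms(3) by (metis inj_on_def)
  then show ?thesis using ij by (intro exI[of _ "j - i"]) auto
qed

lemma cls_eqI: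
  assumes "finite X" "bij_betw f X X" "x \<in> X" "y \<in> cls f x"
  shows "cls f y = cls f x"
proof
  show "cls f y \<subseteq> cls f x" using assms(4) by (rule cls_subset) (rule cls_step)
  obtain m where m: "y = (f ^^ m) x" using assms(4) unfolding cls_def by auto
  obtain k where k: "k > 0" "(f ^^ k) x = x" using cls_return[OF assms(1-3)] by auto
  have "(f ^^ (m * k)) x = x"
    using k funpow_mod_eq[of k f x "m * k"] by simp
  \<comment> \<open>\<open>m * k\<close> is a multiple of the return time and at least
    \<open>m\<close>, so the remaining \<open>m * k - m\<close> steps lead from \<open>y\<close>
    back to \<open>x\<close>.\<close>
  moreover have "m * k = (m * k - m) + m" using k by (cases k) auto
  ultimately have "(f ^^ (m * k - m)) y = x"
    unfolding m by (metis comp_apply funpow_add)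
  then have "x \<in> cls f y" by (metis cls_funpow)
  then show "cls f x \<subseteq> cls f y" by (rule cls_subset) (rule cls_step)
qed

lemma cls_cycle2: "f x = y \<Longrightarrow> f y = x \<Longrightarrow> cls f x = {x, y}"
  using cls_step[of x f x] by (intro equalityI cls_subset) auto

lemma cls_cycle3: "f x = y \<Longrightarrow> f y = z \<Longrightarrow> f z = x \<Longrightarrow> cls f x = {x, y, z}"
  using cls_step[of x f x] cls_step[of y f x] by (intro equalityI cls_subset) auto

text \<open>\<open>\<eta>'\<close> arises from \<open>\<eta>\<close> by inverting the two-coloured cycle of \<open>\<xi>\<close> on \<open>Z\<close>.\<close>

definition swapped :: "'a set \<Rightarrow> ('a \<Rightarrow> 'a) \<Rightarrow> ('a \<Rightarrow> 'a) \<Rightarrow> 'a set \<Rightarrow> ('a \<Rightarrow> 'a) \<Rightarrow> bool" where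
  "swapped X \<xi> \<eta> Z \<eta>' \<longleftrightarrow> bij_betw \<eta>' X X \<and> (\<forall>a\<in>Z. \<eta>' (\<xi> a) = \<eta> a) \<and> (\<forall>a\<in>X - Z. \<eta>' a = \<eta> a)"

section \<open>The number of orbits after an exchange\<close>

locale swap =
  fixes X :: "'a set" and \<xi> \<eta> \<eta>' :: "'a \<Rightarrow> 'a" and w :: 'a and Z
  assumes fin: "finite X" and xi: "bij_betw \<xi> X X" and eta: "bij_betw \<eta> X X"
    and w: "w \<in> X" and Z: "Z = cls \<xi> w" and sw: "swapped X \<xi> \<eta> Z \<eta>'"
begin

lemma eta': "bij_betw \<eta>' X X"
  using sw by (auto simp: swapped_def)

lemma ZX: "Z \<subseteq> X"
  unfolding Z by (rule cls_in[OF xi w])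

lemma ZX': "a \<in> Z \<Longrightarrow> a \<in> X"
  using ZX by auto

text \<open>The \<open>\<eta>'\<close>-path from \<open>\<xi> a\<close> goes to
  \<open>\<eta> a\<close> and then copies the \<open>\<eta>\<close>-path of \<open>a\<close> until
  this first comes back to \<open>Z\<close>, at \<open>b\<close>. If the first return is
  \<open>a\<close> itself, the whole \<open>\<eta>\<close>-orbit has been traversed without meeting
  another point of \<open>Z\<close>.\<close>

lemma first_return:
  assumes a: "a \<in> Z"
  shows "\<exists>b. b \<in> Z \<and> b \<in> cls \<eta> a \<and> cls \<eta>' b = cls \<eta>' (\<xi> a) \<and> (b = a \<longrightarrow> Z \<inter> cls \<eta> a = {a})"
proof -
  define j where "j = (LEAST j. j > 0 \<and> (\<eta> ^^ j) a \<in> Z)"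
  have aX: "a \<in> X" using a ZX by auto
  have ex: "\<exists>j. j > 0 \<and> (\<eta> ^^ j) a \<in> Z"
    using cls_return[OF fin eta aX] a by metis
  have j: "j > 0" "(\<eta> ^^ j) a \<in> Z" using LeastI_ex[OF ex] unfolding j_def by auto
  have nj: "(\<eta> ^^ i) a \<notin> Z" if "0 < i" "i < j" for i
    using not_less_Least[of i] that unfolding j_def by auto
  have xa: "\<xi> a \<in> X" using xi aX by (rule bij_betw_in)
  have walk: "(\<eta>' ^^ Suc i) (\<xi> a) = (\<eta> ^^ Suc i) a" if "Suc i \<le> j" for i
    using that
  proof (induction i)
    case 0
    then show ?case using sw a by (auto simp: swapped_def)
  next
    case (Suc i)
    have "(\<eta> ^^ Suc i) a \<in> X - Z" using nj[of "Suc i"] Suc funpow_in[OF eta aX, of "Suc i"] by auto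
    then have "\<eta>' ((\<eta> ^^ Suc i) a) = \<eta> ((\<eta> ^^ Suc i) a)" using sw unfolding swapped_def by blast
    then show ?case using Suc by simp
  qed
  show ?thesis
  proof (intro exI[of _ "(\<eta> ^^ j) a"] conjI impI)
    show "(\<eta> ^^ j) a \<in> Z" by fact
    show "(\<eta> ^^ j) a \<in> cls \<eta> a" by (rule cls_funpow)
    have "(\<eta>' ^^ j) (\<xi> a) = (\<eta> ^^ j) a" using walk[of "j - 1"] j by simp
    then have "(\<eta> ^^ j) a \<in> cls \<eta>' (\<xi> a)" by (metis cls_funpow)
    then show "cls \<eta>' ((\<eta> ^^ j) a) = cls \<eta>' (\<xi> a)" by (rule cls_eqI[OF fin eta' xa])
    assume ja: "(\<eta> ^^ j) a = a"
    show "Z \<inter> cls \<eta> a = {a}"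
    proof (intro equalityI subsetI)
      fix c assume c: "c \<in> Z \<inter> cls \<eta> a"
      then obtain m where m: "c = (\<eta> ^^ m) a" unfolding cls_def by auto
      then have m': "c = (\<eta> ^^ (m mod j)) a" using funpow_mod_eq[OF ja] by simp
      have "m mod j < j" using j by simp
      then have "m mod j = 0" using nj[of "m mod j"] c m' by auto
      then show "c \<in> {a}" using m' by simp
    qed (use a in auto)
  qed
qed

lemma step_single:
  assumes "a \<in> Z" "\<And>c. c \<in> Z \<Longrightarrow> cls \<eta> c = cls \<eta> a \<Longrightarrow> c = a"
  shows "cls \<eta>' (\<xi> a) = cls \<eta>' a"
proof -
  obtain b where b: "b \<in> Z" "b \<in> cls \<eta> a" "cls \<eta>' b = cls \<eta>' (\<xi> a)"
    using first_return[OF assms(1)] by auto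
  then have "b = a" using assms(2) cls_eqI[OF fin eta ZX'[OF assms(1)]] by blast
  then show ?thesis using b by simp
qed

lemma step_pair:
  assumes "a \<in> Z" "b \<in> Z" "a \<noteq> b" "cls \<eta> a = cls \<eta> b"
    "\<And>c. c \<in> Z \<Longrightarrow> cls \<eta> c = cls \<eta> a \<Longrightarrow> c = a \<or> c = b"
  shows "cls \<eta>' (\<xi> a) = cls \<eta>' b"
proof -
  obtain c where c: "c \<in> Z" "c \<in> cls \<eta> a" "cls \<eta>' c = cls \<eta>' (\<xi> a)" "c = a \<Longrightarrow> Z \<inter> cls \<eta> a = {a}"
    using first_return[OF assms(1)] by auto
  have "b \<in> Z \<inter> cls \<eta> a" using assms by simp
  then have "c \<noteq> a" using c(4) assms(3) by (metis singletonD)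
  moreover have "c = a \<or> c = b" using assms(5) c cls_eqI[OF fin eta ZX'[OF assms(1)]] by blast
  ultimately show ?thesis using c by simp
qed

text \<open>An orbit of \<open>\<eta>'\<close> either passes through \<open>Z\<close>, and
  \<open>P\<close> represents all of these, or it is an old orbit disjoint from
  \<open>Z\<close>.\<close>

lemma num_cls_le:
  assumes P: "finite P" "\<And>x. x \<in> Z \<Longrightarrow> \<exists>y\<in>P. cls \<eta>' x = cls \<eta>' y"
  shows "num_cls \<eta>' X + card (cls \<eta> ` Z) \<le> num_cls \<eta> X + card P"
proof -
  have sub: "cls \<eta>' ` X \<subseteq> cls \<eta>' ` P \<union> (cls \<eta> ` X - cls \<eta> ` Z)"
  proof
    fix K assume "K \<in> cls \<eta>' ` X"
    then obtain x where x: "x \<in> X" "K = cls \<eta>' x" by auto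
    show "K \<in> cls \<eta>' ` P \<union> (cls \<eta> ` X - cls \<eta> ` Z)"
    proof (cases "cls \<eta> x \<inter> Z = {}")
      case True
      have same: "(\<eta>' ^^ k) x = (\<eta> ^^ k) x" for k
      proof (induction k)
        case (Suc k)
        have "(\<eta> ^^ k) x \<in> X - Z" using True cls_funpow[of k \<eta> x] funpow_in[OF eta x(1), of k]
          by (meson DiffI disjoint_iff)
        then show ?case using Suc sw by (simp add: swapped_def)
      qed simp
      have "cls \<eta>' x = cls \<eta> x" unfolding cls_def same ..
      moreover have "cls \<eta> x \<notin> cls \<eta> ` Z" using True by (metis IntI cls_self empty_iff imageE)
      ultimately show ?thesis using x by auto
    next
      case False
      then have ex: "\<exists>j. (\<eta> ^^ j) x \<in> Z" unfolding cls_def by auto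
      define j where "j = (LEAST j. (\<eta> ^^ j) x \<in> Z)"
      have j: "(\<eta> ^^ j) x \<in> Z" unfolding j_def by (rule LeastI_ex[OF ex])
      have nj: "(\<eta> ^^ i) x \<notin> Z" if "i < j" for i
        using not_less_Least[of i] that unfolding j_def by auto
      have same: "i \<le> j \<Longrightarrow> (\<eta>' ^^ i) x = (\<eta> ^^ i) x" for i
      proof (induction i)
        case (Suc k)
        have "(\<eta> ^^ k) x \<in> X - Z"
          using nj[of k] funpow_in[OF eta x(1), of k] Suc.prems by (meson DiffI Suc_le_lessD)
        then show ?case using Suc sw by (simp add: swapped_def)
      qed simp
      have "(\<eta> ^^ j) x \<in> cls \<eta>' x" using same[of j] by (metis cls_funpow order_refl)
      then have "cls \<eta>' ((\<eta> ^^ j) x) = cls \<eta>' x" by (rule cls_eqI[OF fin eta' x(1)])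
      then show ?thesis using P(2)[OF j] x(2) by (metis UnI1 imageI)
    qed
  qed
  have fX: "finite (cls \<eta> ` X)" using fin by simp
  have ss: "cls \<eta> ` Z \<subseteq> cls \<eta> ` X" using ZX by auto
  have "num_cls \<eta>' X \<le> card (cls \<eta>' ` P \<union> (cls \<eta> ` X - cls \<eta> ` Z))"
    unfolding num_cls_def using P(1) fX by (intro card_mono[OF _ sub]) auto
  also have "\<dots> \<le> card (cls \<eta>' ` P) + card (cls \<eta> ` X - cls \<eta> ` Z)" by (rule card_Un_le)
  also have "\<dots> \<le> card P + (card (cls \<eta> ` X) - card (cls \<eta> ` Z))"
    using card_image_le[OF P(1)] fX ss by (simp add: card_Diff_subset finite_subset)
  finally show ?thesis using card_mono[OF fX ss] unfolding num_cls_def by linarith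
qed

lemma Z_induct [consumes 2, case_names base step]:
  assumes "y \<in> Z" "x \<in> Z" "P x" "\<And>z. z \<in> Z \<Longrightarrow> P z \<Longrightarrow> P (\<xi> z)"
  shows "P y"
proof -
  have e: "cls \<xi> x = Z" using assms(2) unfolding Z by (rule cls_eqI[OF fin xi w])
  have "y \<in> cls \<xi> x" using e assms(1) by simp
  then show ?thesis
  proof (induction rule: cls_induct)
    case (step z)
    then show ?case using assms(4) e by blast
  qed (rule assms(3))
qed

text \<open>By \<open>step_single\<close>, going round the \<open>\<xi>\<close>-cycle never changes
  the \<open>\<eta>'\<close>-orbit, so all orbits through \<open>Z\<close> are fused into
  one.\<close>

lemma num_cls_inj:
  assumes inj: "inj_on (cls \<eta>) Z"
  shows "num_cls \<eta>' X + card Z \<le> num_cls \<eta> X + 1"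
proof -
  have wZ: "w \<in> Z" unfolding Z by simp
  have "cls \<eta>' x = cls \<eta>' w" if "x \<in> Z" for x
    using that wZ
  proof (induction rule: Z_induct)
    case (step z)
    have "cls \<eta>' (\<xi> z) = cls \<eta>' z"
      by (rule step_single) (use step inj in \<open>auto simp: inj_on_def\<close>)
    then show ?case using step by simp
  qed simp
  then show ?thesis using num_cls_le[of "{w}"] card_image[OF inj] by auto
qed

text \<open>With a single coincidence, the walk round \<open>Z\<close> meets only the new orbits of
  \<open>x\<close> and \<open>y\<close>, so at most two orbits replace \<open>card Z - 1\<close> old
  ones.\<close>

lemma num_cls_pair:
  assumes xy: "x \<in> Z" "y \<in> Z" "x \<noteq> y" "cls \<eta> x = cls \<eta> y" and inj: "inj_on (cls \<eta>) (Z - {y})"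
  shows "num_cls \<eta>' X + card Z \<le> num_cls \<eta> X + 3"
proof -
  have I: "a \<in> Z \<Longrightarrow> b \<in> Z \<Longrightarrow> a \<noteq> y \<Longrightarrow> b \<noteq> y \<Longrightarrow> cls \<eta> a = cls \<eta> b \<Longrightarrow> a = b" for a b
    using inj by (auto simp: inj_on_def)
  have xyc: "c = x \<or> c = y" if "c \<in> Z" "cls \<eta> c = cls \<eta> x" for c
    using I[of c x] that xy by (cases "c = y") auto
  have sx: "cls \<eta>' (\<xi> x) = cls \<eta>' y"
    by (rule step_pair) (use xy xyc in auto)
  have sy: "cls \<eta>' (\<xi> y) = cls \<eta>' x"
    by (rule step_pair) (use xy xyc in auto)
  have s: "cls \<eta>' (\<xi> a) = cls \<eta>' a" if a: "a \<in> Z" "a \<noteq> x" "a \<noteq> y" for a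
  proof (rule step_single[OF a(1)])
    fix c assume "c \<in> Z" "cls \<eta> c = cls \<eta> a"
    then show "c = a" using I[of c a] I[of x a] a xy by (cases "c = y") auto
  qed
  have "cls \<eta>' a = cls \<eta>' x \<or> cls \<eta>' a = cls \<eta>' y" if "a \<in> Z" for a
    using that xy(1)
  proof (induction rule: Z_induct)
    case (step z)
    then show ?case using s[of z] sx sy by (cases "z = x \<or> z = y") auto
  qed auto
  then have *: "\<And>a. a \<in> Z \<Longrightarrow> \<exists>b\<in>{x, y}. cls \<eta>' a = cls \<eta>' b" by auto
  have "cls \<eta> y \<in> cls \<eta> ` (Z - {y})" using xy by (metis DiffI image_eqI singletonD)
  then have "cls \<eta> ` Z = cls \<eta> ` (Z - {y})" by blast
  then have "card (cls \<eta> ` Z) = card Z - 1" using card_image[OF inj] xy by simp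
  moreover have "card Z > 0" using xy(1) finite_subset[OF ZX fin] card_gt_0_iff by blast
  ultimately show ?thesis using num_cls_le[of "{x, y}", OF _ *] xy(3) by simp
qed

text \<open>The transition rules are exported along with the count, because for small
  \<open>Z\<close> the cyclic order of the four points decides which of the new orbits
  coincide.\<close>

lemma num_cls_two_pairs:
  assumes xy: "x \<in> Z" "y \<in> Z" "x \<noteq> y" "cls \<eta> x = cls \<eta> y"
    and uv: "u \<in> Z" "v \<in> Z" "u \<noteq> v" "cls \<eta> u = cls \<eta> v" "cls \<eta> x \<noteq> cls \<eta> u"
    and inj: "inj_on (cls \<eta>) (Z - {y, v})"
  shows "\<And>a. a \<in> Z \<Longrightarrow> a \<notin> {x, y, u, v} \<Longrightarrow> cls \<eta>' (\<xi> a) = cls \<eta>' a"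
    and "cls \<eta>' (\<xi> x) = cls \<eta>' y" and "cls \<eta>' (\<xi> y) = cls \<eta>' x"
    and "cls \<eta>' (\<xi> u) = cls \<eta>' v" and "cls \<eta>' (\<xi> v) = cls \<eta>' u"
    and "card (cls \<eta> ` Z) + 2 = card Z"
    and "num_cls \<eta>' X + card Z \<le> num_cls \<eta> X + 5"
proof -
  have I: "a \<in> Z \<Longrightarrow> b \<in> Z \<Longrightarrow> a \<notin> {y, v} \<Longrightarrow> b \<notin> {y, v} \<Longrightarrow> cls \<eta> a = cls \<eta> b \<Longrightarrow> a = b" for a b
    by (rule inj_onD[OF inj]) auto
  have xyc: "c = x \<or> c = y" if "c \<in> Z" "cls \<eta> c = cls \<eta> x" for c
  proof -
    have "c \<noteq> v" "x \<noteq> v" using that(2) uv(4,5) by metis+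
    then show ?thesis using I[OF that(1) xy(1) _ _ that(2)] xy(3) by blast
  qed
  have uvc: "c = u \<or> c = v" if "c \<in> Z" "cls \<eta> c = cls \<eta> u" for c
  proof -
    have "c \<noteq> y" "u \<noteq> y" using that(2) xy(4) uv(5) by metis+
    then show ?thesis using I[OF that(1) uv(1) _ _ that(2)] uv(3) by blast
  qed
  show sx: "cls \<eta>' (\<xi> x) = cls \<eta>' y"
    by (rule step_pair) (use xy(1-4) xyc in auto)
  show sy: "cls \<eta>' (\<xi> y) = cls \<eta>' x"
    by (rule step_pair) (use xy(1-4) xyc in auto)
  show su: "cls \<eta>' (\<xi> u) = cls \<eta>' v"
    by (rule step_pair) (use uv(1-4) uvc in auto)
  show sv: "cls \<eta>' (\<xi> v) = cls \<eta>' u"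
    by (rule step_pair) (use uv(1-4) uvc in auto)
  show s: "cls \<eta>' (\<xi> a) = cls \<eta>' a" if a: "a \<in> Z" "a \<notin> {x, y, u, v}" for a
  proof (rule step_single[OF a(1)])
    fix c assume c: "c \<in> Z" "cls \<eta> c = cls \<eta> a"
    have "c \<noteq> y" using xyc[OF a(1)] a(2) c xy(4) by (metis insertCI)
    moreover have "c \<noteq> v" using uvc[OF a(1)] a(2) c uv(4) by (metis insertCI)
    ultimately show "c = a" using I[OF c(1) a(1) _ _ c(2)] a(2) by blast
  qed
  have four: "\<exists>b\<in>{x, y, u, v}. cls \<eta>' a = cls \<eta>' b" if "a \<in> Z" for a
    using that xy(1)
  proof (induction rule: Z_induct)
    case (step z)
    show ?case
    proof (cases "z \<in> {x, y, u, v}")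
      case True
      then consider "z = x" | "z = y" | "z = u" | "z = v" by blast
      then show ?thesis by cases (use sx sy su sv in blast)+
    next
      case False
      then show ?thesis using step s[OF step(1)] by simp
    qed
  qed auto
  \<comment> \<open>Starting at \<open>x\<close>, the walk round \<open>Z\<close> can leave the
    orbits of \<open>x\<close> and \<open>y\<close> only at \<open>u\<close> or \<open>v\<close>.
    Since it does reach \<open>u\<close>, the two pairs have a new orbit in common, and three
    representatives suffice.\<close>
  have two: "\<exists>a\<in>{x, y}. \<exists>b\<in>{u, v}. cls \<eta>' a = cls \<eta>' b"
  proof (rule ccontr)
    assume n: "\<not> ?thesis"
    have "cls \<eta>' a = cls \<eta>' x \<or> cls \<eta>' a = cls \<eta>' y" if "a \<in> Z" for a
      using that xy(1)
    proof (induction rule: Z_induct)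
      case (step z)
      then have "z \<notin> {u, v}" using n by auto
      then consider "z = x" | "z = y" | "z \<notin> {x, y, u, v}" by blast
      then show ?case by cases (use sx sy s[OF step(1)] step in simp_all)
    qed auto
    from this[OF uv(1)] show False using n by (metis insertCI)
  qed
  then obtain a b where ab: "a \<in> {x, y}" "b \<in> {u, v}" "cls \<eta>' a = cls \<eta>' b" by blast
  have three: "\<exists>c\<in>{x, y, u, v} - {b}. cls \<eta>' z = cls \<eta>' c" if zZ: "z \<in> Z" for z
  proof -
    obtain c where c: "c \<in> {x, y, u, v}" "cls \<eta>' z = cls \<eta>' c" using four[OF zZ] by blast
    have "a \<noteq> b" using ab(1,2) xy(4) uv(4,5) by blast
    then have a: "a \<in> {x, y, u, v} - {b}" using ab(1) by blast
    show ?thesis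
    proof (cases "c = b")
      case True
      have "cls \<eta>' z = cls \<eta>' a" using c(2) ab(3) True by simp
      then show ?thesis using a by (rule bexI)
    next
      case False
      then have "c \<in> {x, y, u, v} - {b}" using c(1) by simp
      with c(2) show ?thesis by (rule bexI)
    qed
  qed
  have d: "cls \<eta> ` Z = cls \<eta> ` (Z - {y, v})"
  proof (intro equalityI subsetI)
    fix K assume "K \<in> cls \<eta> ` Z"
    then obtain a where a: "a \<in> Z" "K = cls \<eta> a" by auto
    have "x \<noteq> v" "u \<noteq> y" using xy(4) uv(4,5) by metis+
    then have xu: "x \<in> Z - {y, v}" "u \<in> Z - {y, v}" using xy uv by auto
    consider "a = y" | "a = v" | "a \<in> Z - {y, v}" using a by blast
    then show "K \<in> cls \<eta> ` (Z - {y, v})"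
      by cases (use xu a(2) xy(4) uv(4) in \<open>metis imageI\<close>)+
  qed auto
  have yv: "y \<noteq> v" using xy(4) uv(4,5) by metis
  have "card {y, v} \<le> card Z" using xy uv finite_subset[OF ZX fin] by (intro card_mono) auto
  then show c: "card (cls \<eta> ` Z) + 2 = card Z"
    using d card_image[OF inj] xy(2) uv(2) yv by (simp add: card_Diff_subset)
  have "card ({x, y, u, v} - {b}) < card {x, y, u, v}" using ab(2) by (intro psubset_card_mono) auto
  moreover have "card {x, y, u, v} \<le> 4" by (simp add: card_insert_if)
  moreover have "num_cls \<eta>' X + card (cls \<eta> ` Z) \<le> num_cls \<eta> X + card ({x, y, u, v} - {b})"
    by (rule num_cls_le) (simp, erule three)
  ultimately show "num_cls \<eta>' X + card Z \<le> num_cls \<eta> X + 5" using c by linarith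
qed

end

lemma orbit_enum:
  assumes "finite X" "bij_betw f X X" "x \<in> X"
  shows "(f ^^ card (cls f x)) x = x"
    and "cls f x = (\<lambda>k. (f ^^ k) x) ` {..<card (cls f x)}"
    and "inj_on (\<lambda>k. (f ^^ k) x) {..<card (cls f x)}"
proof -
  define m where "m = (LEAST k. k > 0 \<and> (f ^^ k) x = x)"
  have ex: "\<exists>k. k > 0 \<and> (f ^^ k) x = x" using cls_return[OF assms] by auto
  have m: "m > 0" "(f ^^ m) x = x" using LeastI_ex[OF ex] unfolding m_def by auto
  have nm: "(f ^^ k) x \<noteq> x" if "0 < k" "k < m" for k
    using not_less_Least[of k] that unfolding m_def by auto
  have eq: "cls f x = (\<lambda>k. (f ^^ k) x) ` {..<m}"
  proof
    show "cls f x \<subseteq> (\<lambda>k. (f ^^ k) x) ` {..<m}"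
    proof
      fix y assume "y \<in> cls f x"
      then obtain k where "y = (f ^^ k) x" unfolding cls_def by auto
      then have "y = (f ^^ (k mod m)) x" using funpow_mod_eq[OF m(2)] by simp
      moreover have "k mod m \<in> {..<m}" using m(1) by simp
      ultimately show "y \<in> (\<lambda>k. (f ^^ k) x) ` {..<m}" by blast
    qed
    show "(\<lambda>k. (f ^^ k) x) ` {..<m} \<subseteq> cls f x" unfolding cls_def by auto
  qed
  have inj: "inj_on (\<lambda>k. (f ^^ k) x) {..<m}"
  proof (rule linorder_inj_onI)
    fix i j assume ij: "i < j" "i \<in> {..<m}" "j \<in> {..<m}"
    show "(f ^^ i) x \<noteq> (f ^^ j) x"
    proof
      assume "(f ^^ i) x = (f ^^ j) x"
      then have "(f ^^ i) x = (f ^^ i) ((f ^^ (j - i)) x)"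
        using ij by (metis comp_apply funpow_add le_add_diff_inverse less_imp_le_nat)
      moreover have "inj_on (f ^^ i) X"
        using bij_betw_funpow[OF assms(2)] by (auto simp: bij_betw_def)
      ultimately have "(f ^^ (j - i)) x = x"
        using funpow_in[OF assms(2,3)] assms(3) by (metis inj_on_def)
      then show False using nm[of "j - i"] ij by (simp add: less_imp_diff_less)
    qed
  qed auto
  have "card (cls f x) = m" using card_image[OF inj] eq by simp
  then show "(f ^^ card (cls f x)) x = x" "cls f x = (\<lambda>k. (f ^^ k) x) ` {..<card (cls f x)}"
    "inj_on (\<lambda>k. (f ^^ k) x) {..<card (cls f x)}" using m eq inj by auto
qed

lemma orbit4:
  assumes "finite X" "bij_betw f X X" "x \<in> X" "card (cls f x) = 4"
  shows "cls f x = {x, f x, f (f x), f (f (f x))}" "f (f (f (f x))) = x"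
    "distinct [x, f x, f (f x), f (f (f x))]"
proof -
  have l: "{..<4::nat} = {0, 1, 2, 3}" by auto
  show "cls f x = {x, f x, f (f x), f (f (f x))}"
    using orbit_enum(2)[OF assms(1-3)] unfolding assms(4) l by (simp add: numeral_eq_Suc)
  show "f (f (f (f x))) = x"
    using orbit_enum(1)[OF assms(1-3)] unfolding assms(4) by (simp add: numeral_eq_Suc)
  show "distinct [x, f x, f (f x), f (f (f x))]"
    using orbit_enum(3)[OF assms(1-3)] unfolding assms(4) l by (auto simp: numeral_eq_Suc)
qed

lemma orbit5:
  assumes "finite X" "bij_betw f X X" "x \<in> X" "card (cls f x) = 5"
  shows "cls f x = {x, f x, f (f x), f (f (f x)), f (f (f (f x)))}" "f (f (f (f (f x)))) = x"
    "distinct [x, f x, f (f x), f (f (f x)), f (f (f (f x)))]"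
proof -
  have l: "{..<5::nat} = {0, 1, 2, 3, 4}" by auto
  show "cls f x = {x, f x, f (f x), f (f (f x)), f (f (f (f x)))}"
    using orbit_enum(2)[OF assms(1-3)] unfolding assms(4) l by (simp add: numeral_eq_Suc)
  show "f (f (f (f (f x)))) = x"
    using orbit_enum(1)[OF assms(1-3)] unfolding assms(4) by (simp add: numeral_eq_Suc)
  show "distinct [x, f x, f (f x), f (f (f x)), f (f (f (f x)))]"
    using orbit_enum(3)[OF assms(1-3)] unfolding assms(4) l by (auto simp: numeral_eq_Suc)
qed

lemma pairings:
  assumes "{a, b, c, d} = {x, y, u, v}" "distinct [a, b, c, d]" "distinct [x, y, u, v]"
    and "k x = k y" "k u = k v"
  shows "(k a = k b \<and> k c = k d) \<or> (k a = k c \<and> k b = k d) \<or> (k a = k d \<and> k b = k c)"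
proof -
  have "x = a \<or> x = b \<or> x = c \<or> x = d" "y = a \<or> y = b \<or> y = c \<or> y = d"
    "u = a \<or> u = b \<or> u = c \<or> u = d" "v = a \<or> v = b \<or> v = c \<or> v = d"
    using assms(1) by blast+
  then show ?thesis using assms(2-5) by (elim disjE; simp)
qed

text \<open>The intended maps come from three perfect matchings of a simple graph, hence no fixed
  points and no common values. Optimality is one-sided: only the number of
  \<open>\<eta>\<close>-orbits is compared, since an exchange along a \<open>\<xi>\<close>-cycle
  does not affect the cycles of \<open>\<xi>\<close>.\<close>

locale cycle_opt =
  fixes X :: "'a set" and \<xi> \<eta> :: "'a \<Rightarrow> 'a"
  assumes fin: "finite X" and xi: "bij_betw \<xi> X X" and eta: "bij_betw \<eta> X X"
    and xi_ne: "a \<in> X \<Longrightarrow> \<xi> a \<noteq> a" and eta_ne: "a \<in> X \<Longrightarrow> \<eta> a \<noteq> a"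
    and xi_eta: "a \<in> X \<Longrightarrow> \<xi> a \<noteq> \<eta> a"
    and opt: "w \<in> X \<Longrightarrow> \<exists>\<eta>'. swapped X \<xi> \<eta> (cls \<xi> w) \<eta>' \<and> num_cls \<eta> X \<le> num_cls \<eta>' X"
begin

lemma fin_cls: "w \<in> X \<Longrightarrow> finite (cls \<xi> w)"
  using cls_in[OF xi] fin finite_subset by blast

lemma opt_swap:
  assumes "w \<in> X"
  obtains \<eta>' where "swap X \<xi> \<eta> \<eta>' w (cls \<xi> w)" "num_cls \<eta> X \<le> num_cls \<eta>' X"
proof -
  obtain \<eta>' where "swapped X \<xi> \<eta> (cls \<xi> w) \<eta>'" "num_cls \<eta> X \<le> num_cls \<eta>' X"
    using opt[OF assms] by auto
  then show ?thesis using that fin xi eta assms by (auto simp: swap_def)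
qed

lemma card_ge2: "w \<in> X \<Longrightarrow> 2 \<le> card (cls \<xi> w)"
proof -
  assume w: "w \<in> X"
  have "card {w, \<xi> w} \<le> card (cls \<xi> w)"
    using cls_step[of w \<xi> w] fin_cls[OF w] by (intro card_mono) auto
  then show ?thesis using xi_ne[OF w] by (simp add: card_insert_if)
qed

lemma not_inj: "w \<in> X \<Longrightarrow> \<not> inj_on (cls \<eta>) (cls \<xi> w)"
proof
  assume w: "w \<in> X" and inj: "inj_on (cls \<eta>) (cls \<xi> w)"
  obtain \<eta>' where s: "swap X \<xi> \<eta> \<eta>' w (cls \<xi> w)" and le: "num_cls \<eta> X \<le> num_cls \<eta>' X"
    using opt_swap[OF w] .
  show False using swap.num_cls_inj[OF s inj] card_ge2[OF w] le by simp
qed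

lemma card_img_less: "w \<in> X \<Longrightarrow> card (cls \<eta> ` cls \<xi> w) < card (cls \<xi> w)"
  using not_inj[of w] fin_cls[of w] card_image_le[of "cls \<xi> w" "cls \<eta>"] eq_card_imp_inj_on[of "cls \<xi> w" "cls \<eta>"]
  by linarith

text \<open>If there were only one coincidence, the exchange would replace at least three orbits by
  at most two.\<close>

lemma card_img_le:
  assumes w: "w \<in> X" and c: "4 \<le> card (cls \<xi> w)"
  shows "card (cls \<eta> ` cls \<xi> w) + 2 \<le> card (cls \<xi> w)"
proof (rule ccontr)
  assume "\<not> ?thesis"
  then have d: "card (cls \<eta> ` cls \<xi> w) = card (cls \<xi> w) - 1" using card_img_less[OF w] by simp
  obtain x y where xy: "x \<in> cls \<xi> w" "y \<in> cls \<xi> w" "x \<noteq> y" "cls \<eta> x = cls \<eta> y"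
    using not_inj[OF w] unfolding inj_on_def by metis
  have "cls \<eta> y \<in> cls \<eta> ` (cls \<xi> w - {y})" using xy by (metis DiffI image_eqI singletonD)
  then have "cls \<eta> ` cls \<xi> w = cls \<eta> ` (cls \<xi> w - {y})" by blast
  then have "card (cls \<eta> ` (cls \<xi> w - {y})) = card (cls \<xi> w - {y})"
    using d xy(2) by simp
  then have inj: "inj_on (cls \<eta>) (cls \<xi> w - {y})"
    using fin_cls[OF w] by (intro eq_card_imp_inj_on) auto
  obtain \<eta>' where s: "swap X \<xi> \<eta> \<eta>' w (cls \<xi> w)" and le: "num_cls \<eta> X \<le> num_cls \<eta>' X"
    using opt_swap[OF w] .
  show False using swap.num_cls_pair[OF s xy inj] le c by simp
qed

text \<open>The two coincidences already account for the two missing orbits, so there is no third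
  one.\<close>

lemma inj_two:
  assumes w: "w \<in> X" and xy: "x \<in> cls \<xi> w" "y \<in> cls \<xi> w" "x \<noteq> y" "cls \<eta> x = cls \<eta> y"
    and uv: "u \<in> cls \<xi> w" "v \<in> cls \<xi> w" "u \<noteq> v" "cls \<eta> u = cls \<eta> v" "cls \<eta> x \<noteq> cls \<eta> u"
    and d: "card (cls \<eta> ` cls \<xi> w) + 2 = card (cls \<xi> w)"
  shows "inj_on (cls \<eta>) (cls \<xi> w - {y, v})"
proof -
  have ne: "x \<noteq> v" "u \<noteq> y" "y \<noteq> v" using xy(4) uv(4,5) by metis+
  have "cls \<eta> y \<in> cls \<eta> ` (cls \<xi> w - {y, v})"
    unfolding xy(4)[symmetric] using xy ne by (intro imageI) auto
  moreover have "cls \<eta> v \<in> cls \<eta> ` (cls \<xi> w - {y, v})"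
    unfolding uv(4)[symmetric] using uv ne by (intro imageI) auto
  ultimately have "cls \<eta> ` cls \<xi> w = cls \<eta> ` (cls \<xi> w - {y, v})" by blast
  moreover have "card (cls \<xi> w - {y, v}) = card (cls \<xi> w) - 2"
    using xy uv ne by (simp add: card_Diff_subset)
  ultimately have "card (cls \<eta> ` (cls \<xi> w - {y, v})) = card (cls \<xi> w - {y, v})"
    using d by simp
  then show ?thesis using fin_cls[OF w] by (intro eq_card_imp_inj_on) auto
qed

lemma two_pairs_card:
  assumes w: "w \<in> X" and xy: "x \<in> cls \<xi> w" "y \<in> cls \<xi> w" "x \<noteq> y" "cls \<eta> x = cls \<eta> y"
    and uv: "u \<in> cls \<xi> w" "v \<in> cls \<xi> w" "u \<noteq> v" "cls \<eta> u = cls \<eta> v" "cls \<eta> x \<noteq> cls \<eta> u"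
    and d: "card (cls \<eta> ` cls \<xi> w) + 2 = card (cls \<xi> w)"
  shows "card (cls \<xi> w) \<le> 5"
proof -
  obtain \<eta>' where s: "swap X \<xi> \<eta> \<eta>' w (cls \<xi> w)" and le: "num_cls \<eta> X \<le> num_cls \<eta>' X"
    using opt_swap[OF w] .
  show ?thesis using swap.num_cls_two_pairs(7)[OF s xy uv inj_two[OF assms]] le by simp
qed

text \<open>The pairs cross in the cyclic order. The transition rules then link all four points, so
  the exchange would fuse two orbits into one.\<close>

lemma cross4:
  assumes w: "w \<in> X" and c: "card (cls \<xi> w) = 4" and d: "card (cls \<eta> ` cls \<xi> w) = 2"
    and k: "cls \<eta> w = cls \<eta> (\<xi> (\<xi> w))" "cls \<eta> (\<xi> w) = cls \<eta> (\<xi> (\<xi> (\<xi> w)))" "cls \<eta> w \<noteq> cls \<eta> (\<xi> w)"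
  shows False
proof -
  note o = orbit4[OF fin xi w c]
  let ?a = "\<xi> w" and ?b = "\<xi> (\<xi> w)" and ?c = "\<xi> (\<xi> (\<xi> w))"
  have i: "w \<in> cls \<xi> w" "?a \<in> cls \<xi> w" "?b \<in> cls \<xi> w" "?c \<in> cls \<xi> w" "w \<noteq> ?b" "?a \<noteq> ?c"
    using o by auto
  obtain \<eta>' where s: "swap X \<xi> \<eta> \<eta>' w (cls \<xi> w)" and le: "num_cls \<eta> X \<le> num_cls \<eta>' X"
    using opt_swap[OF w] .
  have "inj_on (cls \<eta>) (cls \<xi> w - {?b, ?c})"
    by (rule inj_two[OF w i(1,3,5) k(1) i(2,4,6) k(2,3)]) (use c d in simp)
  note t = swap.num_cls_two_pairs[OF s i(1,3,5) k(1) i(2,4,6) k(2,3) this]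
  have c1: "cls \<eta>' ?c = cls \<eta>' w" using t(3) by simp
  have b1: "cls \<eta>' ?b = cls \<eta>' w" using t(4) c1 by simp
  have a1: "cls \<eta>' ?a = cls \<eta>' w" using t(2) b1 by simp
  have all: "cls \<eta>' z = cls \<eta>' w" if z: "z \<in> cls \<xi> w" for z
  proof -
    have "z = w \<or> z = ?a \<or> z = ?b \<or> z = ?c" using z unfolding o(1) by simp
    then show ?thesis using a1 b1 c1 by (elim disjE) simp_all
  qed
  have "num_cls \<eta>' X + card (cls \<eta> ` cls \<xi> w) \<le> num_cls \<eta> X + card {w}"
    by (rule swap.num_cls_le[OF s]) (simp, rule bexI[of _ w], erule all, simp)
  then show False using le d by simp
qed

text \<open>Crossing pairs again, with \<open>w\<close> alone in its orbit: the rules link all five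
  points, and three orbits would become one.\<close>

lemma cross5:
  assumes w: "w \<in> X" and c: "card (cls \<xi> w) = 5" and d: "card (cls \<eta> ` cls \<xi> w) = 3"
    and k: "cls \<eta> (\<xi> w) = cls \<eta> (\<xi> (\<xi> (\<xi> w)))" "cls \<eta> (\<xi> (\<xi> w)) = cls \<eta> (\<xi> (\<xi> (\<xi> (\<xi> w))))"
      "cls \<eta> (\<xi> w) \<noteq> cls \<eta> (\<xi> (\<xi> w))"
  shows False
proof -
  note o = orbit5[OF fin xi w c]
  let ?a = "\<xi> w" and ?b = "\<xi> (\<xi> w)" and ?c = "\<xi> (\<xi> (\<xi> w))" and ?d = "\<xi> (\<xi> (\<xi> (\<xi> w)))"
  have i: "?a \<in> cls \<xi> w" "?c \<in> cls \<xi> w" "?a \<noteq> ?c" "?b \<in> cls \<xi> w" "?d \<in> cls \<xi> w" "?b \<noteq> ?d"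
    using o by auto
  obtain \<eta>' where s: "swap X \<xi> \<eta> \<eta>' w (cls \<xi> w)" and le: "num_cls \<eta> X \<le> num_cls \<eta>' X"
    using opt_swap[OF w] .
  have inj: "inj_on (cls \<eta>) (cls \<xi> w - {?c, ?d})"
    by (rule inj_two[OF w i(1-3) k(1) i(4-6) k(2,3)]) (use c d in simp)
  note t = swap.num_cls_two_pairs[OF s i(1-3) k(1) i(4-6) k(2,3) inj]
  have "w \<notin> {?a, ?c, ?b, ?d}" using o(3) by auto
  then have w1: "cls \<eta>' ?a = cls \<eta>' w" by (intro t(1)) simp_all
  have d1: "cls \<eta>' ?d = cls \<eta>' w" using t(3) w1 by simp
  have c1: "cls \<eta>' ?c = cls \<eta>' w" using t(4) d1 by simp
  have b1: "cls \<eta>' ?b = cls \<eta>' w" using t(2) c1 by simp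
  have all: "cls \<eta>' z = cls \<eta>' w" if z: "z \<in> cls \<xi> w" for z
  proof -
    have "z = w \<or> z = ?a \<or> z = ?b \<or> z = ?c \<or> z = ?d" using z unfolding o(1) by simp
    then show ?thesis using w1 b1 c1 d1 by (elim disjE) simp_all
  qed
  have "num_cls \<eta>' X + card (cls \<eta> ` cls \<xi> w) \<le> num_cls \<eta> X + card {w}"
    by (rule swap.num_cls_le[OF s]) (simp, rule bexI[of _ w], erule all, simp)
  then show False using le d by simp
qed

text \<open>Crossing pairs being excluded, at least one of the pairs consists of consecutive points.
  In the list of remaining positions \<open>q\<close> starts a pair of a 4-cycle or is the unpaired
  point of a 5-cycle; in the latter the pairs lie side by side or are nested.\<close>

lemma two_pairs:
  assumes w: "w \<in> X" and xy: "x \<in> cls \<xi> w" "y \<in> cls \<xi> w" "x \<noteq> y" "cls \<eta> x = cls \<eta> y"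
    and uv: "u \<in> cls \<xi> w" "v \<in> cls \<xi> w" "u \<noteq> v" "cls \<eta> u = cls \<eta> v" "cls \<eta> x \<noteq> cls \<eta> u"
    and d: "card (cls \<eta> ` cls \<xi> w) + 2 = card (cls \<xi> w)"
  shows "\<exists>q\<in>cls \<xi> w. cls \<eta> q \<in> {cls \<eta> x, cls \<eta> u} \<and> cls \<eta> (\<xi> q) = cls \<eta> q"
    and "(\<exists>q\<in>cls \<xi> w. card (cls \<xi> q) = 4 \<and> \<xi> (\<xi> (\<xi> (\<xi> q))) = q \<and>
        cls \<eta> (\<xi> q) = cls \<eta> q \<and> cls \<eta> (\<xi> (\<xi> q)) = cls \<eta> (\<xi> (\<xi> (\<xi> q))) \<and> cls \<eta> q \<noteq> cls \<eta> (\<xi> (\<xi> q)) \<and>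
        {cls \<eta> q, cls \<eta> (\<xi> (\<xi> q))} = {cls \<eta> x, cls \<eta> u}) \<or>
      (\<exists>q\<in>cls \<xi> w. card (cls \<xi> q) = 5 \<and> \<xi> (\<xi> (\<xi> (\<xi> (\<xi> q)))) = q \<and>
        cls \<eta> q \<notin> {cls \<eta> x, cls \<eta> u} \<and>
        (cls \<eta> (\<xi> q) = cls \<eta> (\<xi> (\<xi> q)) \<and> cls \<eta> (\<xi> (\<xi> (\<xi> q))) = cls \<eta> (\<xi> (\<xi> (\<xi> (\<xi> q)))) \<and>
           {cls \<eta> (\<xi> q), cls \<eta> (\<xi> (\<xi> (\<xi> q)))} = {cls \<eta> x, cls \<eta> u} \<or>
         cls \<eta> (\<xi> q) = cls \<eta> (\<xi> (\<xi> (\<xi> (\<xi> q)))) \<and> cls \<eta> (\<xi> (\<xi> q)) = cls \<eta> (\<xi> (\<xi> (\<xi> q))) \<and>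
           {cls \<eta> (\<xi> q), cls \<eta> (\<xi> (\<xi> q))} = {cls \<eta> x, cls \<eta> u}))" (is "?Q4 \<or> ?Q5")
proof -
  have dist: "distinct [x, y, u, v]" using xy(3,4) uv(3-5) by auto
  have fZ: "finite (cls \<xi> w)" using fin_cls[OF w] .
  have "card {x, y, u, v} \<le> card (cls \<xi> w)" using xy uv fZ by (intro card_mono) auto
  then have c45: "card (cls \<xi> w) = 4 \<or> card (cls \<xi> w) = 5"
    using two_pairs_card[OF assms] dist by simp arith
  show main: "?Q4 \<or> ?Q5"
    using c45
  proof
    assume c: "card (cls \<xi> w) = 4"
    have Z: "cls \<xi> w = {x, y, u, v}"
      using dist xy uv fZ c by (intro card_seteq[symmetric]) (auto simp: card_insert_if split: if_splits)
    note o = orbit4[OF fin xi w c]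
    let ?a = "\<xi> w" and ?b = "\<xi> (\<xi> w)" and ?c = "\<xi> (\<xi> (\<xi> w))"
    have img: "{cls \<eta> w, cls \<eta> ?a, cls \<eta> ?b, cls \<eta> ?c} = {cls \<eta> x, cls \<eta> u}"
    proof -
      have "cls \<eta> ` {w, ?a, ?b, ?c} = cls \<eta> ` {x, y, u, v}" using o(1) Z by simp
      then show ?thesis using xy(4) uv(4) by auto
    qed
    have "{w, ?a, ?b, ?c} = {x, y, u, v}" using o(1) Z by simp
    from pairings[OF this o(3) dist xy(4) uv(4)]
    consider (1) "cls \<eta> w = cls \<eta> ?a" "cls \<eta> ?b = cls \<eta> ?c"
      | (2) "cls \<eta> w = cls \<eta> ?b" "cls \<eta> ?a = cls \<eta> ?c"
      | (3) "cls \<eta> w = cls \<eta> ?c" "cls \<eta> ?a = cls \<eta> ?b" by blast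
    then show ?thesis
    proof cases
      case 1
      have s: "{cls \<eta> w, cls \<eta> ?b} = {cls \<eta> x, cls \<eta> u}" using img 1 by simp
      then have "cls \<eta> w \<noteq> cls \<eta> ?b" using uv(5) by (auto simp: doubleton_eq_iff)
      then have ?Q4 using 1 s c o(2) by (intro bexI[of _ w]) auto
      then show ?thesis ..
    next
      case 2
      have s: "{cls \<eta> w, cls \<eta> ?a} = {cls \<eta> x, cls \<eta> u}" using img 2 by (simp add: insert_commute)
      then have "cls \<eta> w \<noteq> cls \<eta> ?a" using uv(5) by (auto simp: doubleton_eq_iff)
      then have False using cross4[OF w c _ 2] d c by simp
      then show ?thesis ..
    next
      case 3
      have s: "{cls \<eta> ?a, cls \<eta> ?c} = {cls \<eta> x, cls \<eta> u}" using img 3 by (simp add: insert_commute)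
      then have ne: "cls \<eta> ?a \<noteq> cls \<eta> ?c" using uv(5) by (auto simp: doubleton_eq_iff)
      have "?a \<in> cls \<xi> w" by (intro cls_step cls_self)
      moreover then have "cls \<xi> ?a = cls \<xi> w" by (rule cls_eqI[OF fin xi w])
      ultimately have ?Q4 using 3 s c o(2) ne by (intro bexI[of _ ?a]) (simp_all add: insert_commute)
      then show ?thesis ..
    qed
  next
    assume c: "card (cls \<xi> w) = 5"
    have "card (cls \<xi> w - {x, y, u, v}) = 1"
      using dist xy uv fZ c by (subst card_Diff_subset) (auto simp: card_insert_if split: if_splits)
    then obtain q where q: "cls \<xi> w - {x, y, u, v} = {q}" by (auto simp: card_1_singleton_iff)
    then have qw: "q \<in> cls \<xi> w" and qn: "q \<notin> {x, y, u, v}" by auto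
    have Zq: "cls \<xi> w = insert q {x, y, u, v}" using q xy uv by blast
    have qX: "q \<in> X" using cls_in[OF xi w] qw by auto
    have clq: "cls \<xi> q = cls \<xi> w" by (rule cls_eqI[OF fin xi w qw])
    then have cq: "card (cls \<xi> q) = 5" using c by simp
    note o = orbit5[OF fin xi qX cq]
    let ?a = "\<xi> q" and ?b = "\<xi> (\<xi> q)" and ?c = "\<xi> (\<xi> (\<xi> q))" and ?d = "\<xi> (\<xi> (\<xi> (\<xi> q)))"
    have st: "{?a, ?b, ?c, ?d} = {x, y, u, v}"
    proof -
      have "insert q {?a, ?b, ?c, ?d} = insert q {x, y, u, v}" using o(1) clq Zq by simp
      moreover have "q \<notin> {?a, ?b, ?c, ?d}" using o(3) by auto
      ultimately show ?thesis using qn by (meson insert_ident)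
    qed
    have img: "{cls \<eta> ?a, cls \<eta> ?b, cls \<eta> ?c, cls \<eta> ?d} = {cls \<eta> x, cls \<eta> u}"
    proof -
      have "cls \<eta> ` {?a, ?b, ?c, ?d} = cls \<eta> ` {x, y, u, v}" using st by simp
      then show ?thesis using xy(4) uv(4) by auto
    qed
    have nq: "cls \<eta> q \<notin> {cls \<eta> x, cls \<eta> u}"
    proof -
      have "inj_on (cls \<eta>) (cls \<xi> w - {y, v})" by (rule inj_two[OF assms])
      moreover have "q \<in> cls \<xi> w - {y, v}" "x \<in> cls \<xi> w - {y, v}" "u \<in> cls \<xi> w - {y, v}"
        using qw qn xy uv dist by auto
      ultimately have "cls \<eta> q = cls \<eta> x \<Longrightarrow> q = x" "cls \<eta> q = cls \<eta> u \<Longrightarrow> q = u"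
        by (meson inj_onD)+
      then show ?thesis using qn by auto
    qed
    have "distinct [?a, ?b, ?c, ?d]" using o(3) by simp
    from pairings[OF st this dist xy(4) uv(4)]
    consider (1) "cls \<eta> ?a = cls \<eta> ?b" "cls \<eta> ?c = cls \<eta> ?d"
      | (2) "cls \<eta> ?a = cls \<eta> ?c" "cls \<eta> ?b = cls \<eta> ?d"
      | (3) "cls \<eta> ?a = cls \<eta> ?d" "cls \<eta> ?b = cls \<eta> ?c" by blast
    then show ?thesis
    proof cases
      case 1
      then have "{cls \<eta> ?a, cls \<eta> ?c} = {cls \<eta> x, cls \<eta> u}" using img by simp
      then have ?Q5 using 1 cq o(2) nq qw by (intro bexI[of _ q]) simp_all
      then show ?thesis ..
    next
      case 2
      have s: "{cls \<eta> ?a, cls \<eta> ?b} = {cls \<eta> x, cls \<eta> u}" using img 2 by (simp add: insert_commute)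
      then have "cls \<eta> ?a \<noteq> cls \<eta> ?b" using uv(5) by (auto simp: doubleton_eq_iff)
      then have False using cross5[OF qX cq _ 2] d c clq by simp
      then show ?thesis ..
    next
      case 3
      then have "{cls \<eta> ?a, cls \<eta> ?b} = {cls \<eta> x, cls \<eta> u}" using img by (simp add: insert_commute)
      then have ?Q5 using 3 cq o(2) nq qw by (intro bexI[of _ q]) simp_all
      then show ?thesis ..
    qed
  qed
  show "\<exists>q\<in>cls \<xi> w. cls \<eta> q \<in> {cls \<eta> x, cls \<eta> u} \<and> cls \<eta> (\<xi> q) = cls \<eta> q"
    using main
  proof
    assume ?Q4
    then show ?thesis by (elim bexE conjE) (rule bexI, auto)
  next
    assume ?Q5
    then obtain q where q: "q \<in> cls \<xi> w"
      "cls \<eta> (\<xi> q) = cls \<eta> (\<xi> (\<xi> q)) \<and> {cls \<eta> (\<xi> q), cls \<eta> (\<xi> (\<xi> (\<xi> q)))} = {cls \<eta> x, cls \<eta> u} \<or>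
       cls \<eta> (\<xi> (\<xi> q)) = cls \<eta> (\<xi> (\<xi> (\<xi> q))) \<and> {cls \<eta> (\<xi> q), cls \<eta> (\<xi> (\<xi> q))} = {cls \<eta> x, cls \<eta> u}"
      by (elim bexE conjE) blast
    have "\<xi> q \<in> cls \<xi> w" "\<xi> (\<xi> q) \<in> cls \<xi> w" using q(1) by (intro cls_step; simp)+
    then show ?thesis using q(2)
    proof (elim disjE conjE)
      assume a: "cls \<eta> (\<xi> q) = cls \<eta> (\<xi> (\<xi> q))" "{cls \<eta> (\<xi> q), cls \<eta> (\<xi> (\<xi> (\<xi> q)))} = {cls \<eta> x, cls \<eta> u}"
      then show ?thesis using \<open>\<xi> q \<in> cls \<xi> w\<close> by (intro bexI[of _ "\<xi> q"]) auto
    next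
      assume a: "cls \<eta> (\<xi> (\<xi> q)) = cls \<eta> (\<xi> (\<xi> (\<xi> q)))" "{cls \<eta> (\<xi> q), cls \<eta> (\<xi> (\<xi> q))} = {cls \<eta> x, cls \<eta> u}"
      then show ?thesis using \<open>\<xi> (\<xi> q) \<in> cls \<xi> w\<close> by (intro bexI[of _ "\<xi> (\<xi> q)"]) auto
    qed
  qed
qed

end

section \<open>Locally optimal pairs of permutations\<close>

lemma in_cls_iff:
  assumes "finite X" "bij_betw f X X" "x \<in> X" "W \<in> cls f ` X"
  shows "x \<in> W \<longleftrightarrow> cls f x = W"
proof
  assume "x \<in> W"
  obtain w where w: "w \<in> X" "W = cls f w" using assms(4) by auto
  show "cls f x = W" unfolding w(2) by (rule cls_eqI[OF assms(1,2) w(1)]) (use \<open>x \<in> W\<close> w in simp)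
next
  assume "cls f x = W"
  then show "x \<in> W" using cls_self[of x f] by simp
qed

lemma cls_preimage:
  assumes "finite X" "bij_betw f X X" "x \<in> X" "a \<in> cls f x"
  obtains b where "b \<in> cls f x" "f b = a"
proof -
  have aX: "a \<in> X" using cls_in[OF assms(2,3)] assms(4) by auto
  obtain k where k: "k > 0" "(f ^^ k) a = a" using cls_return[OF assms(1,2) aX] by auto
  then obtain j where j: "k = Suc j" by (cases k) auto
  have "(f ^^ j) a \<in> cls f a" by (rule cls_funpow)
  moreover have "cls f a = cls f x" by (rule cls_eqI[OF assms])
  ultimately show ?thesis using that[of "(f ^^ j) a"] k j by simp
qed

text \<open>Traversing some cycles backwards does not change them as sets. This is what exchanging
  colours 1 and 3 does to the orbits of the permutation formed from these two colours.\<close>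

lemma cls_inverted:
  assumes fin: "finite X" and f: "bij_betw f X X" and f': "bij_betw f' X X"
    and U: "U \<subseteq> X" "\<And>x. x \<in> U \<Longrightarrow> cls f x \<subseteq> U"
    and inv: "\<And>a. a \<in> U \<Longrightarrow> f' (f a) = a" and out: "\<And>a. a \<in> X - U \<Longrightarrow> f' a = f a"
    and x: "x \<in> X"
  shows "cls f' x = cls f x"
proof (cases "x \<in> U")
  case True
  have sub: "cls f' x \<subseteq> cls f x"
  proof (rule cls_subset)
    fix a assume a: "a \<in> cls f x"
    obtain b where b: "b \<in> cls f x" "f b = a" using cls_preimage[OF fin f x a] .
    then have "f' a = b" using inv[of b] U(2)[OF True] by auto
    then show "f' a \<in> cls f x" using b by simp
  qed simp
  moreover have "cls f x \<subseteq> cls f' x"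
  proof (rule cls_subset)
    fix a assume a: "a \<in> cls f' x"
    then have aU: "a \<in> U" using sub U(2)[OF True] by auto
    then have fa: "f a \<in> X" using bij_betw_in[OF f] U(1) by auto
    have "f' (f a) \<in> cls f' (f a)" by (intro cls_step cls_self)
    then have "a \<in> cls f' (f a)" using inv[OF aU] by simp
    then have "cls f' a = cls f' (f a)" by (rule cls_eqI[OF fin f' fa])
    moreover have "cls f' a = cls f' x" by (rule cls_eqI[OF fin f' x a])
    ultimately show "f a \<in> cls f' x" using cls_self[of "f a" f'] by simp
  qed simp
  ultimately show ?thesis by (rule equalityI)
next
  case False
  have nU: "(f ^^ k) x \<notin> U" for k
  proof
    assume k: "(f ^^ k) x \<in> U"
    have "cls f ((f ^^ k) x) = cls f x" by (rule cls_eqI[OF fin f x cls_funpow])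
    then have "x \<in> U" using U(2)[OF k] cls_self[of x f] by auto
    then show False using False by simp
  qed
  have "(f' ^^ k) x = (f ^^ k) x" for k
  proof (induction k)
    case (Suc k)
    then show ?case using out[of "(f ^^ k) x"] nU[of k] funpow_in[OF f x, of k] by simp
  qed simp
  then show ?thesis unfolding cls_def by simp
qed

lemma sum_card_cls:
  assumes "finite X" "bij_betw f X X"
  shows "(\<Sum>Z\<in>cls f ` X. card Z) = card X"
proof -
  have "{x \<in> X. cls f x = Z} = Z" if Z: "Z \<in> cls f ` X" for Z
  proof -
    have "Z \<subseteq> X" using Z cls_in[OF assms(2)] by auto
    moreover have "x \<in> X \<Longrightarrow> cls f x = Z \<longleftrightarrow> x \<in> Z" for x
      using in_cls_iff[OF assms _ Z, of x] by simp
    ultimately show ?thesis by blast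
  qed
  then show ?thesis using sum.image_gen[OF assms(1), of "\<lambda>_. 1::nat" "cls f"] by simp
qed

text \<open>The charging scheme: a short cycle that would spoil the average is paid for by the cycle with
  which it shares two points.\<close>

definition sharers :: "'a set \<Rightarrow> ('a \<Rightarrow> 'a) \<Rightarrow> 'a set \<Rightarrow> 'a set set" where
  "sharers X \<eta> Z = {W \<in> cls \<eta> ` X. card W \<le> 3 \<and> card (W \<inter> Z) = 2}"

definition deficient :: "('a \<Rightarrow> 'a) \<Rightarrow> 'a set \<Rightarrow> bool" where
  "deficient \<eta> Z \<longleftrightarrow> card Z \<le> 3 \<and> card (cls \<eta> ` Z) + 1 = card Z"

section \<open>The balance of a single orbit and its sum\<close>

context cycle_opt
begin

text \<open>As \<open>\<eta> a\<close> is neither \<open>a\<close> nor \<open>\<xi> a = b\<close>,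
  the short \<open>\<eta>\<close>-orbit has a third point \<open>c\<close>, which lies outside the
  \<open>\<xi>\<close>-cycle, and injectivity forces the order a, c, b. Thus \<open>\<eta>\<close>
  leads from \<open>b\<close> straight back to \<open>a\<close>, against the direction of
  \<open>\<xi>\<close>.\<close>

lemma triangle:
  assumes aX: "a \<in> X" and ab: "\<xi> a = b" and int: "cls \<eta> a \<inter> cls \<xi> a = {a, b}" and c3: "card (cls \<eta> a) \<le> 3"
  shows "\<exists>c\<in>X. c \<notin> cls \<xi> a \<and> \<eta> b = a \<and> \<eta> a = c \<and> \<eta> c = b"
proof -
  let ?W = "cls \<eta> a" and ?c = "\<eta> a"
  have fW: "finite ?W" using cls_in[OF eta aX] fin finite_subset by blast
  have WX: "?W \<subseteq> X" by (rule cls_in[OF eta aX])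
  have a: "a \<in> ?W" by simp
  have b: "b \<in> ?W" using int by auto
  have bX: "b \<in> X" using b WX by auto
  have ba: "b \<noteq> a" using xi_ne[OF aX] ab by simp
  have c: "?c \<in> ?W" by (intro cls_step cls_self)
  have cX: "?c \<in> X" using c WX by auto
  have ca: "?c \<noteq> a" "?c \<noteq> b" using eta_ne[OF aX] xi_eta[OF aX] ab by auto
  have cZ: "?c \<notin> cls \<xi> a" using int c ca by auto
  have W: "{a, b, ?c} = ?W"
    using a b c fW c3 ba ca by (intro card_seteq) auto
  have inj: "\<eta> p = \<eta> q \<Longrightarrow> p \<in> X \<Longrightarrow> q \<in> X \<Longrightarrow> p = q" for p q
    using eta by (auto simp: bij_betw_def inj_on_def)
  have "\<eta> b \<in> {a, b, ?c}" unfolding W using b by (rule cls_step)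
  moreover have "\<eta> b \<noteq> ?c" using inj[of b a] aX bX ba by auto
  ultimately have eb: "\<eta> b = a" using eta_ne[OF bX] by auto
  have "\<eta> ?c \<in> {a, b, ?c}" unfolding W using c by (rule cls_step)
  moreover have "\<eta> ?c \<noteq> a" using inj[of ?c b] cX bX ca eb by auto
  ultimately have "\<eta> ?c = b" using eta_ne[OF cX] by auto
  then show ?thesis using eb cZ cX by auto
qed

lemma consecutive:
  assumes aX: "a \<in> X" and b: "b \<in> cls \<xi> a" "a \<noteq> b" and c3: "card (cls \<xi> a) \<le> 3"
  shows "\<xi> a = b \<or> \<xi> b = a"
proof (rule ccontr)
  assume n: "\<not> ?thesis"
  let ?Z = "cls \<xi> a" and ?c = "\<xi> a"
  have bX: "b \<in> X" using b cls_in[OF xi aX] by auto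
  have c: "?c \<in> ?Z" by (intro cls_step cls_self)
  have "{a, b, ?c} = ?Z"
    using b c fin_cls[OF aX] c3 n xi_ne[OF aX] by (intro card_seteq) auto
  moreover have "\<xi> b \<in> ?Z" using b(1) by (rule cls_step)
  ultimately have "\<xi> b \<in> {a, b, ?c}" by simp
  then have "\<xi> b = ?c" using n xi_ne[OF bX] by auto
  then have "b = a" using xi aX bX by (auto simp: bij_betw_def inj_on_def)
  then show False using b by simp
qed

lemma fibre:
  assumes w: "w \<in> X" and W: "W \<in> cls \<eta> ` X"
  shows "{x \<in> cls \<xi> w. cls \<eta> x = W} = W \<inter> cls \<xi> w"
proof -
  have "x \<in> cls \<xi> w \<Longrightarrow> cls \<eta> x = W \<longleftrightarrow> x \<in> W" for x
    using in_cls_iff[OF fin eta _ W, of x] cls_in[OF xi w] by blast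
  then show ?thesis by blast
qed

text \<open>Each \<open>\<eta>\<close>-orbit met by the cycle owns at least one of its points, and a
  sharer owns two.\<close>

lemma sharers_card:
  assumes w: "w \<in> X"
  shows "card (cls \<eta> ` cls \<xi> w) + card (sharers X \<eta> (cls \<xi> w)) \<le> card (cls \<xi> w)"
proof -
  let ?Z = "cls \<xi> w" and ?S = "sharers X \<eta> (cls \<xi> w)"
  have fZ: "finite ?Z" by (rule fin_cls[OF w])
  have img: "W \<in> cls \<eta> ` X" if "W \<in> cls \<eta> ` ?Z" for W using that cls_in[OF xi w] by auto
  have SZ: "?S \<subseteq> cls \<eta> ` ?Z"
  proof
    fix W assume W: "W \<in> ?S"
    then have "W \<inter> ?Z \<noteq> {}" by (auto simp: sharers_def)
    then obtain x where x: "x \<in> W" "x \<in> ?Z" by auto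
    then have "cls \<eta> x = W" using in_cls_iff[OF fin eta _, of x W] W cls_in[OF xi w] by (auto simp: sharers_def)
    then show "W \<in> cls \<eta> ` ?Z" using x by auto
  qed
  have "card (cls \<eta> ` ?Z) + card ?S = (\<Sum>W\<in>cls \<eta> ` ?Z. 1) + (\<Sum>W\<in>cls \<eta> ` ?Z. if W \<in> ?S then 1 else 0)"
    using fZ SZ by (simp add: sum.If_cases Int_absorb1)
  also have "\<dots> = (\<Sum>W\<in>cls \<eta> ` ?Z. 1 + (if W \<in> ?S then 1 else 0))" by (simp only: sum.distrib)
  also have "\<dots> \<le> (\<Sum>W\<in>cls \<eta> ` ?Z. card {x \<in> ?Z. cls \<eta> x = W})"
  proof (rule sum_mono)
    fix W assume W: "W \<in> cls \<eta> ` ?Z"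
    then obtain x where "x \<in> {x \<in> ?Z. cls \<eta> x = W}" by blast
    then have "card {x \<in> ?Z. cls \<eta> x = W} \<ge> 1" using fZ by (simp add: Suc_le_eq card_gt_0_iff) blast
    then show "1 + (if W \<in> ?S then 1 else 0) \<le> card {x \<in> ?Z. cls \<eta> x = W}"
      using fibre[OF w img[OF W]] by (simp add: sharers_def)
  qed
  also have "\<dots> = card ?Z" using sum.image_gen[OF fZ, of "\<lambda>_. 1::nat" "cls \<eta>"] by simp
  finally show ?thesis .
qed

text \<open>An orbit with l points and d neighbours can give away 2 l - 2 d - 3 units, one to each
  sharer. If l \<le> 3, there are no sharers by \<open>no_small\<close>, and the balance is negative
  only for a deficient orbit, namely -1. If l \<ge> 4, then d \<le> l - 2 leaves a unit for one
  sharer; two sharers need d \<le> l - 3, which is \<open>no_two\<close>; with three or more, the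
  doubly used points themselves make d small enough.\<close>

lemma node_bound:
  assumes w: "w \<in> X"
    and no_small: "\<And>a b. a \<in> X \<Longrightarrow> a \<noteq> b \<Longrightarrow> cls \<eta> a \<inter> cls \<xi> a = {a, b} \<Longrightarrow>
      card (cls \<xi> a) \<le> 3 \<Longrightarrow> card (cls \<eta> a) \<le> 3 \<Longrightarrow> False"
    and no_two: "\<And>x y u v. x \<in> cls \<xi> w \<Longrightarrow> u \<in> cls \<xi> w \<Longrightarrow> x \<noteq> y \<Longrightarrow> u \<noteq> v \<Longrightarrow>
      cls \<eta> x \<noteq> cls \<eta> u \<Longrightarrow> cls \<eta> x \<inter> cls \<xi> w = {x, y} \<Longrightarrow> cls \<eta> u \<inter> cls \<xi> w = {u, v} \<Longrightarrow>
      card (cls \<eta> x) \<le> 3 \<Longrightarrow> card (cls \<eta> u) \<le> 3 \<Longrightarrow>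
      card (cls \<eta> ` cls \<xi> w) + 2 = card (cls \<xi> w) \<Longrightarrow> False"
  shows "3 + 2 * card (cls \<eta> ` cls \<xi> w) + card (sharers X \<eta> (cls \<xi> w))
    \<le> 2 * card (cls \<xi> w) + (if deficient \<eta> (cls \<xi> w) then 1 else 0)"
proof -
  let ?Z = "cls \<xi> w" and ?S = "sharers X \<eta> (cls \<xi> w)"
  have S: "\<exists>x y. x \<in> ?Z \<and> x \<in> X \<and> x \<noteq> y \<and> W = cls \<eta> x \<and> cls \<eta> x \<inter> ?Z = {x, y} \<and> card (cls \<eta> x) \<le> 3"
    if W: "W \<in> ?S" for W
  proof -
    obtain x y where xy: "W \<inter> ?Z = {x, y}" "x \<noteq> y" using W by (auto simp: sharers_def card_2_iff)
    then have x: "x \<in> W" "x \<in> ?Z" "x \<in> X" using cls_in[OF xi w] by auto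
    have "cls \<eta> x = W" using in_cls_iff[OF fin eta x(3), of W] W x by (auto simp: sharers_def)
    then show ?thesis using xy x W by (auto simp: sharers_def)
  qed
  show ?thesis
  proof (cases "card ?Z \<le> 3")
    case True
    have "?S = {}"
    proof (rule ccontr)
      assume "?S \<noteq> {}"
      then obtain W where "W \<in> ?S" by auto
      then obtain x y where x: "x \<in> ?Z" "x \<in> X" "x \<noteq> y" "cls \<eta> x \<inter> ?Z = {x, y}" "card (cls \<eta> x) \<le> 3"
        using S by blast
      have "cls \<xi> x = ?Z" by (rule cls_eqI[OF fin xi w x(1)])
      then show False using no_small[OF x(2,3)] x(4,5) True by simp
    qed
    then show ?thesis using card_img_less[OF w] card_ge2[OF w] True by (auto simp: deficient_def)
  next
    case False
    then have d: "card (cls \<eta> ` ?Z) + 2 \<le> card ?Z" using card_img_le[OF w] by simp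
    note s = sharers_card[OF w]
    consider "card ?S \<le> 1" | "card ?S = 2" | "3 \<le> card ?S" by linarith
    then show ?thesis
    proof cases
      case 2
      then obtain W1 W2 where W: "?S = {W1, W2}" "W1 \<noteq> W2" by (auto simp: card_2_iff)
      then obtain x y where x: "x \<in> ?Z" "x \<noteq> y" "W1 = cls \<eta> x" "cls \<eta> x \<inter> ?Z = {x, y}" "card (cls \<eta> x) \<le> 3"
        using S[of W1] by blast
      obtain u v where u: "u \<in> ?Z" "u \<noteq> v" "W2 = cls \<eta> u" "cls \<eta> u \<inter> ?Z = {u, v}" "card (cls \<eta> u) \<le> 3"
        using S[of W2] W by blast
      have "card (cls \<eta> ` ?Z) + 2 \<noteq> card ?Z"
        using no_two[OF x(1) u(1) x(2) u(2) _ x(4) u(4) x(5) u(5)] W(2) x(3) u(3) by auto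
      then show ?thesis using d 2 by simp
    qed (use s d in simp_all)
  qed
qed

text \<open>A deficient orbit has a coincidence, so two of its points lie in a common orbit
  \<open>W\<close>. If it had three points in \<open>W\<close>, all of it would lie there, leaving
  one neighbour where deficiency demands two.\<close>

lemma sharer_exists:
  assumes w: "w \<in> X" and d: "deficient \<eta> (cls \<xi> w)"
  shows "\<exists>W\<in>cls \<eta> ` X. cls \<xi> w \<in> sharers X \<xi> W"
proof -
  let ?Z = "cls \<xi> w"
  obtain a b where ab: "a \<in> ?Z" "b \<in> ?Z" "a \<noteq> b" "cls \<eta> a = cls \<eta> b"
    using not_inj[OF w] unfolding inj_on_def by metis
  have aX: "a \<in> X" using ab cls_in[OF xi w] by auto
  let ?W = "cls \<eta> a"
  have sub: "{a, b} \<subseteq> ?Z \<inter> ?W" using ab cls_self[of b \<eta>] cls_self[of a \<eta>] by blast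
  have "card (?Z \<inter> ?W) = 2"
  proof (rule ccontr)
    assume "card (?Z \<inter> ?W) \<noteq> 2"
    moreover have "card {a, b} \<le> card (?Z \<inter> ?W)" using sub fin_cls[OF w] by (intro card_mono) auto
    ultimately have "card ?Z \<le> card (?Z \<inter> ?W)" using ab(3) d by (simp add: deficient_def)
    then have "?Z \<inter> ?W = ?Z" using fin_cls[OF w] by (intro card_seteq) auto
    then have "x \<in> ?Z \<Longrightarrow> x \<in> ?W" for x by blast
    then have "cls \<eta> ` ?Z \<subseteq> {?W}" using cls_eqI[OF fin eta aX] by blast
    then have "card (cls \<eta> ` ?Z) \<le> 1" using card_mono[of "{?W}" "cls \<eta> ` ?Z"] by simp
    then have "card ?Z \<le> 2" using d by (simp add: deficient_def)
    moreover have "card (?Z \<inter> ?W) \<le> card ?Z" using fin_cls[OF w] by (intro card_mono) auto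
    ultimately show False using \<open>card (?Z \<inter> ?W) \<noteq> 2\<close> \<open>card {a, b} \<le> card (?Z \<inter> ?W)\<close> ab(3) by simp
  qed
  then show ?thesis using aX w d by (intro bexI[of _ ?W]) (auto simp: sharers_def deficient_def)
qed

lemma cls_image_meet:
  assumes Z: "Z \<in> cls \<xi> ` X"
  shows "cls \<eta> ` Z = {W \<in> cls \<eta> ` X. Z \<inter> W \<noteq> {}}"
proof -
  have ZX: "Z \<subseteq> X" using Z cls_in[OF xi] by auto
  show ?thesis
  proof (intro equalityI subsetI)
    fix W assume "W \<in> cls \<eta> ` Z"
    then obtain x where "x \<in> Z" "W = cls \<eta> x" by auto
    then show "W \<in> {W \<in> cls \<eta> ` X. Z \<inter> W \<noteq> {}}" using ZX cls_self[of x \<eta>] by blast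
  next
    fix W assume "W \<in> {W \<in> cls \<eta> ` X. Z \<inter> W \<noteq> {}}"
    then obtain x where x: "W \<in> cls \<eta> ` X" "x \<in> Z" "x \<in> W" by auto
    then have "cls \<eta> x = W" using in_cls_iff[OF fin eta _ x(1), of x] ZX by auto
    then show "W \<in> cls \<eta> ` Z" using x by auto
  qed
qed

text \<open>The balances are summed over all \<open>\<xi>\<close>-orbits. Deficient
  \<open>\<eta>\<close>-orbits appear on the left since each is a sharer of some
  \<open>\<xi>\<close>-orbit. With \<open>\<xi>\<close> and \<open>\<eta>\<close> interchanged the
  two deficiency counts change sides, so they cancel when both inequalities are added.\<close>

lemma charge_sum:
  assumes opp: "cycle_opt X \<eta> \<xi>"
    and no_small: "\<And>a b. a \<in> X \<Longrightarrow> a \<noteq> b \<Longrightarrow> cls \<eta> a \<inter> cls \<xi> a = {a, b} \<Longrightarrow>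
      card (cls \<xi> a) \<le> 3 \<Longrightarrow> card (cls \<eta> a) \<le> 3 \<Longrightarrow> False"
    and no_two: "\<And>w x y u v. w \<in> X \<Longrightarrow> x \<in> cls \<xi> w \<Longrightarrow> u \<in> cls \<xi> w \<Longrightarrow> x \<noteq> y \<Longrightarrow> u \<noteq> v \<Longrightarrow>
      cls \<eta> x \<noteq> cls \<eta> u \<Longrightarrow> cls \<eta> x \<inter> cls \<xi> w = {x, y} \<Longrightarrow> cls \<eta> u \<inter> cls \<xi> w = {u, v} \<Longrightarrow>
      card (cls \<eta> x) \<le> 3 \<Longrightarrow> card (cls \<eta> u) \<le> 3 \<Longrightarrow>
      card (cls \<eta> ` cls \<xi> w) + 2 = card (cls \<xi> w) \<Longrightarrow> False"
  shows "3 * num_cls \<xi> X + 2 * (\<Sum>Z\<in>cls \<xi> ` X. card (cls \<eta> ` Z)) + card {W \<in> cls \<eta> ` X. deficient \<xi> W}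
    \<le> 2 * card X + card {Z \<in> cls \<xi> ` X. deficient \<eta> Z}"
proof -
  let ?C = "cls \<xi> ` X"
  have fC: "finite ?C" and fD: "finite (cls \<eta> ` X)" using fin by auto
  have b: "3 + 2 * card (cls \<eta> ` Z) + card (sharers X \<eta> Z) \<le> 2 * card Z + (if deficient \<eta> Z then 1 else 0)"
    if Z: "Z \<in> ?C" for Z
  proof -
    obtain w where w: "w \<in> X" "Z = cls \<xi> w" using Z by auto
    show ?thesis unfolding w(2) by (rule node_bound[OF w(1) no_small no_two[OF w(1)]])
  qed
  have "{W \<in> cls \<eta> ` X. deficient \<xi> W} \<subseteq> (\<Union>Z\<in>?C. sharers X \<eta> Z)"
    using cycle_opt.sharer_exists[OF opp] by blast
  then have "card {W \<in> cls \<eta> ` X. deficient \<xi> W} \<le> card (\<Union>Z\<in>?C. sharers X \<eta> Z)"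
    by (rule card_mono[rotated]) (rule finite_subset[OF _ fD], auto simp: sharers_def)
  also have "\<dots> \<le> (\<Sum>Z\<in>?C. card (sharers X \<eta> Z))" by (rule card_UN_le[OF fC])
  finally have l: "card {W \<in> cls \<eta> ` X. deficient \<xi> W} \<le> (\<Sum>Z\<in>?C. card (sharers X \<eta> Z))" .
  have "(\<Sum>Z\<in>?C. 3 + 2 * card (cls \<eta> ` Z) + card (sharers X \<eta> Z))
    \<le> (\<Sum>Z\<in>?C. 2 * card Z + (if deficient \<eta> Z then 1 else 0))" by (rule sum_mono) (rule b)
  then have "3 * card ?C + 2 * (\<Sum>Z\<in>?C. card (cls \<eta> ` Z)) + (\<Sum>Z\<in>?C. card (sharers X \<eta> Z))
    \<le> 2 * card X + card {Z \<in> ?C. deficient \<eta> Z}"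
    unfolding sum.distrib sum_distrib_left[symmetric] sum_card_cls[OF fin xi]
    using fC by (simp add: sum.If_cases Int_def mult.commute)
  then show ?thesis using l by (simp add: num_cls_def)
qed

end

text \<open>In \<open>merge\<close>, \<open>\<sigma>'\<close> and \<open>\<tau>'\<close> are the
  permutations after colours 1 and 3 have been exchanged on the \<open>\<tau>\<close>-orbits of
  \<open>u\<close> and \<open>v\<close>; taking \<open>u = v\<close> inverts a single orbit. Only
  numbers of \<open>\<tau>\<close>-orbits are compared afterwards, because the preparation may
  increase the number of \<open>\<sigma>\<close>-orbits.\<close>

locale mutual_opt =
  fixes X :: "'a set" and \<sigma> \<tau> :: "'a \<Rightarrow> 'a"
  assumes C: "cycle_opt X \<sigma> \<tau>" and D: "cycle_opt X \<tau> \<sigma>"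
    and trans: "x \<in> X \<Longrightarrow> y \<in> X \<Longrightarrow> (x, y) \<in> ({(a, \<sigma> a) | a. a \<in> X} \<union> {(a, \<tau> a) | a. a \<in> X})\<^sup>*"
    and merge: "u \<in> X \<Longrightarrow> v \<in> X \<Longrightarrow> \<exists>\<sigma>' \<tau>'. bij_betw \<sigma>' X X \<and> bij_betw \<tau>' X X \<and>
      (\<forall>a \<in> cls \<tau> u \<union> cls \<tau> v. \<sigma>' (\<tau> a) = \<sigma> a \<and> \<tau>' (\<tau> a) = a) \<and>
      (\<forall>a \<in> X - (cls \<tau> u \<union> cls \<tau> v). \<sigma>' a = \<sigma> a \<and> \<tau>' a = \<tau> a) \<and>
      (\<forall>w \<in> X. \<exists>\<tau>''. swapped X \<sigma>' \<tau>' (cls \<sigma>' w) \<tau>'' \<and> num_cls \<tau> X \<le> num_cls \<tau>'' X)"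
begin

lemma fin: "finite X" and s: "bij_betw \<sigma> X X" and t: "bij_betw \<tau> X X"
  using C by (auto simp: cycle_opt_def)

lemma s_in [simp]: "a \<in> X \<Longrightarrow> \<sigma> a \<in> X" and t_in [simp]: "a \<in> X \<Longrightarrow> \<tau> a \<in> X"
  using s t bij_betw_in by metis+

text \<open>Here \<open>\<sigma>'\<close> is \<open>\<sigma>\<close> after exchanging the colours 1 and 3 on the union \<open>U\<close> of two orbits of \<open>\<tau>\<close>. A short cycle
  of \<open>\<sigma>'\<close> cannot visit different orbits of \<open>\<tau>\<close>, as exchanging along it would merge them.\<close>

definition rigid :: "'a set \<Rightarrow> ('a \<Rightarrow> 'a) \<Rightarrow> bool" where
  "rigid U \<sigma>' \<longleftrightarrow> (\<forall>a\<in>U. \<sigma>' (\<tau> a) = \<sigma> a) \<and> (\<forall>a\<in>X - U. \<sigma>' a = \<sigma> a) \<and>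
    (\<forall>x\<in>X. \<forall>y. \<sigma>' x = y \<longrightarrow> \<sigma>' y = x \<longrightarrow> cls \<tau> x \<noteq> cls \<tau> y \<longrightarrow> False) \<and>
    (\<forall>x\<in>X. \<forall>y z. \<sigma>' x = y \<longrightarrow> \<sigma>' y = z \<longrightarrow> \<sigma>' z = x \<longrightarrow> cls \<tau> x \<noteq> cls \<tau> y \<longrightarrow>
      cls \<tau> y \<noteq> cls \<tau> z \<longrightarrow> cls \<tau> x \<noteq> cls \<tau> z \<longrightarrow> False)"

lemma rigidD:
  assumes "rigid U \<sigma>'"
  shows "a \<in> U \<Longrightarrow> \<sigma>' (\<tau> a) = \<sigma> a" and "a \<in> X - U \<Longrightarrow> \<sigma>' a = \<sigma> a"
    and "x \<in> X \<Longrightarrow> \<sigma>' x = y \<Longrightarrow> \<sigma>' y = x \<Longrightarrow> cls \<tau> x \<noteq> cls \<tau> y \<Longrightarrow> False"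
    and "x \<in> X \<Longrightarrow> \<sigma>' x = y \<Longrightarrow> \<sigma>' y = z \<Longrightarrow> \<sigma>' z = x \<Longrightarrow> cls \<tau> x \<noteq> cls \<tau> y \<Longrightarrow>
      cls \<tau> y \<noteq> cls \<tau> z \<Longrightarrow> cls \<tau> x \<noteq> cls \<tau> z \<Longrightarrow> False"
  using assms unfolding rigid_def by blast+

text \<open>Inverting orbits keeps them as sets, so \<open>\<tau>'\<close> has the orbits of
  \<open>\<tau>\<close>. By \<open>num_cls_inj\<close>, an exchange along a
  \<open>\<sigma>'\<close>-cycle through pairwise different \<open>\<tau>\<close>-orbits would
  reduce their number, contrary to \<open>merge\<close>.\<close>

lemma no_merge:
  assumes u: "u \<in> X" and v: "v \<in> X"
  shows "\<exists>\<sigma>'. rigid (cls \<tau> u \<union> cls \<tau> v) \<sigma>'"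
proof -
  let ?U = "cls \<tau> u \<union> cls \<tau> v"
  obtain \<sigma>' \<tau>' where s': "bij_betw \<sigma>' X X" and t': "bij_betw \<tau>' X X"
    and inU: "\<And>a. a \<in> ?U \<Longrightarrow> \<sigma>' (\<tau> a) = \<sigma> a" "\<And>a. a \<in> ?U \<Longrightarrow> \<tau>' (\<tau> a) = a"
    and outU: "\<And>a. a \<in> X - ?U \<Longrightarrow> \<sigma>' a = \<sigma> a" "\<And>a. a \<in> X - ?U \<Longrightarrow> \<tau>' a = \<tau> a"
    and opt: "\<And>w. w \<in> X \<Longrightarrow> \<exists>\<tau>''. swapped X \<sigma>' \<tau>' (cls \<sigma>' w) \<tau>'' \<and> num_cls \<tau> X \<le> num_cls \<tau>'' X"
    using merge[OF u v] by blast
  have UX: "?U \<subseteq> X" using cls_in[OF t u] cls_in[OF t v] by auto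
  have Uc: "cls \<tau> x \<subseteq> ?U" if "x \<in> ?U" for x
    using that cls_eqI[OF fin t u, of x] cls_eqI[OF fin t v, of x] by blast
  have same: "cls \<tau>' x = cls \<tau> x" if "x \<in> X" for x
    by (rule cls_inverted[OF fin t t' UX Uc inU(2) outU(2) that])
  have num: "num_cls \<tau>' X = num_cls \<tau> X" unfolding num_cls_def by (simp add: same)
  have key: "\<not> inj_on (cls \<tau>) (cls \<sigma>' w)" if w: "w \<in> X" and c: "card (cls \<sigma>' w) \<ge> 2" for w
  proof
    assume inj: "inj_on (cls \<tau>) (cls \<sigma>' w)"
    have sub: "cls \<sigma>' w \<subseteq> X" by (rule cls_in[OF s' w])
    have inj': "inj_on (cls \<tau>') (cls \<sigma>' w)"
      using inj sub same inj_on_cong[of "cls \<sigma>' w" "cls \<tau>'" "cls \<tau>"] by blast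
    obtain \<tau>'' where t'': "swapped X \<sigma>' \<tau>' (cls \<sigma>' w) \<tau>''" "num_cls \<tau> X \<le> num_cls \<tau>'' X"
      using opt[OF w] by blast
    have "swap X \<sigma>' \<tau>' \<tau>'' w (cls \<sigma>' w)"
      unfolding swap_def using fin s' t' w t'' by blast
    from swap.num_cls_inj[OF this inj'] show False using t''(2) num c by simp
  qed
  show ?thesis unfolding rigid_def
  proof (intro exI[of _ \<sigma>'] conjI ballI allI impI; (rule inU(1) outU(1))?)
    fix x y assume a: "x \<in> X" "\<sigma>' x = y" "\<sigma>' y = x" "cls \<tau> x \<noteq> cls \<tau> y"
    have e: "cls \<sigma>' x = {x, y}" by (rule cls_cycle2[OF a(2,3)])
    have "x \<noteq> y" using a(4) by auto
    then show False using key[OF a(1)] a(4) unfolding e by (simp add: inj_on_def)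
  next
    fix x y z assume a: "x \<in> X" "\<sigma>' x = y" "\<sigma>' y = z" "\<sigma>' z = x"
      "cls \<tau> x \<noteq> cls \<tau> y" "cls \<tau> y \<noteq> cls \<tau> z" "cls \<tau> x \<noteq> cls \<tau> z"
    have e: "cls \<sigma>' x = {x, y, z}" by (rule cls_cycle3[OF a(2,3,4)])
    have "x \<noteq> y" "y \<noteq> z" "x \<noteq> z" using a(5-7) by auto
    then show False using key[OF a(1)] a(5-7) unfolding e by (simp add: inj_on_def)
  qed
qed

text \<open>By \<open>triangle\<close> on both sides, \<open>\<tau>\<close> has the cycle a, c, b
  and \<open>\<sigma>\<close> has the cycle a, b, z. Inverting the \<open>\<tau>\<close>-orbit makes
  \<open>\<sigma>'\<close> send \<open>a\<close> to \<open>z\<close>, while \<open>z\<close> still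
  goes to \<open>a\<close>: a 2-cycle between different \<open>\<tau>\<close>-orbits.\<close>

lemma no_small_aux:
  assumes aX: "a \<in> X" and ab: "\<sigma> a = b" and int: "cls \<tau> a \<inter> cls \<sigma> a = {a, b}"
    and c: "card (cls \<sigma> a) \<le> 3" "card (cls \<tau> a) \<le> 3"
  shows False
proof -
  have bX: "b \<in> X" using aX ab by auto
  obtain c where c1: "c \<in> X" "c \<notin> cls \<sigma> a" "\<tau> b = a" "\<tau> a = c" "\<tau> c = b"
    using cycle_opt.triangle[OF C aX ab int c(2)] by blast
  have bm: "b \<in> cls \<tau> a" "b \<in> cls \<sigma> a" using int by auto
  have eb: "cls \<tau> b = cls \<tau> a" "cls \<sigma> b = cls \<sigma> a"
    using cls_eqI[OF fin t aX bm(1)] cls_eqI[OF fin s aX bm(2)] by auto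
  have "\<exists>z\<in>X. z \<notin> cls \<tau> b \<and> \<sigma> a = b \<and> \<sigma> b = z \<and> \<sigma> z = a"
    by (rule cycle_opt.triangle[OF D bX c1(3)]) (use int c eb in auto)
  then obtain z where z: "z \<in> X" "z \<notin> cls \<tau> a" "\<sigma> b = z" "\<sigma> z = a" using eb by auto
  obtain \<sigma>' where "rigid (cls \<tau> a \<union> cls \<tau> a) \<sigma>'" using no_merge[OF aX aX] ..
    note i = rigidD[OF this]
  have 1: "\<sigma>' a = z" using i(1)[of b] bm c1 z by simp
  have 2: "\<sigma>' z = a" using i(2)[of z] z by simp
  have "cls \<tau> a \<noteq> cls \<tau> z" using z(2) cls_self[of z \<tau>] by auto
  then show False using i(3)[OF aX 1 2] by simp
qed

lemma no_small:
  assumes aX: "a \<in> X" and ab: "a \<noteq> b" and int: "cls \<tau> a \<inter> cls \<sigma> a = {a, b}"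
    and c: "card (cls \<sigma> a) \<le> 3" "card (cls \<tau> a) \<le> 3"
  shows False
proof -
  have bm: "b \<in> cls \<tau> a" "b \<in> cls \<sigma> a" using int by auto
  have bX: "b \<in> X" using bm cls_in[OF t aX] by auto
  have eb: "cls \<tau> b = cls \<tau> a" "cls \<sigma> b = cls \<sigma> a"
    using cls_eqI[OF fin t aX bm(1)] cls_eqI[OF fin s aX bm(2)] by auto
  from cycle_opt.consecutive[OF C aX bm(2) ab c(1)] show False
  proof
    assume "\<sigma> a = b" then show False using no_small_aux[OF aX _ int c] by simp
  next
    assume "\<sigma> b = a" then show False using no_small_aux[OF bX] int c eb by (simp add: insert_commute)
  qed
qed

text \<open>The two pairs serve to obtain one consecutive pair \<open>q\<close>,
  \<open>\<tau> q\<close> from \<open>two_pairs\<close>. By \<open>triangle\<close>,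
  \<open>\<sigma>\<close> has the cycle \<open>\<tau> q\<close>, \<open>q\<close>, \<open>c\<close>;
  inverting the \<open>\<tau>\<close>-orbit of \<open>q\<close> shortens it to a 2-cycle of
  \<open>\<tau> q\<close> and \<open>c\<close>, with \<open>c\<close> outside that orbit.\<close>

lemma no_two_D:
  assumes w: "w \<in> X" and x: "x \<in> cls \<tau> w" "u \<in> cls \<tau> w" "x \<noteq> y" "u \<noteq> v" "cls \<sigma> x \<noteq> cls \<sigma> u"
    and int: "cls \<sigma> x \<inter> cls \<tau> w = {x, y}" "cls \<sigma> u \<inter> cls \<tau> w = {u, v}"
    and c: "card (cls \<sigma> x) \<le> 3" "card (cls \<sigma> u) \<le> 3" and d: "card (cls \<sigma> ` cls \<tau> w) + 2 = card (cls \<tau> w)"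
  shows False
proof -
  have y: "y \<in> cls \<tau> w" "y \<in> cls \<sigma> x" and v: "v \<in> cls \<tau> w" "v \<in> cls \<sigma> u" using int by auto
  have xX: "x \<in> X" "u \<in> X" using x cls_in[OF t w] by auto
  have k: "cls \<sigma> x = cls \<sigma> y" "cls \<sigma> u = cls \<sigma> v"
    using cls_eqI[OF fin s xX(1) y(2)] cls_eqI[OF fin s xX(2) v(2)] by auto
  obtain q where q: "q \<in> cls \<tau> w" "cls \<sigma> q \<in> {cls \<sigma> x, cls \<sigma> u}" "cls \<sigma> (\<tau> q) = cls \<sigma> q"
    using cycle_opt.two_pairs(1)[OF D w x(1) y(1) x(3) k(1) x(2) v(1) x(4) k(2) x(5) d] by blast
  have qX: "q \<in> X" using q cls_in[OF t w] by auto
  have tq: "\<tau> q \<in> cls \<tau> w" using q(1) by (rule cls_step)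
  have eq: "cls \<tau> q = cls \<tau> w" by (rule cls_eqI[OF fin t w q(1)])
  have sub: "{q, \<tau> q} \<subseteq> cls \<sigma> q \<inter> cls \<tau> q"
    using q(1) tq eq q(3) cls_self[of "\<tau> q" \<sigma>] by auto
  have ne: "\<tau> q \<noteq> q" using cycle_opt.eta_ne[OF C qX] .
  have "card (cls \<sigma> q \<inter> cls \<tau> q) = 2" using q(2) int x(3,4) eq by auto
  then have int': "cls \<sigma> q \<inter> cls \<tau> q = {q, \<tau> q}"
    using sub ne card_seteq[of "cls \<sigma> q \<inter> cls \<tau> q" "{q, \<tau> q}"]
    by (metis card.infinite card_2_iff le_refl zero_neq_numeral)
  have c3: "card (cls \<sigma> q) \<le> 3" using q(2) c by auto
  obtain c where cc: "c \<in> X" "c \<notin> cls \<tau> q" "\<sigma> (\<tau> q) = q" "\<sigma> q = c" "\<sigma> c = \<tau> q"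
    using cycle_opt.triangle[OF D qX refl int' c3] by blast
  obtain \<sigma>' where "rigid (cls \<tau> q \<union> cls \<tau> q) \<sigma>'" using no_merge[OF qX qX] ..
    note i = rigidD[OF this]
  have 1: "\<sigma>' (\<tau> q) = c" using i(1)[of q] cc by simp
  have 2: "\<sigma>' c = \<tau> q" using i(2)[of c] cc by simp
  have "cls \<tau> (\<tau> q) = cls \<tau> q" by (rule cls_eqI[OF fin t qX]) (intro cls_step cls_self)
  then have "cls \<tau> (\<tau> q) \<noteq> cls \<tau> c" using cc(2) cls_self[of c \<tau>] by auto
  then show False using i(3)[OF _ 1 2] qX by simp
qed

text \<open>Now the short orbits belong to \<open>\<tau>\<close>, and both may have to be inverted
  at once. Along a consecutive pair \<open>\<tau>\<close> runs against \<open>\<sigma>\<close>,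
  which is \<open>turn\<close>; after inversion \<open>\<sigma>'\<close> leads from \<open>q\<close>
  directly to \<open>\<sigma> (\<sigma> q)\<close>. Every arrangement left by
  \<open>two_pairs\<close> thereby collapses to a cycle of length 2 or 3 through different
  \<open>\<tau>\<close>-orbits.\<close>

lemma no_two_C:
  assumes w: "w \<in> X" and x: "x \<in> cls \<sigma> w" "u \<in> cls \<sigma> w" "x \<noteq> y" "u \<noteq> v" "cls \<tau> x \<noteq> cls \<tau> u"
    and int: "cls \<tau> x \<inter> cls \<sigma> w = {x, y}" "cls \<tau> u \<inter> cls \<sigma> w = {u, v}"
    and c: "card (cls \<tau> x) \<le> 3" "card (cls \<tau> u) \<le> 3" and d: "card (cls \<tau> ` cls \<sigma> w) + 2 = card (cls \<sigma> w)"
  shows False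
proof -
  have y: "y \<in> cls \<sigma> w" "y \<in> cls \<tau> x" and v: "v \<in> cls \<sigma> w" "v \<in> cls \<tau> u" using int by auto
  have xX: "x \<in> X" "u \<in> X" using x cls_in[OF s w] by auto
  have k: "cls \<tau> x = cls \<tau> y" "cls \<tau> u = cls \<tau> v"
    using cls_eqI[OF fin t xX(1) y(2)] cls_eqI[OF fin t xX(2) v(2)] by auto
  have ZX: "q \<in> X" if "q \<in> cls \<sigma> w" for q using that cls_in[OF s w] by auto
  have turn: "\<tau> (\<sigma> q) = q"
    if q: "q \<in> cls \<sigma> w" "cls \<tau> q \<in> {cls \<tau> x, cls \<tau> u}" "cls \<tau> (\<sigma> q) = cls \<tau> q" for q
  proof -
    have qX: "q \<in> X" by (rule ZX[OF q(1)])
    have sq: "\<sigma> q \<in> cls \<sigma> w" using q(1) by (rule cls_step)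
    have eq: "cls \<sigma> q = cls \<sigma> w" by (rule cls_eqI[OF fin s w q(1)])
    have sub: "{q, \<sigma> q} \<subseteq> cls \<tau> q \<inter> cls \<sigma> q"
      using q(1) sq eq q(3) cls_self[of "\<sigma> q" \<tau>] by auto
    have ne: "\<sigma> q \<noteq> q" using cycle_opt.xi_ne[OF C qX] .
    have "card (cls \<tau> q \<inter> cls \<sigma> q) = 2" using q(2) int x(3,4) eq by auto
    then have int': "cls \<tau> q \<inter> cls \<sigma> q = {q, \<sigma> q}"
      using sub ne card_seteq[of "cls \<tau> q \<inter> cls \<sigma> q" "{q, \<sigma> q}"]
      by (metis card.infinite card_2_iff le_refl zero_neq_numeral)
    have c3: "card (cls \<tau> q) \<le> 3" using q(2) c by auto
    show ?thesis using cycle_opt.triangle[OF C qX refl int' c3] by blast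
  qed
  have in_cls: "a \<in> cls \<tau> b" if "cls \<tau> a = cls \<tau> b" for a b using that cls_self[of a \<tau>] by simp
  have step: "\<sigma> q \<in> cls \<sigma> w" if "q \<in> cls \<sigma> w" for q using that by (rule cls_step)
  from cycle_opt.two_pairs(2)[OF C w x(1) y(1) x(3) k(1) x(2) v(1) x(4) k(2) x(5) d]
  show False
  proof (elim disjE bexE conjE)
    fix q
    let ?r = "\<sigma> (\<sigma> q)"
    assume q: "q \<in> cls \<sigma> w" "\<sigma> (\<sigma> (\<sigma> (\<sigma> q))) = q" "cls \<tau> (\<sigma> q) = cls \<tau> q"
      "cls \<tau> ?r = cls \<tau> (\<sigma> ?r)" "cls \<tau> q \<noteq> cls \<tau> ?r" "{cls \<tau> q, cls \<tau> ?r} = {cls \<tau> x, cls \<tau> u}"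
    have qX: "q \<in> X" "?r \<in> X" using ZX q(1) by auto
    have m: "cls \<tau> q \<in> {cls \<tau> x, cls \<tau> u}" "cls \<tau> ?r \<in> {cls \<tau> x, cls \<tau> u}" using q(6) by blast+
    have b1: "\<tau> (\<sigma> q) = q" by (rule turn[OF q(1) m(1) q(3)])
    have b2: "\<tau> (\<sigma> ?r) = ?r" by (rule turn[OF step[OF step[OF q(1)]] m(2) q(4)[symmetric]])
    obtain \<sigma>' where "rigid (cls \<tau> q \<union> cls \<tau> ?r) \<sigma>'" using no_merge[OF qX] ..
    note i = rigidD[OF this]
    \<comment> \<open>Both pairs are cut short, and the 4-cycle becomes the 2-cycle of
      \<open>q\<close> and \<open>?r\<close>.\<close>
    have 1: "\<sigma>' q = ?r" using i(1)[of "\<sigma> q"] b1 in_cls[OF q(3)] by simp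
    have 2: "\<sigma>' ?r = q" using i(1)[of "\<sigma> ?r"] b2 in_cls[OF q(4)[symmetric]] q(2) by simp
    show False by (rule i(3)[OF qX(1) 1 2 q(5)])
  next
    fix q
    let ?a = "\<sigma> q" and ?b = "\<sigma> (\<sigma> q)" and ?c = "\<sigma> (\<sigma> (\<sigma> q))" and ?d = "\<sigma> (\<sigma> (\<sigma> (\<sigma> q)))"
    assume q: "q \<in> cls \<sigma> w" "\<sigma> ?d = q" "cls \<tau> q \<notin> {cls \<tau> x, cls \<tau> u}"
      "cls \<tau> ?a = cls \<tau> ?b" "cls \<tau> ?c = cls \<tau> ?d" "{cls \<tau> ?a, cls \<tau> ?c} = {cls \<tau> x, cls \<tau> u}"
    have qX: "?a \<in> X" "?c \<in> X" "q \<in> X" using ZX q(1) by auto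
    have m: "cls \<tau> ?a \<in> {cls \<tau> x, cls \<tau> u}" "cls \<tau> ?c \<in> {cls \<tau> x, cls \<tau> u}" using q(6) by blast+
    have ne: "cls \<tau> ?a \<noteq> cls \<tau> ?c" using q(6) x(5) by (auto simp: doubleton_eq_iff)
    have nq: "cls \<tau> q \<noteq> cls \<tau> ?a" "cls \<tau> q \<noteq> cls \<tau> ?c" using q(3) m by metis+
    have b1: "\<tau> ?b = ?a" by (rule turn[OF step[OF q(1)] m(1) q(4)[symmetric]])
    have b2: "\<tau> ?d = ?c" by (rule turn[OF step[OF step[OF step[OF q(1)]]] m(2) q(5)[symmetric]])
    obtain \<sigma>' where "rigid (cls \<tau> ?a \<union> cls \<tau> ?c) \<sigma>'" using no_merge[OF qX(1,2)] ..
    note i = rigidD[OF this]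
    \<comment> \<open>Pairs side by side: the 5-cycle becomes the 3-cycle of \<open>?a\<close>,
      \<open>?c\<close> and the unpaired point \<open>q\<close>.\<close>
    have 1: "\<sigma>' ?a = ?c" using i(1)[of ?b] b1 in_cls[OF q(4)[symmetric]] by simp
    have 2: "\<sigma>' ?c = q" using i(1)[of ?d] b2 in_cls[OF q(5)[symmetric]] q(2) by simp
    have "q \<notin> cls \<tau> ?a" "q \<notin> cls \<tau> ?c"
      using nq cls_eqI[OF fin t qX(1), of q] cls_eqI[OF fin t qX(2), of q] by metis+
    then have 3: "\<sigma>' q = ?a" using i(2)[of q] qX by simp
    show False by (rule i(4)[OF qX(1) 1 2 3 ne nq(2)[symmetric] nq(1)[symmetric]])
  next
    fix q
    let ?a = "\<sigma> q" and ?b = "\<sigma> (\<sigma> q)" and ?c = "\<sigma> (\<sigma> (\<sigma> q))" and ?d = "\<sigma> (\<sigma> (\<sigma> (\<sigma> q)))"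
    assume q: "q \<in> cls \<sigma> w" "\<sigma> ?d = q" "cls \<tau> q \<notin> {cls \<tau> x, cls \<tau> u}" "card (cls \<sigma> q) = 5"
      "cls \<tau> ?a = cls \<tau> ?d" "cls \<tau> ?b = cls \<tau> ?c" "{cls \<tau> ?a, cls \<tau> ?b} = {cls \<tau> x, cls \<tau> u}"
    have qX: "?a \<in> X" "?b \<in> X" "q \<in> X" "?d \<in> X" using ZX q(1) by auto
    have m: "cls \<tau> ?a \<in> {cls \<tau> x, cls \<tau> u}" "cls \<tau> ?b \<in> {cls \<tau> x, cls \<tau> u}" using q(7) by blast+
    have ne: "cls \<tau> ?a \<noteq> cls \<tau> ?b" using q(7) x(5) by (auto simp: doubleton_eq_iff)
    have nq: "cls \<tau> q \<noteq> cls \<tau> ?a" using q(3) m by metis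
    have b1: "\<tau> ?c = ?b" by (rule turn[OF step[OF step[OF q(1)]] m(2) q(6)[symmetric]])
    \<comment> \<open>In the nested arrangement \<open>turn\<close> applies to the inner pair only.
      The outer pair is still adjacent in its \<open>\<tau>\<close>-orbit of at most three points,
      in an unknown direction.\<close>
    have "?a \<noteq> ?d" using orbit5(3)[OF fin s qX(3) q(4)] by simp
    moreover have "card (cls \<tau> ?a) \<le> 3" using m(1) c by auto
    ultimately have "\<tau> ?a = ?d \<or> \<tau> ?d = ?a"
      using cycle_opt.consecutive[OF D qX(1) in_cls[OF q(5)[symmetric]]] by simp
    then show False
    proof
      \<comment> \<open>In this direction both \<open>\<tau>\<close>-orbits are inverted, giving the
        2-cycle of \<open>?d\<close> and \<open>?b\<close>.\<close>
      assume ad: "\<tau> ?a = ?d"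
      obtain \<sigma>' where "rigid (cls \<tau> ?a \<union> cls \<tau> ?b) \<sigma>'" using no_merge[OF qX(1,2)] ..
    note i = rigidD[OF this]
      have 1: "\<sigma>' ?d = ?b" using i(1)[of ?a] ad by simp
      have 2: "\<sigma>' ?b = ?d" using i(1)[of ?c] b1 in_cls[OF q(6)[symmetric]] by simp
      show False by (rule i(3)[OF qX(4) 1 2]) (use ne q(5) in simp)
    next
      \<comment> \<open>In this direction only the outer orbit is inverted, giving the 2-cycle of
        \<open>?a\<close> and \<open>q\<close>.\<close>
      assume da: "\<tau> ?d = ?a"
      obtain \<sigma>' where "rigid (cls \<tau> ?a \<union> cls \<tau> ?a) \<sigma>'" using no_merge[OF qX(1,1)] ..
    note i = rigidD[OF this]
      have 1: "\<sigma>' ?a = q" using i(1)[of ?d] da in_cls[OF q(5)[symmetric]] q(2) by simp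
      have "q \<notin> cls \<tau> ?a" using nq cls_eqI[OF fin t qX(1), of q] by metis
      then have 2: "\<sigma>' q = ?a" using i(2)[of q] qX by simp
      show False by (rule i(3)[OF qX(1) 1 2 nq[symmetric]])
    qed
  qed
qed

section \<open>Connectedness of the intersection graph and the final count\<close>

lemma trans_classes:
  assumes "x \<in> X" "y \<in> X" and F: "F = {(Inl Z, Inr W) | Z W. Z \<in> cls \<sigma> ` X \<and> W \<in> cls \<tau> ` X \<and> Z \<inter> W \<noteq> {}}"
  shows "(Inl (cls \<sigma> x), Inl (cls \<sigma> y)) \<in> (F \<union> F\<inverse>)\<^sup>*"
    and "(Inl (cls \<sigma> x), Inr (cls \<tau> x)) \<in> F \<union> F\<inverse>" and "(Inr (cls \<tau> x), Inl (cls \<sigma> x)) \<in> F \<union> F\<inverse>"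
proof -
  have edge: "(Inl (cls \<sigma> a), Inr (cls \<tau> a)) \<in> F" if "a \<in> X" for a
  proof -
    have "cls \<sigma> a \<inter> cls \<tau> a \<noteq> {}" using cls_self[of a \<sigma>] cls_self[of a \<tau>] by blast
    then show ?thesis unfolding F using that by blast
  qed
  show "(Inl (cls \<sigma> x), Inr (cls \<tau> x)) \<in> F \<union> F\<inverse>" "(Inr (cls \<tau> x), Inl (cls \<sigma> x)) \<in> F \<union> F\<inverse>"
    using edge[OF assms(1)] by auto
  have "y \<in> X \<and> (Inl (cls \<sigma> x), Inl (cls \<sigma> y)) \<in> (F \<union> F\<inverse>)\<^sup>*"
    using trans[OF assms(1,2)]
  proof (induction rule: rtrancl_induct)
    case base
    then show ?case using assms(1) by simp
  next
    case (step a b)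
    then have aX: "a \<in> X" by simp
    from step(2) show ?case
    proof
      assume "(a, b) \<in> {(a, \<sigma> a) |a. a \<in> X}"
      then have b: "b = \<sigma> a" by auto
      have "cls \<sigma> b = cls \<sigma> a" unfolding b by (rule cls_eqI[OF fin s aX]) (intro cls_step cls_self)
      then show ?thesis using step(3) b by simp
    next
      assume "(a, b) \<in> {(a, \<tau> a) |a. a \<in> X}"
      then have b: "b = \<tau> a" by auto
      then have bX: "b \<in> X" using aX by simp
      have e: "cls \<tau> b = cls \<tau> a" unfolding b by (rule cls_eqI[OF fin t aX]) (intro cls_step cls_self)
      have "(Inl (cls \<sigma> a), Inr (cls \<tau> a)) \<in> F \<union> F\<inverse>" using edge[OF aX] by simp
      moreover have "(Inr (cls \<tau> a), Inl (cls \<sigma> b)) \<in> F \<union> F\<inverse>" using edge[OF bX] e by simp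
      ultimately show ?thesis using step(3) bX by (meson rtrancl.rtrancl_into_rtrancl)
    qed
  qed
  then show "(Inl (cls \<sigma> x), Inl (cls \<sigma> y)) \<in> (F \<union> F\<inverse>)\<^sup>*" ..
qed

theorem num_cls_bound: "7 * (num_cls \<sigma> X + num_cls \<tau> X) \<le> 4 * card X + 4"
proof -
  let ?C = "cls \<sigma> ` X" and ?D = "cls \<tau> ` X"
  let ?E = "{(Z, W). Z \<in> ?C \<and> W \<in> ?D \<and> Z \<inter> W \<noteq> {}}"
  have fC: "finite ?C" and fD: "finite ?D" using fin by auto
  have "?E = Sigma ?C (\<lambda>Z. {W \<in> ?D. Z \<inter> W \<noteq> {}})" by auto
  then have eC: "card ?E = (\<Sum>Z\<in>?C. card (cls \<tau> ` Z))" using fC fD cycle_opt.cls_image_meet[OF C] by simp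
  have "?E = prod.swap ` Sigma ?D (\<lambda>W. {Z \<in> ?C. W \<inter> Z \<noteq> {}})" by force
  then have eD: "card ?E = (\<Sum>W\<in>?D. card (cls \<sigma> ` W))"
    using fC fD cycle_opt.cls_image_meet[OF D] by (simp add: card_image)
  have conn: "num_cls \<sigma> X + num_cls \<tau> X \<le> card ?E + 1"
  proof -
    \<comment> \<open>The vertices are tagged because the same set may be an orbit of both
      permutations.\<close>
    define F :: "(('a set + 'a set) \<times> ('a set + 'a set)) set"
      where F: "F = {(Inl Z, Inr W) | Z W. Z \<in> ?C \<and> W \<in> ?D \<and> Z \<inter> W \<noteq> {}}"
    have F': "F = (\<lambda>(Z, W). (Inl Z, Inr W)) ` ?E" unfolding F by auto
    have cF: "card F = card ?E" unfolding F' by (rule card_image) (auto simp: inj_on_def)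
    have fE: "finite ?E" by (rule finite_subset[of _ "?C \<times> ?D"]) (use fC fD in auto)
    let ?V = "?C <+> ?D"
    have "card ?V \<le> card F + 1"
    proof (rule connected_card_le)
      show "finite F" unfolding F' using fE by simp
      show "finite ?V" using fC fD by simp
      show "F \<subseteq> ?V \<times> ?V" unfolding F by auto
      note tc = trans_classes[OF _ _ F]
      have sy: "sym ((F \<union> F\<inverse>)\<^sup>*)" by (rule sym_rtrancl) (auto simp: sym_def)
      have toI: "\<exists>x\<in>X. (a, Inl (cls \<sigma> x)) \<in> (F \<union> F\<inverse>)\<^sup>*" if "a \<in> ?V" for a
      proof -
        from that consider x where "x \<in> X" "a = Inl (cls \<sigma> x)" | x where "x \<in> X" "a = Inr (cls \<tau> x)" by auto
        then show ?thesis
        proof cases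
          case 1 then show ?thesis by (intro bexI[of _ x]) simp_all
        next
          case 2 then show ?thesis using tc(3)[of x x] by (intro bexI[of _ x]) (simp_all add: r_into_rtrancl)
        qed
      qed
      fix a b assume "a \<in> ?V" "b \<in> ?V"
      then obtain x y where "x \<in> X" "(a, Inl (cls \<sigma> x)) \<in> (F \<union> F\<inverse>)\<^sup>*"
        "y \<in> X" "(b, Inl (cls \<sigma> y)) \<in> (F \<union> F\<inverse>)\<^sup>*" using toI by meson
      then show "(a, b) \<in> (F \<union> F\<inverse>)\<^sup>*" using tc(1)[of x y] symD[OF sy] by (meson rtrancl_trans)
    qed
    then show ?thesis using cF card_Plus[OF fC fD] by (simp add: num_cls_def)
  qed
  have sumC: "3 * num_cls \<sigma> X + 2 * card ?E + card {W \<in> ?D. deficient \<sigma> W} \<le> 2 * card X + card {Z \<in> ?C. deficient \<tau> Z}"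
    unfolding eC by (rule cycle_opt.charge_sum[OF C D no_small no_two_C])
  have ns: "a \<in> X \<Longrightarrow> a \<noteq> b \<Longrightarrow> cls \<sigma> a \<inter> cls \<tau> a = {a, b} \<Longrightarrow>
    card (cls \<tau> a) \<le> 3 \<Longrightarrow> card (cls \<sigma> a) \<le> 3 \<Longrightarrow> False" for a b
    using no_small[of a b] by (simp add: Int_commute)
  have sumD: "3 * num_cls \<tau> X + 2 * card ?E + card {Z \<in> ?C. deficient \<tau> Z} \<le> 2 * card X + card {W \<in> ?D. deficient \<sigma> W}"
    unfolding eD by (rule cycle_opt.charge_sum[OF D C ns no_two_D])
  have "7 * (a + b) \<le> 4 * n + 4"
    if "a + b \<le> m + 1" "3 * a + 2 * m + d \<le> 2 * n + c" "3 * b + 2 * m + c \<le> 2 * n + d" for a b m n c d :: nat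
    using that by (simp add: algebra_simps)
  from this[OF conn sumC sumD] show ?thesis .
qed

end

section \<open>The local search program\<close>

type_synonym edge = "nat \<times> nat"
type_synonym colouring = "edge list \<times> edge list \<times> edge list"

definition joined :: "nat list list \<Rightarrow> edge \<Rightarrow> bool" where
  "joined P e \<longleftrightarrow> (\<exists>p\<in>set P. fst e \<in> set p \<and> snd e \<in> set p)"

definition join_parts :: "nat list list \<Rightarrow> edge \<Rightarrow> nat list list" where
  "join_parts P e = (if joined P e then P
     else concat (filter (\<lambda>p. fst e \<in> set p \<or> snd e \<in> set p) P) #
       filter (\<lambda>p. \<not> (fst e \<in> set p \<or> snd e \<in> set p)) P)"

definition parts :: "nat list \<Rightarrow> edge list \<Rightarrow> nat list list" where
  "parts vs es = foldl join_parts (map (\<lambda>v. [v]) vs) es"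

text \<open>Exactly one part contains a given vertex, so the concatenation is just that
  part.\<close>

definition part_of :: "nat list list \<Rightarrow> nat \<Rightarrow> nat list" where
  "part_of P w = concat (filter (\<lambda>p. w \<in> set p) P)"

text \<open>Testing one endpoint is enough: \<open>K\<close> will be a component of the first two
  colours and contains both ends of such an edge or neither.\<close>

definition exchange :: "nat list \<Rightarrow> colouring \<Rightarrow> colouring" where
  "exchange K s =
    (filter (\<lambda>e. \<not> fst e \<in> set K) (fst s) @ filter (\<lambda>e. fst e \<in> set K) (fst (snd s)),
     filter (\<lambda>e. \<not> fst e \<in> set K) (fst (snd s)) @ filter (\<lambda>e. fst e \<in> set K) (fst s),
     snd (snd s))"

definition kempe :: "nat list \<Rightarrow> nat \<Rightarrow> colouring \<Rightarrow> colouring" where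
  "kempe vs w s = exchange (part_of (parts vs (fst s @ fst (snd s))) w) s"

definition colour_perms :: "colouring \<Rightarrow> colouring list" where
  "colour_perms s = (let P = fst s; Q = fst (snd s); R = snd (snd s) in
    [(P, Q, R), (P, R, Q), (Q, P, R), (Q, R, P), (R, P, Q), (R, Q, P)])"

text \<open>Every renaming of the colours occurs with and without an exchange. In particular the
  identity is a move, so that three moves include all shorter sequences.\<close>

definition moves :: "nat list \<Rightarrow> colouring \<Rightarrow> colouring list" where
  "moves vs s = concat (map (\<lambda>p. p # map (\<lambda>w. kempe vs w p) vs) (colour_perms s))"

definition moves3 :: "nat list \<Rightarrow> colouring \<Rightarrow> colouring list" where
  "moves3 vs s = concat (map (\<lambda>p. moves vs p) (concat (map (\<lambda>p. moves vs p) (moves vs s))))"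

definition uncovered :: "edge list \<Rightarrow> nat \<Rightarrow> bool" where
  "uncovered M v \<longleftrightarrow> \<not> (\<exists>e\<in>set M. v = fst e \<or> v = snd e)"

text \<open>The new edge always receives the first colour, since renamings are among the moves. The
  default \<open>s\<close> would lose the edge; \<open>free_colour\<close> shows that it does not
  occur for the graphs considered.\<close>

definition add_edge :: "nat list \<Rightarrow> colouring \<Rightarrow> edge \<Rightarrow> colouring" where
  "add_edge vs s e =
    (case filter (\<lambda>c. uncovered (fst c) (fst e) \<and> uncovered (fst c) (snd e)) (moves vs s) of
      [] \<Rightarrow> s | c # cs \<Rightarrow> (e # fst c, snd c))"

definition colour :: "nat list \<Rightarrow> edge list \<Rightarrow> colouring" where
  "colour vs es = foldl (\<lambda>s e. add_edge vs s e) ([], [], []) es"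

definition factor12 :: "colouring \<Rightarrow> edge list" where
  "factor12 s = fst s @ fst (snd s)"

definition factor13 :: "colouring \<Rightarrow> edge list" where
  "factor13 s = fst s @ snd (snd s)"

text \<open>Lexicographic comparison with \<open>factor13\<close> first, phrased through strict
  comparisons of list lengths, which \<open>ptime_length_less\<close> decides.\<close>

definition better :: "nat list \<Rightarrow> colouring \<Rightarrow> colouring \<Rightarrow> bool" where
  "better vs c s \<longleftrightarrow> length (parts vs (factor13 c)) < length (parts vs (factor13 s)) \<or>
    \<not> length (parts vs (factor13 s)) < length (parts vs (factor13 c)) \<and>
    length (parts vs (factor12 c)) < length (parts vs (factor12 s))"

definition improve :: "nat list \<Rightarrow> colouring \<Rightarrow> colouring" where
  "improve vs s = (case filter (\<lambda>c. better vs c s) (moves3 vs s) of [] \<Rightarrow> s | c # cs \<Rightarrow> c)"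

text \<open>Only the length matters: it bounds the number of improving steps.\<close>

definition fuel :: "nat list \<Rightarrow> edge list" where
  "fuel vs = concat (map (\<lambda>v. map (\<lambda>w. (v, w)) (vs @ vs)) (vs @ vs))"

text \<open>Once no improving sequence of moves is left, \<open>improve\<close> returns its
  argument, and the remaining rounds are idle.\<close>

definition optimise :: "nat list \<Rightarrow> colouring \<Rightarrow> colouring" where
  "optimise vs s = foldl (\<lambda>s x. improve vs s) s (fuel vs)"

text \<open>A scan as in Kruskal's algorithm. An edge between different parts is taken twice, which
  connects them without changing the parity of any degree.\<close>

definition doubles :: "nat list list \<Rightarrow> edge list \<Rightarrow> edge list" where
  "doubles P es = snd (foldl (\<lambda>s e. if joined (fst s) e then s
     else (join_parts (fst s) e, e # e # snd s)) (P, []) es)"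

definition best_factor :: "nat list \<Rightarrow> colouring \<Rightarrow> edge list" where
  "best_factor vs s = (if length (parts vs (factor12 s)) < length (parts vs (factor13 s))
     then factor12 s else factor13 s)"

definition connect :: "nat list \<Rightarrow> edge list \<Rightarrow> edge list \<Rightarrow> edge list" where
  "connect vs es F = F @ doubles (parts vs F) es"

definition tour :: "nat list \<Rightarrow> edge list \<Rightarrow> edge list" where
  "tour vs es = connect vs es (best_factor vs (optimise vs (colour vs es)))"

section \<open>Running time of the search\<close>

lemma ptime_joined [ptime_intros]: "ptime f \<Longrightarrow> ptime g \<Longrightarrow> ptime (\<lambda>x. joined (f x) (g x))"
  by (rule ptime_comp2) (unfold joined_def, intro ptime_intros)

lemma ptime_join_parts [ptime_intros]: "ptime f \<Longrightarrow> ptime g \<Longrightarrow> ptime (\<lambda>x. join_parts (f x) (g x))"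
  by (rule ptime_comp2) (unfold join_parts_def, intro ptime_intros)

lemma sz_join_parts: "sz (join_parts P e) \<le> sz P + 1"
proof -
  let ?g = "\<lambda>p. fst e \<in> set p \<or> snd e \<in> set p"
  have "sz (concat (filter ?g P)) + sz (filter (\<lambda>p. \<not> ?g p) P) \<le> sz P"
    using sz_concat[of "filter ?g P"] sz_filter_split[of ?g P] by linarith
  then show ?thesis unfolding join_parts_def by simp
qed

lemma ptime_parts [ptime_intros]: "ptime f \<Longrightarrow> ptime g \<Longrightarrow> ptime (\<lambda>x. parts (f x) (g x))"
proof (rule ptime_comp2[where h = parts])
  show "ptime (\<lambda>p. parts (fst p) (snd p))"
    unfolding parts_def
    by (rule ptime_foldl_additive[where c = "\<lambda>n. 1"]) (intro ptime_intros pb_intros | rule sz_join_parts)+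
qed

lemma ptime_part_of [ptime_intros]: "ptime f \<Longrightarrow> ptime g \<Longrightarrow> ptime (\<lambda>x. part_of (f x) (g x))"
  by (rule ptime_comp2) (unfold part_of_def, intro ptime_intros)

lemma ptime_exchange [ptime_intros]: "ptime f \<Longrightarrow> ptime g \<Longrightarrow> ptime (\<lambda>x. exchange (f x) (g x))"
  by (rule ptime_comp2) (unfold exchange_def, intro ptime_intros)

lemma ptime_kempe [ptime_intros]:
  "ptime f \<Longrightarrow> ptime g \<Longrightarrow> ptime h \<Longrightarrow> ptime (\<lambda>x. kempe (f x) (g x) (h x))"
  by (rule ptime_comp3) (unfold kempe_def, intro ptime_intros)

lemma ptime_colour_perms [ptime_intros]: "ptime f \<Longrightarrow> ptime (\<lambda>x. colour_perms (f x))"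
  by (rule ptime_comp[of colour_perms]) (unfold colour_perms_def Let_def, intro ptime_intros)

lemma ptime_moves [ptime_intros]: "ptime f \<Longrightarrow> ptime g \<Longrightarrow> ptime (\<lambda>x. moves (f x) (g x))"
  by (rule ptime_comp2) (unfold moves_def, intro ptime_intros)

lemma ptime_moves3 [ptime_intros]: "ptime f \<Longrightarrow> ptime g \<Longrightarrow> ptime (\<lambda>x. moves3 (f x) (g x))"
  by (rule ptime_comp2) (unfold moves3_def, intro ptime_intros)

lemma ptime_uncovered [ptime_intros]: "ptime f \<Longrightarrow> ptime g \<Longrightarrow> ptime (\<lambda>x. uncovered (f x) (g x))"
  by (rule ptime_comp2) (unfold uncovered_def, intro ptime_intros)

lemma ptime_add_edge [ptime_intros]:
  "ptime f \<Longrightarrow> ptime g \<Longrightarrow> ptime h \<Longrightarrow> ptime (\<lambda>x. add_edge (f x) (g x) (h x))"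
  by (rule ptime_comp3) (unfold add_edge_def, intro ptime_intros)

text \<open>Moves only redistribute edges among three lists. Hence colourings keep their size
  throughout the local search, and while colouring they grow only by the inserted edges, as the
  iteration rules require.\<close>

lemma sz_exchange: "sz (exchange K s) = sz s"
proof -
  let ?g = "\<lambda>e :: edge. fst e \<in> set K"
  show ?thesis
    using sz_filter_split[of ?g "fst s"] sz_filter_split[of ?g "fst (snd s)"]
    by (cases s) (simp add: exchange_def)
qed

lemma sz_moves: "c \<in> set (moves vs s) \<Longrightarrow> sz c = sz s"
  by (cases s) (auto simp: moves_def colour_perms_def kempe_def sz_exchange)

lemma sz_moves3: "c \<in> set (moves3 vs s) \<Longrightarrow> sz c = sz s"
  by (auto simp: moves3_def dest!: sz_moves)

lemma sz_add_edge: "sz (add_edge vs s e) \<le> sz s + (sz e + 1)"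
proof -
  let ?l = "filter (\<lambda>c. uncovered (fst c) (fst e) \<and> uncovered (fst c) (snd e)) (moves vs s)"
  show ?thesis
  proof (cases ?l)
    case Nil
    then show ?thesis by (simp add: add_edge_def)
  next
    case (Cons c cs)
    then have "c \<in> set ?l" by (metis list.set_intros(1))
    then have "sz c = sz s" using sz_moves[of c vs s] by simp
    then show ?thesis using Cons by (cases c) (simp add: add_edge_def)
  qed
qed

lemma sz_improve: "sz (improve vs s) = sz s"
proof -
  let ?l = "filter (\<lambda>c. better vs c s) (moves3 vs s)"
  show ?thesis
  proof (cases ?l)
    case Nil
    then show ?thesis by (simp add: improve_def)
  next
    case (Cons c cs)
    then have "c \<in> set ?l" by (metis list.set_intros(1))
    then have "sz c = sz s" using sz_moves3[of c vs s] by simp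
    then show ?thesis using Cons by (simp add: improve_def)
  qed
qed

lemma ptime_colour [ptime_intros]: "ptime f \<Longrightarrow> ptime g \<Longrightarrow> ptime (\<lambda>x. colour (f x) (g x))"
proof (rule ptime_comp2[where h = colour])
  have le: "sz (add_edge vs s x) \<le> sz s + ((k + sz x) + 1)" for vs s x k
    using sz_add_edge[of vs s x] by linarith
  show "ptime (\<lambda>p. colour (fst p) (snd p))"
    unfolding colour_def
    by (rule ptime_foldl_additive[where c = "\<lambda>n. n + 1"]) (intro ptime_intros pb_intros | rule le)+
qed

lemma ptime_factor12 [ptime_intros]: "ptime f \<Longrightarrow> ptime (\<lambda>x. factor12 (f x))"
  by (rule ptime_comp[of factor12]) (unfold factor12_def, intro ptime_intros)

lemma ptime_factor13 [ptime_intros]: "ptime f \<Longrightarrow> ptime (\<lambda>x. factor13 (f x))"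
  by (rule ptime_comp[of factor13]) (unfold factor13_def, intro ptime_intros)

lemma ptime_better [ptime_intros]:
  "ptime f \<Longrightarrow> ptime g \<Longrightarrow> ptime h \<Longrightarrow> ptime (\<lambda>x. better (f x) (g x) (h x))"
  by (rule ptime_comp3) (unfold better_def, intro ptime_intros)

lemma ptime_improve [ptime_intros]: "ptime f \<Longrightarrow> ptime g \<Longrightarrow> ptime (\<lambda>x. improve (f x) (g x))"
  by (rule ptime_comp2) (unfold improve_def, intro ptime_intros)

lemma ptime_fuel [ptime_intros]: "ptime f \<Longrightarrow> ptime (\<lambda>x. fuel (f x))"
  by (rule ptime_comp[of fuel]) (unfold fuel_def, intro ptime_intros)

lemma ptime_optimise [ptime_intros]: "ptime f \<Longrightarrow> ptime g \<Longrightarrow> ptime (\<lambda>x. optimise (f x) (g x))"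
proof (rule ptime_comp2[where h = optimise])
  show "ptime (\<lambda>p. optimise (fst p) (snd p))"
    unfolding optimise_def
    by (rule ptime_foldl_additive[where c = "\<lambda>n. 0"]) (intro ptime_intros pb_intros | simp add: sz_improve)+
qed

lemma ptime_doubles [ptime_intros]: "ptime f \<Longrightarrow> ptime g \<Longrightarrow> ptime (\<lambda>x. doubles (f x) (g x))"
proof (rule ptime_comp2[where h = doubles])
  have le: "sz (if joined (fst s) e then s else (join_parts (fst s) e, e # e # snd s))
      \<le> sz s + (2 * (k + sz e) + 3)" for s :: "nat list list \<times> edge list" and e k
    using sz_join_parts[of "fst s" e] by (cases s) auto
  show "ptime (\<lambda>p. doubles (fst p) (snd p))"
    unfolding doubles_def
    by (rule ptime_snd, rule ptime_foldl_additive[where c = "\<lambda>n. 2 * n + 3"])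
      (intro ptime_intros pb_intros | rule le)+
qed

lemma ptime_best_factor [ptime_intros]: "ptime f \<Longrightarrow> ptime g \<Longrightarrow> ptime (\<lambda>x. best_factor (f x) (g x))"
  by (rule ptime_comp2) (unfold best_factor_def, intro ptime_intros)

lemma ptime_connect [ptime_intros]:
  "ptime f \<Longrightarrow> ptime g \<Longrightarrow> ptime h \<Longrightarrow> ptime (\<lambda>x. connect (f x) (g x) (h x))"
  by (rule ptime_comp3) (unfold connect_def, intro ptime_intros)

lemma ptime_tour: "ptime (\<lambda>p. tour (fst p) (snd p))"
  unfolding tour_def by (intro ptime_intros)

lemma tour_program:
  "\<exists>p q. \<forall>vs es. \<exists>t. runs p (tree_of_graph vs es) (tree_of_edges (tour vs es)) t \<and>
    t \<le> poly q (size (tree_of_graph vs es))"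
proof -
  have e: "enc es = tree_of_edges es" for es :: "edge list"
    unfolding enc_list_def tree_of_edges_def
    by (rule arg_cong[where f = tree_of_list], rule map_cong) (auto simp: enc_prod_def enc_nat_def)
  have g: "enc (vs, es) = tree_of_graph vs es" for vs and es :: "edge list"
    unfolding tree_of_graph_def enc_Pair e by (simp add: enc_list_def enc_nat_def[abs_def])
  obtain p q where "\<And>x. \<exists>t. runs p (enc x) (enc (tour (fst x) (snd x))) t \<and> t \<le> poly q (sz x)"
    using ptimeE[OF ptime_tour] by blast
  from this[of "(_, _)"] show ?thesis unfolding sz_def g e fst_conv snd_conv by blast
qed

section \<open>Components and degrees of edge lists\<close>

definition adj :: "edge list \<Rightarrow> (nat \<times> nat) set" where
  "adj M = set M \<union> (set M)\<inverse>"

lemma sym_adj: "sym (adj M)"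
  by (auto simp: adj_def sym_def)

lemma adj_append [simp]: "adj (M @ N) = adj M \<union> adj N"
  by (auto simp: adj_def)

lemma adj_Cons: "adj (e # M) = adj M \<union> {(fst e, snd e), (snd e, fst e)}"
  by (auto simp: adj_def)

lemma adj_Nil [simp]: "adj [] = {}"
  by (simp add: adj_def)

text \<open>Distinctness is demanded of the sets, not of the lists, so that the length of
  \<open>P\<close> is the number of components.\<close>

definition lists_comps :: "nat list list \<Rightarrow> nat set \<Rightarrow> (nat \<times> nat) set \<Rightarrow> bool" where
  "lists_comps P V R \<longleftrightarrow> set ` set P = component R ` V \<and> distinct (map set P)"

lemma lists_comps_length: "lists_comps P V R \<Longrightarrow> length P = num_comps V R"
  unfolding lists_comps_def num_comps_def by (metis distinct_card length_map list.set_map)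

lemma lists_comps_joined:
  assumes "lists_comps P V R" "sym R" "fst e \<in> V"
  shows "joined P e \<longleftrightarrow> snd e \<in> component R (fst e)"
proof
  assume "joined P e"
  then obtain p where p: "p \<in> set P" "fst e \<in> set p" "snd e \<in> set p" by (auto simp: joined_def)
  have "set p \<in> component R ` V" using p(1) assms(1) unfolding lists_comps_def by (metis imageI)
  then obtain x where "set p = component R x" by blast
  then show "snd e \<in> component R (fst e)" using p component_sym[OF assms(2), of "fst e" x] by simp
next
  assume s: "snd e \<in> component R (fst e)"
  have "component R (fst e) \<in> set ` set P" using assms by (simp add: lists_comps_def)
  then obtain p where "p \<in> set P" "set p = component R (fst e)" by auto
  then show "joined P e" using s component_self[of "fst e" R] unfolding joined_def by metis
qed

lemma lists_comps_mem:
  assumes "lists_comps P V R" "sym R" "p \<in> set P" "u \<in> V"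
  shows "u \<in> set p \<longleftrightarrow> set p = component R u"
proof
  assume u: "u \<in> set p"
  have "set p \<in> component R ` V" using assms(1,3) unfolding lists_comps_def by (metis imageI)
  then obtain x where "set p = component R x" by blast
  then show "set p = component R u" using u component_sym[OF assms(2), of u x] by simp
next
  assume "set p = component R u"
  then show "u \<in> set p" using component_self[of u R] by simp
qed

lemma lists_comps_join:
  assumes P: "lists_comps P V R" and R: "sym R" and e: "fst e \<in> V" "snd e \<in> V"
  shows "lists_comps (join_parts P e) V (R \<union> {(fst e, snd e), (snd e, fst e)})"
proof (cases "joined P e")
  case True
  then have "snd e \<in> component R (fst e)" using lists_comps_joined[OF P R e(1)] by simp
  then have "component (R \<union> {(fst e, snd e), (snd e, fst e)}) = component R" by (rule component_insert_same[OF R])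
  then show ?thesis using P True unfolding lists_comps_def join_parts_def by simp
next
  case False
  let ?g = "\<lambda>p. fst e \<in> set p \<or> snd e \<in> set p"
  let ?K = "component R ` V - {component R (fst e), component R (snd e)}"
  have g: "?g p \<longleftrightarrow> set p = component R (fst e) \<or> set p = component R (snd e)" if "p \<in> set P" for p
    using lists_comps_mem[OF P R that] e by simp
  have img: "set ` set P = component R ` V" using P by (simp add: lists_comps_def)
  have 1: "set (concat (filter ?g P)) = component R (fst e) \<union> component R (snd e)"
  proof -
    have "{p \<in> set P. ?g p} = {p \<in> set P. set p = component R (fst e) \<or> set p = component R (snd e)}"
      using g by (intro Collect_cong) blast
    then have "set (concat (filter ?g P)) = \<Union> (set ` {p \<in> set P. set p = component R (fst e) \<or> set p = component R (snd e)})"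
      by (simp only: set_concat set_filter)
    also have "set ` {p \<in> set P. set p = component R (fst e) \<or> set p = component R (snd e)} =
      {K \<in> set ` set P. K = component R (fst e) \<or> K = component R (snd e)}" by blast
    also have "{K \<in> set ` set P. K = component R (fst e) \<or> K = component R (snd e)} = {component R (fst e), component R (snd e)}"
      unfolding img using e by blast
    finally show ?thesis by simp
  qed
  have 2: "set ` set (filter (\<lambda>p. \<not> ?g p) P) = ?K"
  proof -
    have "{p \<in> set P. \<not> ?g p} = {p \<in> set P. \<not> (set p = component R (fst e) \<or> set p = component R (snd e))}"
      using g by (intro Collect_cong) blast
    then have "set ` set (filter (\<lambda>p. \<not> ?g p) P) = set ` set P - {component R (fst e), component R (snd e)}"
      unfolding set_filter by blast
    then show ?thesis unfolding img .
  qed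
  have d: "distinct (map set (filter (\<lambda>p. \<not> ?g p) P))"
    using P by (simp add: lists_comps_def distinct_map_filter)
  have n: "component R (fst e) \<union> component R (snd e) \<notin> ?K" by (rule component_union_new[OF R])
  have jp: "join_parts P e = concat (filter ?g P) # filter (\<lambda>p. \<not> ?g p) P"
    using False by (simp add: join_parts_def)
  show ?thesis unfolding lists_comps_def jp component_image_insert[OF R e]
  proof
    show "set ` set (concat (filter ?g P) # filter (\<lambda>p. \<not> ?g p) P) = insert (component R (fst e) \<union> component R (snd e)) ?K"
      using 1 2 by (simp del: set_concat set_filter)
    show "distinct (map set (concat (filter ?g P) # filter (\<lambda>p. \<not> ?g p) P))"
      using 1 2 d n by (simp del: set_concat set_filter)
  qed
qed

lemma lists_comps_singletons: "distinct vs \<Longrightarrow> lists_comps (map (\<lambda>v. [v]) vs) (set vs) {}"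
proof -
  have c: "component {} = (\<lambda>x :: nat. {x})" by (auto simp: component_def)
  assume "distinct vs"
  then show ?thesis unfolding lists_comps_def c by (simp add: image_image distinct_map inj_on_def)
qed

lemma lists_comps_foldl:
  assumes "lists_comps P V R" "sym R" "set M \<subseteq> V \<times> V"
  shows "lists_comps (foldl join_parts P M) V (R \<union> adj M)"
  using assms
proof (induction M arbitrary: P R)
  case (Cons e M)
  have e: "fst e \<in> V" "snd e \<in> V" using Cons.prems by auto
  have "sym (R \<union> {(fst e, snd e), (snd e, fst e)})" using Cons.prems(2) by (auto simp: sym_def)
  from Cons.IH[OF lists_comps_join[OF Cons.prems(1,2) e] this] show ?case
    using Cons.prems(3) by (simp add: adj_Cons Un_ac)
qed simp

lemma parts_comps:
  assumes "distinct vs" "set M \<subseteq> set vs \<times> set vs"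
  shows "lists_comps (parts vs M) (set vs) (adj M)"
  using lists_comps_foldl[OF lists_comps_singletons[OF assms(1)] _ assms(2)]
  by (simp add: parts_def sym_def)

lemma length_parts:
  assumes "distinct vs" "set M \<subseteq> set vs \<times> set vs"
  shows "length (parts vs M) = num_comps (set vs) (adj M)"
  by (rule lists_comps_length[OF parts_comps[OF assms]])

lemma set_part_of:
  assumes "lists_comps P V R" "sym R" "w \<in> V"
  shows "set (part_of P w) = component R w"
proof -
  have "set (part_of P w) = \<Union> {K \<in> set ` set P. K = component R w}"
    using lists_comps_mem[OF assms(1,2) _ assms(3)] by (auto simp: part_of_def)
  also have "{K \<in> set ` set P. K = component R w} = {component R w}"
    using assms by (auto simp: lists_comps_def)
  finally show ?thesis by simp
qed

lemma num_comps_le: "finite V \<Longrightarrow> num_comps V R \<le> card V"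
  unfolding num_comps_def by (rule card_image_le)

definition deg :: "edge list \<Rightarrow> nat \<Rightarrow> nat" where
  "deg M v = length (filter (\<lambda>e. v = fst e \<or> v = snd e) M)"

lemma deg_Nil [simp]: "deg [] v = 0"
  and deg_Cons: "deg (e # M) v = (if v = fst e \<or> v = snd e then 1 else 0) + deg M v"
  and deg_append [simp]: "deg (M @ N) v = deg M v + deg N v"
  by (simp_all add: deg_def)

lemma deg_mset: "deg M v = size (filter_mset (\<lambda>e. v = fst e \<or> v = snd e) (mset M))"
  unfolding deg_def by (metis mset_filter size_mset)

lemma uncovered_deg: "uncovered M v \<longleftrightarrow> deg M v = 0"
  by (auto simp: uncovered_def deg_def filter_empty_conv)

lemma deg_filter:
  assumes "\<And>e. e \<in> set M \<Longrightarrow> v = fst e \<or> v = snd e \<Longrightarrow> P e = b"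
  shows "deg (filter P M) v = (if b then deg M v else 0)"
proof -
  have "filter (\<lambda>e. v = fst e \<or> v = snd e) (filter P M) = (if b then filter (\<lambda>e. v = fst e \<or> v = snd e) M else [])"
    using assms by (induction M) auto
  then show ?thesis by (simp add: deg_def)
qed

definition closed_in :: "nat set \<Rightarrow> edge list \<Rightarrow> bool" where
  "closed_in K M \<longleftrightarrow> (\<forall>e\<in>set M. fst e \<in> K \<longleftrightarrow> snd e \<in> K)"

lemma closed_in_comp: "set M \<subseteq> set N \<Longrightarrow> closed_in (component (adj N) w) M"
  unfolding closed_in_def
proof
  fix e assume M: "set M \<subseteq> set N" "e \<in> set M"
  have "(fst e, snd e) \<in> adj N" "(snd e, fst e) \<in> adj N" using M by (cases e; auto simp: adj_def)+
  then show "fst e \<in> component (adj N) w \<longleftrightarrow> snd e \<in> component (adj N) w" by (meson component_step)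
qed

lemma deg_filter_closed:
  assumes "closed_in K M"
  shows "deg (filter (\<lambda>e. fst e \<in> K) M) v = (if v \<in> K then deg M v else 0)"
    and "deg (filter (\<lambda>e. fst e \<notin> K) M) v = (if v \<in> K then 0 else deg M v)"
proof -
  have c: "fst e \<in> K \<longleftrightarrow> v \<in> K" if "e \<in> set M" "v = fst e \<or> v = snd e" for e
    using assms that unfolding closed_in_def by metis
  show "deg (filter (\<lambda>e. fst e \<in> K) M) v = (if v \<in> K then deg M v else 0)"
    by (rule deg_filter) (rule c)
  have "deg (filter (\<lambda>e. fst e \<notin> K) M) v = (if v \<notin> K then deg M v else 0)"
    by (rule deg_filter) (simp add: c)
  then show "deg (filter (\<lambda>e. fst e \<notin> K) M) v = (if v \<in> K then 0 else deg M v)" by simp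
qed

text \<open>Every edge has exactly one end in \<open>S\<close>, so it is counted once if it lies in
  \<open>K\<close> and not at all otherwise.\<close>

lemma sum_deg:
  assumes "finite K" "closed_in K M" "\<And>e. e \<in> set M \<Longrightarrow> fst e \<in> S \<longleftrightarrow> snd e \<notin> S"
  shows "(\<Sum>x\<in>K \<inter> S. deg M x) = length (filter (\<lambda>e. fst e \<in> K) M)"
  using assms(2,3)
proof (induction M)
  case (Cons e M)
  have e: "fst e \<in> K \<longleftrightarrow> snd e \<in> K" "fst e \<in> S \<longleftrightarrow> snd e \<notin> S" and c: "closed_in K M"
    using Cons.prems by (auto simp: closed_in_def)
  have "(\<Sum>x\<in>K \<inter> S. deg (e # M) x) = (\<Sum>x\<in>K \<inter> S. if x = fst e \<or> x = snd e then 1 else 0) + (\<Sum>x\<in>K \<inter> S. deg M x)"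
    by (simp only: deg_Cons sum.distrib)
  moreover have "(\<Sum>x\<in>K \<inter> S. if x = fst e \<or> x = snd e then 1 else 0) = card (K \<inter> S \<inter> {fst e, snd e})"
  proof -
    have "(\<Sum>x\<in>K \<inter> S. if x = fst e \<or> x = snd e then 1 else 0) = (\<Sum>x\<in>{x \<in> K \<inter> S. x = fst e \<or> x = snd e}. 1::nat)"
      by (rule sum.inter_filter[symmetric]) (use assms(1) in simp)
    also have "{x \<in> K \<inter> S. x = fst e \<or> x = snd e} = K \<inter> S \<inter> {fst e, snd e}" by blast
    finally show ?thesis unfolding card_eq_sum .
  qed
  moreover have "K \<inter> S \<inter> {fst e, snd e} = (if fst e \<in> K then {if fst e \<in> S then fst e else snd e} else {})"
    using e by auto
  ultimately show ?case using Cons.IH[OF c] Cons.prems(2) by simp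
qed simp

text \<open>The vertex \<open>v\<close> misses the colour \<open>N\<close> and \<open>u\<close> misses \<open>M\<close>. If both lay on one two-coloured path,
  they would be its ends, and its length parity would put them on the same side.\<close>

lemma kempe_avoids:
  assumes fin: "finite V" and side: "\<And>e. e \<in> set (M @ N) \<Longrightarrow> fst e \<in> S \<longleftrightarrow> snd e \<notin> S"
    and sub: "set (M @ N) \<subseteq> V \<times> V" and d: "\<And>x. deg M x \<le> 1" "\<And>x. deg N x \<le> 1"
    and v: "v \<in> V" and u: "u \<in> S \<longleftrightarrow> v \<notin> S" "deg M u = 0" "deg N v = 0"
  shows "u \<notin> component (adj (M @ N)) v"
proof
  define K where "K = component (adj (M @ N)) v"
  assume "u \<in> component (adj (M @ N)) v"
  then have uK: "u \<in> K" by (simp add: K_def)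
  have vK: "v \<in> K" by (simp add: K_def)
  have KV: "K \<subseteq> V" unfolding K_def by (rule component_closed[OF v]) (use sub in \<open>auto simp: adj_def\<close>)
  have fK: "finite K" using KV fin finite_subset by blast
  have cM: "closed_in K M" and cN: "closed_in K N" unfolding K_def by (intro closed_in_comp; simp)+
  let ?m = "length (filter (\<lambda>e. fst e \<in> K) M)" and ?n = "length (filter (\<lambda>e. fst e \<in> K) N)"
  have side': "fst e \<in> - S \<longleftrightarrow> snd e \<notin> - S" if "e \<in> set (M @ N)" for e using side[OF that] by auto
  have m: "(\<Sum>x\<in>K \<inter> S. deg M x) = ?m" "(\<Sum>x\<in>K \<inter> - S. deg M x) = ?m"
    using sum_deg[OF fK cM, of S] sum_deg[OF fK cM, of "- S"] side side' by auto
  have n: "(\<Sum>x\<in>K \<inter> S. deg N x) = ?n" "(\<Sum>x\<in>K \<inter> - S. deg N x) = ?n"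
    using sum_deg[OF fK cN, of S] sum_deg[OF fK cN, of "- S"] side side' by auto
  have le: "(\<Sum>x\<in>T. deg L x) \<le> card T" if "\<And>x. deg L x \<le> 1" for T L
    using sum_bounded_above[of T "deg L" 1] that by simp
  have lt: "(\<Sum>x\<in>T. deg L x) < card T" if "\<And>x. deg L x \<le> 1" "finite T" "a \<in> T" "deg L a = 0" for T L a
  proof -
    have "(\<Sum>x\<in>T. deg L x) = (\<Sum>x\<in>T - {a}. deg L x)" using that by (simp add: sum.remove)
    also have "\<dots> \<le> card (T - {a})" by (rule le) (rule that)
    also have "\<dots> < card T" using that by (intro psubset_card_mono) auto
    finally show ?thesis .
  qed
  have K: "card K = card (K \<inter> S) + card (K \<inter> - S)"
    using fK card_Un_disjoint[of "K \<inter> S" "K \<inter> - S"] by (simp add: Int_Un_distrib[symmetric] Int_ac)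
  define F where "F = set (filter (\<lambda>e. fst e \<in> K) (M @ N))"
  have "card F \<le> length (filter (\<lambda>e. fst e \<in> K) (M @ N))" unfolding F_def by (rule card_length)
  then have cF: "card F \<le> ?m + ?n" by simp
  have FK: "F \<subseteq> K \<times> K" unfolding F_def using cM cN by (auto simp: closed_in_def)
  have reach: "(v, x) \<in> (F \<union> F\<inverse>)\<^sup>*" if "x \<in> K" for x
  proof -
    have "(v, x) \<in> (adj (M @ N))\<^sup>*" using that by (simp add: K_def component_def)
    then show ?thesis
    proof (induction rule: rtrancl_induct)
      case (step y z)
      have y: "y \<in> K" using step(1) by (simp add: K_def component_def)
      have z: "z \<in> K" using step(1,2) unfolding K_def component_def by (auto intro: rtrancl_into_rtrancl)
      have "(y, z) \<in> F \<union> F\<inverse>" using step(2) y z unfolding F_def adj_def by auto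
      then show ?case using step(3) by (rule rtrancl_into_rtrancl[rotated])
    qed simp
  qed
  have sF: "sym ((F \<union> F\<inverse>)\<^sup>*)" by (rule sym_rtrancl) (auto simp: sym_def)
  have "card K \<le> card F + 1"
  proof (rule connected_card_le)
    show "finite F" unfolding F_def by simp
    fix x y assume "x \<in> K" "y \<in> K"
    then show "(x, y) \<in> (F \<union> F\<inverse>)\<^sup>*" using reach symD[OF sF] by (meson rtrancl_trans)
  qed (use FK fK in auto)
  then have kk: "card (K \<inter> S) + card (K \<inter> - S) \<le> ?m + ?n + 1" using K cF by linarith
  \<comment> \<open>Each colour count is a degree sum over either side of \<open>K\<close>. On the
    side of \<open>u\<close> the count for \<open>M\<close> is smaller than the number of vertices,
    and on the side of \<open>v\<close>, which is the other side, so is the count for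
    \<open>N\<close>. Hence \<open>card K\<close> is at least \<open>?m + ?n + 2\<close>, while
    connectedness allows only \<open>?m + ?n + 1\<close>.\<close>
  show False
  proof (cases "u \<in> S")
    case True
    then have "u \<in> K \<inter> S" "v \<in> K \<inter> - S" using uK vK u by auto
    then show False
      using lt[OF d(1), of "K \<inter> S" u] lt[OF d(2), of "K \<inter> - S" v] le[OF d(2), of "K \<inter> S"] le[OF d(1), of "K \<inter> - S"]
        fK u m n kk by simp
  next
    case False
    then have "u \<in> K \<inter> - S" "v \<in> K \<inter> S" using uK vK u by auto
    then show False
      using lt[OF d(1), of "K \<inter> - S" u] lt[OF d(2), of "K \<inter> S" v] le[OF d(2), of "K \<inter> - S"] le[OF d(1), of "K \<inter> S"]
        fK u m n kk by simp
  qed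
qed

section \<open>Edge colourings of cubic bipartite graphs\<close>

text \<open>The list \<open>es\<close> may be a prefix of all edges, so the same notion covers the
  partial colourings met during construction.\<close>

definition proper :: "edge list \<Rightarrow> colouring \<Rightarrow> bool" where
  "proper es s \<longleftrightarrow> mset (fst s) + mset (fst (snd s)) + mset (snd (snd s)) = mset es \<and>
    (\<forall>v. deg (fst s) v \<le> 1 \<and> deg (fst (snd s)) v \<le> 1 \<and> deg (snd (snd s)) v \<le> 1)"

lemma proper_deg: "proper es s \<Longrightarrow> deg es v = deg (fst s) v + deg (fst (snd s)) v + deg (snd (snd s)) v"
  unfolding proper_def deg_mset by (metis filter_union_mset size_union)

lemma proper_set:
  assumes "proper es s"
  shows "set (fst s) \<union> set (fst (snd s)) \<union> set (snd (snd s)) = set es"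
proof -
  have "set_mset (mset (fst s) + mset (fst (snd s)) + mset (snd (snd s))) = set_mset (mset es)"
    using assms by (simp add: proper_def)
  then show ?thesis by simp
qed

lemma proper_perms: "proper es s \<Longrightarrow> p \<in> set (colour_perms s) \<Longrightarrow> proper es p"
  unfolding proper_def colour_perms_def Let_def by (auto simp: ac_simps)

text \<open>The hypotheses in terms of lists. \<open>simple\<close> speaks of unordered pairs and
  thus also forbids listing an edge in both orientations.\<close>

locale cubic_bip =
  fixes vs :: "nat list" and es :: "edge list" and X Y :: "nat set"
  assumes dvs: "distinct vs" and V: "set vs = X \<union> Y" and disj: "X \<inter> Y = {}"
    and side: "e \<in> set es \<Longrightarrow> fst e \<in> X \<and> snd e \<in> Y \<or> fst e \<in> Y \<and> snd e \<in> X"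
    and simple: "distinct (map (\<lambda>e. {fst e, snd e}) es)"
    and cubic: "v \<in> set vs \<Longrightarrow> deg es v = 3"
    and conn: "u \<in> set vs \<Longrightarrow> v \<in> set vs \<Longrightarrow> (u, v) \<in> (adj es)\<^sup>*"
    and ne: "vs \<noteq> []"
begin

lemma finX: "finite X" and finY: "finite Y"
  using V by (metis List.finite_set finite_Un)+

lemma es_sub: "set es \<subseteq> set vs \<times> set vs"
proof
  fix e assume "e \<in> set es"
  then have "fst e \<in> set vs \<and> snd e \<in> set vs" using side[of e] V by auto
  then show "e \<in> set vs \<times> set vs" by (simp add: mem_Times_iff)
qed

lemma kempe_set:
  assumes "set (fst s) \<union> set (fst (snd s)) \<subseteq> set es" "w \<in> set vs"
  shows "set (part_of (parts vs (fst s @ fst (snd s))) w) = component (adj (fst s @ fst (snd s))) w"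
  by (rule set_part_of[OF parts_comps[OF dvs] sym_adj assms(2)]) (use assms(1) es_sub in auto)

lemma kempe_deg:
  assumes "set (fst s) \<union> set (fst (snd s)) \<subseteq> set es" "w \<in> set vs"
    and K: "K = component (adj (fst s @ fst (snd s))) w"
  shows "deg (fst (kempe vs w s)) v = (if v \<in> K then deg (fst (snd s)) v else deg (fst s) v)"
    and "deg (fst (snd (kempe vs w s))) v = (if v \<in> K then deg (fst s) v else deg (fst (snd s)) v)"
    and "snd (snd (kempe vs w s)) = snd (snd s)"
proof -
  have c: "closed_in K (fst s)" "closed_in K (fst (snd s))" unfolding K by (rule closed_in_comp; simp)+
  show "deg (fst (kempe vs w s)) v = (if v \<in> K then deg (fst (snd s)) v else deg (fst s) v)"
    "deg (fst (snd (kempe vs w s))) v = (if v \<in> K then deg (fst s) v else deg (fst (snd s)) v)"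
    unfolding kempe_def exchange_def kempe_set[OF assms(1,2)] K[symmetric]
    using deg_filter_closed[OF c(1)] deg_filter_closed[OF c(2)] by simp_all
  show "snd (snd (kempe vs w s)) = snd (snd s)" by (simp add: kempe_def exchange_def)
qed

lemma exchange_mset:
  "mset (fst (exchange K s)) + mset (fst (snd (exchange K s))) + mset (snd (snd (exchange K s))) =
    mset (fst s) + mset (fst (snd s)) + mset (snd (snd s))"
proof -
  define A1 where "A1 = filter_mset (\<lambda>e. fst e \<in> set K) (mset (fst s))"
  define A2 where "A2 = filter_mset (\<lambda>e. \<not> fst e \<in> set K) (mset (fst s))"
  define B1 where "B1 = filter_mset (\<lambda>e. fst e \<in> set K) (mset (fst (snd s)))"
  define B2 where "B2 = filter_mset (\<lambda>e. \<not> fst e \<in> set K) (mset (fst (snd s)))"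
  have A: "mset (fst s) = A1 + A2" unfolding A1_def A2_def by (rule multiset_partition)
  have B: "mset (fst (snd s)) = B1 + B2" unfolding B1_def B2_def by (rule multiset_partition)
  have "mset (fst (exchange K s)) = A2 + B1" "mset (fst (snd (exchange K s))) = B2 + A1"
    "snd (snd (exchange K s)) = snd (snd s)"
    unfolding exchange_def A1_def A2_def B1_def B2_def by simp_all
  then show ?thesis unfolding A B by (simp only: ac_simps)
qed

lemma proper_kempe:
  assumes p: "proper es' s" and sub: "set es' \<subseteq> set es" and w: "w \<in> set vs"
  shows "proper es' (kempe vs w s)"
proof -
  have s: "set (fst s) \<union> set (fst (snd s)) \<subseteq> set es" using proper_set[OF p] sub by auto
  show ?thesis unfolding proper_def
  proof (intro conjI allI)
    show "mset (fst (kempe vs w s)) + mset (fst (snd (kempe vs w s))) + mset (snd (snd (kempe vs w s))) = mset es'"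
      using p unfolding kempe_def exchange_mset by (simp add: proper_def)
  qed (use p kempe_deg[OF s w refl] in \<open>auto simp: proper_def\<close>)
qed

lemma moves_iff: "c \<in> set (moves vs s) \<longleftrightarrow> (\<exists>p\<in>set (colour_perms s). c = p \<or> (\<exists>w\<in>set vs. c = kempe vs w p))"
  unfolding moves_def by auto

lemma proper_moves:
  assumes "proper es' s" "set es' \<subseteq> set es" "c \<in> set (moves vs s)"
  shows "proper es' c"
  using assms proper_perms proper_kempe unfolding moves_iff by blast

lemma proper_moves3:
  assumes "proper es' s" "set es' \<subseteq> set es" "c \<in> set (moves3 vs s)"
  shows "proper es' c"
proof -
  obtain a b where "a \<in> set (moves vs s)" "b \<in> set (moves vs a)" "c \<in> set (moves vs b)"
    using assms(3) by (auto simp: moves3_def)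
  then show ?thesis using proper_moves assms(1,2) by blast
qed

text \<open>A vertex of degree at most 2 misses a colour. After renaming, \<open>u\<close> misses
  the first colour; if \<open>v\<close> misses the second, exchanging these two on the component of
  \<open>v\<close> frees the first colour at \<open>v\<close>, and by \<open>kempe_avoids\<close> it
  leaves \<open>u\<close> untouched.\<close>

lemma free_colour:
  assumes p: "proper es' s" and sub: "set es' \<subseteq> set es" and d: "deg es' u \<le> 2" "deg es' v \<le> 2"
    and uv: "u \<in> X \<and> v \<in> Y \<or> u \<in> Y \<and> v \<in> X"
  shows "\<exists>c\<in>set (moves vs s). uncovered (fst c) u \<and> uncovered (fst c) v"
proof -
  have z: "deg (fst s) x = 0 \<or> deg (fst (snd s)) x = 0 \<or> deg (snd (snd s)) x = 0" if "deg es' x \<le> 2" for x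
    using proper_deg[OF p, of x] that by linarith
  have "\<exists>q\<in>set (colour_perms s). deg (fst q) u = 0 \<and> (deg (fst q) v = 0 \<or> deg (fst (snd q)) v = 0)"
    using z[OF d(1)] z[OF d(2)] unfolding colour_perms_def Let_def by (elim disjE) simp_all
  then obtain q where q: "q \<in> set (colour_perms s)" "deg (fst q) u = 0" "deg (fst q) v = 0 \<or> deg (fst (snd q)) v = 0"
    by blast
  from q(3) show ?thesis
  proof
    assume "deg (fst q) v = 0"
    moreover have "q \<in> set (moves vs s)" unfolding moves_iff using q(1) by (intro bexI[of _ q]) simp_all
    ultimately show ?thesis using q(2) unfolding uncovered_deg by (intro bexI[of _ q]) simp_all
  next
    assume v0: "deg (fst (snd q)) v = 0"
    have pq: "proper es' q" by (rule proper_perms[OF p q(1)])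
    have s: "set (fst q) \<union> set (fst (snd q)) \<subseteq> set es" using proper_set[OF pq] sub by auto
    have v: "v \<in> set vs" using uv V by auto
    define K where "K = component (adj (fst q @ fst (snd q))) v"
    have "u \<notin> K" unfolding K_def
    proof (rule kempe_avoids[where V = "set vs" and S = X])
      show "set (fst q @ fst (snd q)) \<subseteq> set vs \<times> set vs" using s es_sub by auto
      show "fst e \<in> X \<longleftrightarrow> snd e \<notin> X" if "e \<in> set (fst q @ fst (snd q))" for e
        using side[of e] that s disj by auto
      show "u \<in> X \<longleftrightarrow> v \<notin> X" using uv disj by auto
      show "deg (fst q) x \<le> 1" "deg (fst (snd q)) x \<le> 1" for x using pq by (auto simp: proper_def)
    qed (use v v0 q in auto)
    moreover have "v \<in> K" by (simp add: K_def)
    ultimately have "deg (fst (kempe vs v q)) u = 0" "deg (fst (kempe vs v q)) v = 0"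
      using kempe_deg(1)[OF s v K_def] v0 q(2) by auto
    moreover have "kempe vs v q \<in> set (moves vs s)"
      unfolding moves_iff using q(1) v by (intro bexI[of _ q]) auto
    ultimately show ?thesis unfolding uncovered_deg by (intro bexI[of _ "kempe vs v q"]) simp_all
  qed
qed

lemma proper_add_edge:
  assumes p: "proper es' s" and sub: "set (es' @ [e]) \<subseteq> set es" and d: "\<And>x. deg (es' @ [e]) x \<le> 3"
  shows "proper (es' @ [e]) (add_edge vs s e)"
proof -
  let ?f = "\<lambda>c :: colouring. uncovered (fst c) (fst e) \<and> uncovered (fst c) (snd e)"
  have "deg es' (fst e) \<le> 2" "deg es' (snd e) \<le> 2"
    using d[of "fst e"] d[of "snd e"] by (simp_all add: deg_Cons)
  then obtain c0 where c0: "c0 \<in> set (moves vs s)" "?f c0"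
    using free_colour[OF p _ _ _ side[of e]] sub by auto
  then have "filter ?f (moves vs s) \<noteq> []" by (auto simp: filter_empty_conv)
  then obtain c cs where cs: "filter ?f (moves vs s) = c # cs" by (cases "filter ?f (moves vs s)") auto
  then have "c \<in> set (filter ?f (moves vs s))" by simp
  then have c: "c \<in> set (moves vs s)" "?f c" by auto
  have pc: "proper es' c" using proper_moves[OF p _ c(1)] sub by simp
  have "add_edge vs s e = (e # fst c, snd c)" using cs by (simp add: add_edge_def)
  then show ?thesis using pc c(2) unfolding proper_def uncovered_deg by (auto simp: deg_Cons)
qed

lemma deg_le3: "deg es x \<le> 3"
proof (cases "x \<in> set vs")
  case False
  then have "deg es x = 0" using es_sub by (fastforce simp: deg_def filter_empty_conv)
  then show ?thesis by simp
qed (simp add: cubic)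

lemma proper_colour: "proper es (colour vs es)"
proof -
  have "proper es1 (foldl (\<lambda>s e. add_edge vs s e) ([], [], []) es1)" if "es1 @ es2 = es" for es1 es2
    using that
  proof (induction es1 arbitrary: es2 rule: rev_induct)
    case Nil
    then show ?case by (simp add: proper_def)
  next
    case (snoc e es1)
    have p: "proper es1 (foldl (\<lambda>s e. add_edge vs s e) ([], [], []) es1)"
      by (rule snoc.IH[of "e # es2"]) (use snoc.prems in simp)
    have "deg (es1 @ [e]) x \<le> 3" for x
      using deg_le3[of x] unfolding snoc.prems[symmetric] by (simp add: deg_Cons)
    moreover have "set (es1 @ [e]) \<subseteq> set es" unfolding snoc.prems[symmetric] by auto
    ultimately show ?case using proper_add_edge[OF p] by simp
  qed
  from this[of es "[]"] show ?thesis by (simp add: colour_def)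
qed

text \<open>Three degrees of at most 1 add up to 3. The colour classes are therefore perfect
  matchings.\<close>

lemma full_deg:
  assumes "proper es s" "v \<in> set vs"
  shows "deg (fst s) v = 1" "deg (fst (snd s)) v = 1" "deg (snd (snd s)) v = 1"
proof -
  have "deg (fst s) v \<le> 1" "deg (fst (snd s)) v \<le> 1" "deg (snd (snd s)) v \<le> 1"
    using assms(1) by (auto simp: proper_def)
  then show "deg (fst s) v = 1" "deg (fst (snd s)) v = 1" "deg (snd (snd s)) v = 1"
    using proper_deg[OF assms(1), of v] cubic[OF assms(2)] by linarith+
qed

section \<open>Colour classes as involutions\<close>

definition mated :: "edge list \<Rightarrow> (nat \<Rightarrow> nat) \<Rightarrow> bool" where
  "mated M m \<longleftrightarrow> set M \<subseteq> set es \<and> adj M = {(v, m v) | v. v \<in> set vs}"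

lemma ex_mated:
  assumes sub: "set M \<subseteq> set es" and d: "\<And>v. v \<in> set vs \<Longrightarrow> deg M v = 1"
  shows "\<exists>m. mated M m"
proof -
  have ex: "\<exists>w. (v, w) \<in> adj M" and un: "\<And>w w'. (v, w) \<in> adj M \<Longrightarrow> (v, w') \<in> adj M \<Longrightarrow> w = w'"
    if v: "v \<in> set vs" for v
  proof -
    have "length (filter (\<lambda>e. v = fst e \<or> v = snd e) M) = 1" using d[OF v] by (simp add: deg_def)
    then obtain e where e: "filter (\<lambda>e. v = fst e \<or> v = snd e) M = [e]" by (auto simp: length_Suc_conv)
    then have "e \<in> set (filter (\<lambda>e. v = fst e \<or> v = snd e) M)" by simp
    then have em: "e \<in> set M" "v = fst e \<or> v = snd e" by auto
    obtain a b where ab: "e = (a, b)" by (cases e)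
    show "\<exists>w. (v, w) \<in> adj M" using em unfolding adj_def ab by auto
    have "e \<in> set es" using em sub by blast
    from side[OF this] have nl: "fst e \<noteq> snd e" using disj by (metis disjoint_iff)
    have all: "f = e" if "f \<in> set M" "v = fst f \<or> v = snd f" for f
    proof -
      have "f \<in> set (filter (\<lambda>e. v = fst e \<or> v = snd e) M)" using that by simp
      then show ?thesis unfolding e by simp
    qed
    fix w w' assume w: "(v, w) \<in> adj M" "(v, w') \<in> adj M"
    have h: "e = (v, x) \<or> e = (x, v)" if "(v, x) \<in> adj M" for x
      using that all[of "(v, x)"] all[of "(x, v)"] unfolding adj_def by auto
    show "w = w'" using h[OF w(1)] h[OF w(2)] nl by auto
  qed
  define m where "m v = (SOME w. (v, w) \<in> adj M)" for v
  have m: "(v, m v) \<in> adj M" if "v \<in> set vs" for v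
    unfolding m_def using someI_ex[OF ex[OF that]] .
  have dom: "v \<in> set vs" if "(v, w) \<in> adj M" for v w
    using that sub es_sub by (auto simp: adj_def)
  have "adj M = {(v, m v) | v. v \<in> set vs}"
  proof (intro equalityI subsetI)
    fix p assume p: "p \<in> adj M"
    obtain v w where vw: "p = (v, w)" by (cases p)
    have "w = m v" using un[OF dom] p m[OF dom] unfolding vw by metis
    then show "p \<in> {(v, m v) | v. v \<in> set vs}" using dom p unfolding vw by blast
  qed (use m in auto)
  then show ?thesis using sub by (auto simp: mated_def)
qed

lemma mated_adj: "mated M m \<Longrightarrow> (v, w) \<in> adj M \<longleftrightarrow> v \<in> set vs \<and> w = m v"
  by (auto simp: mated_def)

lemma mated_side:
  assumes m: "mated M m"
  shows "v \<in> X \<Longrightarrow> m v \<in> Y" "v \<in> Y \<Longrightarrow> m v \<in> X" "v \<in> set vs \<Longrightarrow> m v \<in> set vs"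
proof -
  have e: "(v, m v) \<in> set es \<or> (m v, v) \<in> set es" if "v \<in> set vs"
    using mated_adj[OF m, of v "m v"] that m by (auto simp: mated_def adj_def)
  show "v \<in> X \<Longrightarrow> m v \<in> Y" using e V side[of "(v, m v)"] side[of "(m v, v)"] disj by auto
  show "v \<in> Y \<Longrightarrow> m v \<in> X" using e V side[of "(v, m v)"] side[of "(m v, v)"] disj by auto
  show "v \<in> set vs \<Longrightarrow> m v \<in> set vs" using e es_sub by auto
qed

lemma mated_invol:
  assumes m: "mated M m" and v: "v \<in> set vs"
  shows "m (m v) = v"
proof -
  have "(v, m v) \<in> adj M" using mated_adj[OF m] v by simp
  then have "(m v, v) \<in> adj M" by (rule symD[OF sym_adj])
  then show ?thesis using mated_adj[OF m] by simp
qed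

lemma mated_bij:
  assumes m: "mated M m" and n: "mated N n"
  shows "bij_betw (\<lambda>a. n (m a)) X X"
proof (rule bij_betw_byWitness[where f' = "\<lambda>a. m (n a)"])
  show "(\<lambda>a. n (m a)) ` X \<subseteq> X" "(\<lambda>a. m (n a)) ` X \<subseteq> X"
    using mated_side(1,2)[OF m] mated_side(1,2)[OF n] by auto
  have *: "m x \<in> set vs" "n x \<in> set vs" "x \<in> set vs" if "x \<in> X" for x
    using that V mated_side(1)[OF m] mated_side(1)[OF n] by auto
  show "\<forall>x\<in>X. m (n (n (m x))) = x" "\<forall>x\<in>X. n (m (m (n x))) = x"
    using * mated_invol[OF m] mated_invol[OF n] by simp_all
qed

text \<open>An alternating walk is back in \<open>X\<close> after every two edges. Leaving a vertex
  of \<open>X\<close> along \<open>n\<close> means going backwards in the orbit of \<open>n\<close>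
  after \<open>m\<close>; finiteness provides the preimage within the orbit, so the orbit and its
  image under \<open>m\<close> are together closed under both matchings.\<close>

lemma mated_component:
  assumes m: "mated M m" and n: "mated N n" and x: "x \<in> X"
  shows "component (adj (M @ N)) x \<inter> X = cls (\<lambda>a. n (m a)) x"
proof -
  let ?f = "\<lambda>a. n (m a)" and ?R = "adj (M @ N)"
  have b: "bij_betw ?f X X" by (rule mated_bij[OF m n])
  have cX: "cls ?f x \<subseteq> X" by (rule cls_in[OF b x])
  have R: "(v, w) \<in> ?R \<longleftrightarrow> v \<in> set vs \<and> (w = m v \<or> w = n v)" for v w
    using mated_adj[OF m] mated_adj[OF n] by auto
  have inv: "a \<in> X \<Longrightarrow> m (m a) = a" "a \<in> X \<Longrightarrow> n (n a) = a" "a \<in> Y \<Longrightarrow> n (n a) = a" for a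
    using mated_invol[OF m] mated_invol[OF n] V by auto
  let ?S = "cls ?f x \<union> m ` cls ?f x"
  have "component ?R x \<subseteq> ?S"
  proof (rule component_subset[of x ?S ?R])
    show "x \<in> ?S" by simp
    fix v w assume v: "v \<in> ?S" and vw: "(v, w) \<in> ?R"
    from v show "w \<in> ?S"
    proof
      assume a: "v \<in> cls ?f x"
      obtain b' where b': "b' \<in> cls ?f x" "n (m b') = v" using cls_preimage[OF finX b x a] .
      have "m b' \<in> Y" using b' cX mated_side(1)[OF m] by auto
      then have "n v = m b'" using b'(2) inv(3) by auto
      then show ?thesis using vw a b' unfolding R by auto
    next
      assume "v \<in> m ` cls ?f x"
      then obtain a where a: "a \<in> cls ?f x" "v = m a" by auto
      have "m v = a" using a cX inv(1) by auto
      moreover have "n v \<in> cls ?f x" using cls_step[OF a(1)] a(2) by simp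
      ultimately show ?thesis using vw a unfolding R by auto
    qed
  qed
  moreover have "m ` cls ?f x \<inter> X = {}" using cX mated_side(1)[OF m] disj by auto
  ultimately have "component ?R x \<inter> X \<subseteq> cls ?f x" by auto
  moreover have "cls ?f x \<subseteq> component ?R x"
  proof (rule cls_subset)
    fix z assume z: "z \<in> component ?R x"
    show "n (m z) \<in> component ?R x"
    proof (cases "z \<in> set vs")
      case True
      have "(z, m z) \<in> ?R" "(m z, n (m z)) \<in> ?R" using R True mated_side(3)[OF m] by auto
      then show ?thesis using z by (meson component_step)
    next
      case False
      have "component ?R x \<subseteq> set vs"
      proof (rule component_subset)
        show "x \<in> set vs" using x V by simp
        fix v w assume "v \<in> set vs" "(v, w) \<in> ?R"
        then have "w = m v \<or> w = n v" unfolding R by simp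
        then show "w \<in> set vs"
          using mated_side(3)[OF m \<open>v \<in> set vs\<close>] mated_side(3)[OF n \<open>v \<in> set vs\<close>] by (elim disjE) simp_all
      qed
      then show ?thesis using z False by auto
    qed
  qed simp
  ultimately show ?thesis using cX by auto
qed

text \<open>Every component meets \<open>X\<close> and is determined by its trace there.\<close>

lemma mated_num:
  assumes m: "mated M m" and n: "mated N n"
  shows "num_comps (set vs) (adj (M @ N)) = num_cls (\<lambda>a. n (m a)) X"
proof -
  let ?f = "\<lambda>a. n (m a)" and ?R = "adj (M @ N)"
  have img: "component ?R ` set vs = component ?R ` X"
  proof (intro equalityI subsetI)
    fix K assume "K \<in> component ?R ` set vs"
    then obtain v where v: "v \<in> set vs" "K = component ?R v" by auto
    show "K \<in> component ?R ` X"
    proof (cases "v \<in> X")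
      case False
      then have "m v \<in> X" using v V mated_side(2)[OF m] by auto
      moreover have "(v, m v) \<in> ?R" using mated_adj[OF m] v by simp
      then have "m v \<in> component ?R v" by (rule component_step[OF component_self])
      then have "component ?R (m v) = K" unfolding v(2) by (rule component_sym[OF sym_adj])
      ultimately show ?thesis by blast
    qed (use v in auto)
  qed (use V in auto)
  have "inj_on (\<lambda>K. K \<inter> X) (component ?R ` X)"
  proof (rule inj_onI)
    fix K L assume a: "K \<in> component ?R ` X" "L \<in> component ?R ` X" "K \<inter> X = L \<inter> X"
    obtain x where x: "x \<in> X" "K = component ?R x" using a by auto
    obtain y where y: "y \<in> X" "L = component ?R y" using a by auto
    have "x \<in> K \<inter> X" using x component_self[of x ?R] by simp
    then have "x \<in> component ?R y" using a(3) y by simp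
    then have "component ?R x = component ?R y" by (rule component_sym[OF sym_adj])
    then show "K = L" using x y by simp
  qed
  then have "card (component ?R ` X) = card ((\<lambda>K. K \<inter> X) ` component ?R ` X)" by (simp add: card_image)
  also have "(\<lambda>K. K \<inter> X) ` component ?R ` X = cls ?f ` X"
    unfolding image_image using mated_component[OF m n] by (intro image_cong) auto
  finally show ?thesis unfolding num_comps_def num_cls_def img .
qed

lemma mated_exchange:
  assumes m: "mated (fst s) m" and n: "mated (fst (snd s)) n" and w: "w \<in> set vs"
    and K: "K = component (adj (fst s @ fst (snd s))) w"
  shows "mated (fst (kempe vs w s)) (\<lambda>v. if v \<in> K then n v else m v)"
    and "mated (fst (snd (kempe vs w s))) (\<lambda>v. if v \<in> K then m v else n v)"
proof -
  have sub: "set (fst s) \<union> set (fst (snd s)) \<subseteq> set es" using m n by (auto simp: mated_def)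
  have c: "closed_in K (fst s)" "closed_in K (fst (snd s))" unfolding K by (rule closed_in_comp; simp)+
  have f1: "(v, x) \<in> adj (filter (\<lambda>e. fst e \<in> K) M) \<longleftrightarrow> (v, x) \<in> adj M \<and> v \<in> K"
    and f2: "(v, x) \<in> adj (filter (\<lambda>e. fst e \<notin> K) M) \<longleftrightarrow> (v, x) \<in> adj M \<and> v \<notin> K"
    if "closed_in K M" for v x M
    using that unfolding adj_def closed_in_def by auto
  have k: "kempe vs w s = (filter (\<lambda>e. fst e \<notin> K) (fst s) @ filter (\<lambda>e. fst e \<in> K) (fst (snd s)),
     filter (\<lambda>e. fst e \<notin> K) (fst (snd s)) @ filter (\<lambda>e. fst e \<in> K) (fst s), snd (snd s))"
    unfolding kempe_def exchange_def kempe_set[OF sub w] K[symmetric] ..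
  have "(v, x) \<in> adj (fst (kempe vs w s)) \<longleftrightarrow> v \<in> set vs \<and> x = (if v \<in> K then n v else m v)" for v x
    unfolding k using f1[OF c(2)] f2[OF c(1)] mated_adj[OF m] mated_adj[OF n] by auto
  moreover have "set (fst (kempe vs w s)) \<subseteq> set es" unfolding k using sub by auto
  ultimately show "mated (fst (kempe vs w s)) (\<lambda>v. if v \<in> K then n v else m v)"
    unfolding mated_def by auto
  have "(v, x) \<in> adj (fst (snd (kempe vs w s))) \<longleftrightarrow> v \<in> set vs \<and> x = (if v \<in> K then m v else n v)" for v x
    unfolding k using f1[OF c(1)] f2[OF c(2)] mated_adj[OF m] mated_adj[OF n] by auto
  moreover have "set (fst (snd (kempe vs w s))) \<subseteq> set es" unfolding k using sub by auto
  ultimately show "mated (fst (snd (kempe vs w s))) (\<lambda>v. if v \<in> K then m v else n v)"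
    unfolding mated_def by auto
qed

definition mates :: "colouring \<Rightarrow> (nat \<Rightarrow> nat) \<Rightarrow> (nat \<Rightarrow> nat) \<Rightarrow> (nat \<Rightarrow> nat) \<Rightarrow> bool" where
  "mates s m1 m2 m3 \<longleftrightarrow> mated (fst s) m1 \<and> mated (fst (snd s)) m2 \<and> mated (snd (snd s)) m3"

lemma mates_kempe:
  assumes "mates s m1 m2 m3" "w \<in> set vs" "K = component (adj (fst s @ fst (snd s))) w"
  shows "mates (kempe vs w s) (\<lambda>v. if v \<in> K then m2 v else m1 v) (\<lambda>v. if v \<in> K then m1 v else m2 v) m3"
proof -
  have e: "snd (snd (kempe vs w s)) = snd (snd s)" by (simp add: kempe_def exchange_def)
  have M: "mated (fst s) m1" "mated (fst (snd s)) m2" "mated (snd (snd s)) m3"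
    using assms(1) by (simp_all add: mates_def)
  show ?thesis unfolding mates_def e
    by (intro conjI mated_exchange[OF M(1,2) assms(2,3)] M(3))
qed

lemma ex_mates:
  assumes "proper es s"
  shows "\<exists>m1 m2 m3. mates s m1 m2 m3"
proof -
  have sub: "set (fst s) \<subseteq> set es" "set (fst (snd s)) \<subseteq> set es" "set (snd (snd s)) \<subseteq> set es"
    using proper_set[OF assms] by auto
  show ?thesis unfolding mates_def
    using ex_mated[OF sub(1) full_deg(1)[OF assms]] ex_mated[OF sub(2) full_deg(2)[OF assms]]
      ex_mated[OF sub(3) full_deg(3)[OF assms]] by simp
qed

text \<open>On the exchanged component the first matching becomes \<open>m2\<close>. The new map
  therefore sends \<open>m2 (m1 a)\<close> to \<open>m3 (m2 (m2 (m1 a))) = m3 (m1 a)\<close>, which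
  is the defining equation of \<open>swapped\<close>.\<close>

lemma kempe_swapped:
  assumes m: "mates s m1 m2 m3" and w: "w \<in> X"
  shows "\<exists>\<tau>'. swapped X (\<lambda>a. m2 (m1 a)) (\<lambda>a. m3 (m1 a)) (cls (\<lambda>a. m2 (m1 a)) w) \<tau>' \<and>
    length (parts vs (factor13 (kempe vs w s))) = num_cls \<tau>' X"
proof -
  define K where "K = component (adj (fst s @ fst (snd s))) w"
  define m1' where "m1' = (\<lambda>v. if v \<in> K then m2 v else m1 v)"
  let ?s = "\<lambda>a. m2 (m1 a)"
  have wV: "w \<in> set vs" using w V by auto
  have M: "mated (fst s) m1" "mated (fst (snd s)) m2" "mated (snd (snd s)) m3" using m by (auto simp: mates_def)
  have k: "mates (kempe vs w s) m1' (\<lambda>v. if v \<in> K then m1 v else m2 v) m3"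
    unfolding m1'_def by (rule mates_kempe[OF m wV K_def])
  have M': "mated (fst (kempe vs w s)) m1'" "mated (snd (snd (kempe vs w s))) m3" using k by (auto simp: mates_def)
  have KX: "K \<inter> X = cls ?s w" unfolding K_def by (rule mated_component[OF M(1,2) w])
  have "swapped X ?s (\<lambda>a. m3 (m1 a)) (cls ?s w) (\<lambda>a. m3 (m1' a))"
    unfolding swapped_def
  proof (intro conjI ballI)
    show "bij_betw (\<lambda>a. m3 (m1' a)) X X" by (rule mated_bij[OF M'])
    fix a assume a: "a \<in> cls ?s w"
    then have sa: "?s a \<in> K" using cls_step[OF a] KX by blast
    have "a \<in> X" using a KX by auto
    then have "m1 a \<in> set vs" using mated_side[OF M(1)] V by auto
    then have "m2 (?s a) = m1 a" using mated_invol[OF M(2)] by simp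
    then show "m3 (m1' (?s a)) = m3 (m1 a)" using sa by (simp add: m1'_def)
  next
    fix a assume "a \<in> X - cls ?s w"
    then have "a \<notin> K" using KX by auto
    then show "m3 (m1' a) = m3 (m1 a)" by (simp add: m1'_def)
  qed
  moreover have "set (factor13 (kempe vs w s)) \<subseteq> set vs \<times> set vs"
  proof -
    have "set (fst (kempe vs w s)) \<subseteq> set es" "set (snd (snd (kempe vs w s))) \<subseteq> set es"
      using M' by (simp_all add: mated_def)
    then show ?thesis using es_sub unfolding factor13_def by auto
  qed
  then have "length (parts vs (factor13 (kempe vs w s))) = num_cls (\<lambda>a. m3 (m1' a)) X"
    using length_parts[OF dvs, of "factor13 (kempe vs w s)"] mated_num[OF M'] unfolding factor13_def by metis
  ultimately show ?thesis by blast
qed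

lemma perm_moves: "p \<in> set (colour_perms s) \<Longrightarrow> p \<in> set (moves vs s)"
  unfolding moves_iff by (intro bexI[of _ p]) simp_all

lemma kempe_moves: "p \<in> set (colour_perms s) \<Longrightarrow> w \<in> set vs \<Longrightarrow> kempe vs w p \<in> set (moves vs s)"
  unfolding moves_iff by (intro bexI[of _ p]) auto

lemma moves3I: "a \<in> set (moves vs s) \<Longrightarrow> b \<in> set (moves vs a) \<Longrightarrow> c \<in> set (moves vs b) \<Longrightarrow> c \<in> set (moves3 vs s)"
  unfolding moves3_def by (simp, intro bexI[of _ a] bexI[of _ b]) simp_all

lemma perm_id: "s \<in> set (colour_perms s)"
  by (simp add: colour_perms_def Let_def)

lemma perm_132: "(fst s, snd (snd s), fst (snd s)) \<in> set (colour_perms s)"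
  by (simp add: colour_perms_def Let_def)

text \<open>A common neighbour of \<open>v\<close> in both matchings would make the same unordered
  pair occur twice in \<open>es\<close>.\<close>

lemma mated_distinct:
  assumes m: "mated M m" and n: "mated N n" and sub: "mset M + mset N \<subseteq># mset es" and v: "v \<in> set vs"
  shows "m v \<noteq> n v"
proof
  assume eq: "m v = n v"
  let ?S = "\<lambda>e :: edge. {fst e, snd e}"
  have in_img: "{v, l v} \<in># image_mset ?S (mset L)" if "mated L l" for L l
  proof -
    have "(v, l v) \<in> set L \<or> (l v, v) \<in> set L" using mated_adj[OF that, of v "l v"] v by (simp add: adj_def)
    then show ?thesis by (force simp: insert_commute)
  qed
  have "{v, m v} \<in># image_mset ?S (mset M)" "{v, m v} \<in># image_mset ?S (mset N)"
    using in_img[OF m] in_img[OF n] eq by simp_all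
  then have "count (image_mset ?S (mset M)) {v, m v} \<ge> 1" "count (image_mset ?S (mset N)) {v, m v} \<ge> 1"
    by simp_all
  moreover have "image_mset ?S (mset M) + image_mset ?S (mset N) \<subseteq># mset (map ?S es)"
    using image_mset_subseteq_mono[OF sub, of ?S] by simp
  then have "count (image_mset ?S (mset M)) {v, m v} + count (image_mset ?S (mset N)) {v, m v}
      \<le> count (mset (map ?S es)) {v, m v}"
    unfolding count_union[symmetric] by (rule mset_subset_eq_count)
  moreover have "count (mset (map ?S es)) {v, m v} \<le> 1"
    using simple by (simp only: distinct_count_atmost_1) simp
  ultimately show False by linarith
qed

lemma mates_distinct:
  assumes p: "proper es s" and m: "mates s m1 m2 m3" and v: "v \<in> set vs"
  shows "m1 v \<noteq> m2 v" "m1 v \<noteq> m3 v" "m2 v \<noteq> m3 v"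
proof -
  have M: "mated (fst s) m1" "mated (fst (snd s)) m2" "mated (snd (snd s)) m3" using m by (simp_all add: mates_def)
  have e: "mset es = mset (fst s) + mset (fst (snd s)) + mset (snd (snd s))" using p by (simp add: proper_def)
  have "mset (fst s) + mset (fst (snd s)) \<subseteq># mset es" unfolding e by simp
  then show "m1 v \<noteq> m2 v" by (rule mated_distinct[OF M(1,2) _ v])
  have "mset (fst s) + mset (snd (snd s)) \<subseteq># mset es" unfolding e by simp
  then show "m1 v \<noteq> m3 v" by (rule mated_distinct[OF M(1,3) _ v])
  have "mset (fst (snd s)) + mset (snd (snd s)) \<subseteq># mset es" unfolding e by simp
  then show "m2 v \<noteq> m3 v" by (rule mated_distinct[OF M(2,3) _ v])
qed

text \<open>A walk in the graph is followed inside \<open>X\<close> by letting \<open>m1 y\<close>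
  stand for a vertex \<open>y\<close> of \<open>Y\<close>. Passing from \<open>X\<close> to
  \<open>Y\<close> can then mean a backward step of one of the two permutations, which on a finite
  set is a sequence of forward steps.\<close>

lemma mates_trans:
  assumes p: "proper es s" and m: "mates s m1 m2 m3" and x: "x \<in> X" and y: "y \<in> X"
    and T: "T = {(a, m2 (m1 a)) | a. a \<in> X} \<union> {(a, m3 (m1 a)) | a. a \<in> X}"
  shows "(x, y) \<in> T\<^sup>*"
proof -
  have M: "mated (fst s) m1" "mated (fst (snd s)) m2" "mated (snd (snd s)) m3" using m by (simp_all add: mates_def)
  have adj: "(v, w) \<in> adj es \<longleftrightarrow> v \<in> set vs \<and> (w = m1 v \<or> w = m2 v \<or> w = m3 v)" for v w
  proof -
    have "adj es = adj (fst s) \<union> adj (fst (snd s)) \<union> adj (snd (snd s))"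
      unfolding adj_def proper_set[OF p, symmetric] by auto
    then show ?thesis using mated_adj[OF M(1)] mated_adj[OF M(2)] mated_adj[OF M(3)] by auto
  qed
  have inv_step: "(a, b) \<in> T\<^sup>*" if b: "b \<in> X" and f: "f = (\<lambda>a. m2 (m1 a)) \<or> f = (\<lambda>a. m3 (m1 a))" "f b = a" for a b f
  proof -
    have bf: "bij_betw f X X" using f mated_bij[OF M(1,2)] mated_bij[OF M(1,3)] by auto
    have aX: "a \<in> X" using bij_betw_in[OF bf b] f by simp
    have "a \<in> cls f b" using cls_step[OF cls_self, of f b] f(2) by simp
    then have "cls f a = cls f b" by (rule cls_eqI[OF finX bf b])
    then have "b \<in> cls f a" by simp
    then show ?thesis
    proof (induction rule: cls_induct)
      case (step z)
      have "z \<in> X" using step(1) cls_in[OF bf aX] by auto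
      then have "(z, f z) \<in> T" using f(1) unfolding T by auto
      then show ?case by (rule rtrancl_into_rtrancl[OF step(2)])
    qed simp
  qed
  have XV: "a \<in> X \<Longrightarrow> a \<in> set vs" "a \<in> Y \<Longrightarrow> a \<in> set vs" for a using V by auto
  have "(x, y) \<in> (adj es)\<^sup>*" using conn x y V by auto
  then have "(y \<in> X \<longrightarrow> (x, y) \<in> T\<^sup>*) \<and> (y \<in> Y \<longrightarrow> (x, m1 y) \<in> T\<^sup>*)"
  proof (induction rule: rtrancl_induct)
    case base
    then show ?case using x disj by auto
  next
    case (step v w)
    have v: "v \<in> set vs" and w: "w = m1 v \<or> w = m2 v \<or> w = m3 v" using step(2) adj by auto
    show ?case
    proof (cases "v \<in> X")
      case True
      then have vT: "(x, v) \<in> T\<^sup>*" using step by simp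
      have wY: "w \<in> Y" using w mated_side(1)[OF M(1) True] mated_side(1)[OF M(2) True] mated_side(1)[OF M(3) True] by auto
      have "(v, m1 w) \<in> T\<^sup>*"
        using w
      proof (elim disjE)
        assume "w = m1 v"
        then show ?thesis using mated_invol[OF M(1) v] by simp
      next
        assume w: "w = m2 v"
        have "m2 (m1 (m1 w)) = v" using mated_invol[OF M(1) XV(2)[OF wY]] mated_invol[OF M(2) v] w by simp
        then show ?thesis by (intro inv_step[OF mated_side(2)[OF M(1) wY], of "\<lambda>a. m2 (m1 a)"]) simp_all
      next
        assume w: "w = m3 v"
        have "m3 (m1 (m1 w)) = v" using mated_invol[OF M(1) XV(2)[OF wY]] mated_invol[OF M(3) v] w by simp
        then show ?thesis by (intro inv_step[OF mated_side(2)[OF M(1) wY], of "\<lambda>a. m3 (m1 a)"]) simp_all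
      qed
      then have "(x, m1 w) \<in> T\<^sup>*" by (rule rtrancl_trans[OF vT])
      then show ?thesis using wY disj by auto
    next
      case False
      then have vY: "v \<in> Y" using v V by auto
      then have vT: "(x, m1 v) \<in> T\<^sup>*" using step by simp
      have mX: "m1 v \<in> X" by (rule mated_side(2)[OF M(1) vY])
      have wX: "w \<in> X" using w mated_side(2)[OF M(1) vY] mated_side(2)[OF M(2) vY] mated_side(2)[OF M(3) vY] by auto
      have e: "m1 (m1 v) = v" by (rule mated_invol[OF M(1) v])
      have "(m1 v, m2 (m1 (m1 v))) \<in> T" "(m1 v, m3 (m1 (m1 v))) \<in> T" using mX unfolding T by blast+
      then have "(m1 v, m2 v) \<in> T" "(m1 v, m3 v) \<in> T" unfolding e by simp_all
      then have "(x, w) \<in> T\<^sup>*" using w vT by (elim disjE) (simp_all add: rtrancl_into_rtrancl)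
      then show ?thesis using wX disj by auto
    qed
  qed
  then show ?thesis using y by simp
qed

lemma length_factors:
  assumes m: "mates s m1 m2 m3"
  shows "length (parts vs (factor12 s)) = num_cls (\<lambda>a. m2 (m1 a)) X"
    and "length (parts vs (factor13 s)) = num_cls (\<lambda>a. m3 (m1 a)) X"
proof -
  have M: "mated (fst s) m1" "mated (fst (snd s)) m2" "mated (snd (snd s)) m3" using m by (simp_all add: mates_def)
  have sub: "set (fst s) \<subseteq> set es" "set (fst (snd s)) \<subseteq> set es" "set (snd (snd s)) \<subseteq> set es"
    using M by (simp_all add: mated_def)
  have "set (fst s @ fst (snd s)) \<subseteq> set vs \<times> set vs" "set (fst s @ snd (snd s)) \<subseteq> set vs \<times> set vs"
    using sub es_sub by auto
  note l = this[THEN length_parts[OF dvs]]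
  show "length (parts vs (factor12 s)) = num_cls (\<lambda>a. m2 (m1 a)) X"
    unfolding factor12_def l(1) by (rule mated_num[OF M(1,2)])
  show "length (parts vs (factor13 s)) = num_cls (\<lambda>a. m3 (m1 a)) X"
    unfolding factor13_def l(2) by (rule mated_num[OF M(1,3)])
qed

lemma mates_132: "mates s m1 m2 m3 \<Longrightarrow> mates (fst s, snd (snd s), fst (snd s)) m1 m3 m2"
  by (simp add: mates_def)

text \<open>The first exchange does not alter the union of the two colours, so the component of
  \<open>v\<close> is still the same. If \<open>v\<close> lies in the component of \<open>u\<close>,
  a second exchange would undo the first, and the identity move is taken instead.\<close>

lemma double_kempe:
  assumes m: "mates s m1 m2 m3" and u: "u \<in> X" and v: "v \<in> X"
    and U: "U = component (adj (fst s @ fst (snd s))) u \<union> component (adj (fst s @ fst (snd s))) v"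
  shows "\<exists>c\<in>set (moves vs (kempe vs u s)).
    mates c (\<lambda>x. if x \<in> U then m2 x else m1 x) (\<lambda>x. if x \<in> U then m1 x else m2 x) m3"
proof -
  let ?R = "adj (fst s @ fst (snd s))"
  define K where "K = component ?R u"
  define L where "L = component ?R v"
  let ?c = "kempe vs u s"
  have uV: "u \<in> set vs" and vV: "v \<in> set vs" using u v V by auto
  have k: "mates ?c (\<lambda>x. if x \<in> K then m2 x else m1 x) (\<lambda>x. if x \<in> K then m1 x else m2 x) m3"
    by (rule mates_kempe[OF m uV K_def])
  show ?thesis
  proof (cases "v \<in> K")
    case True
    have "L = K" unfolding L_def K_def by (rule component_sym[OF sym_adj]) (use True in \<open>simp add: K_def\<close>)
    then have "U = K" unfolding U K_def L_def by simp
    then show ?thesis using k perm_moves[OF perm_id, of ?c] by (intro bexI[of _ ?c]) simp_all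
  next
    case False
    have M: "mated (fst s) m1" "mated (fst (snd s)) m2" using m by (simp_all add: mates_def)
    have kM: "mated (fst ?c) (\<lambda>x. if x \<in> K then m2 x else m1 x)" "mated (fst (snd ?c)) (\<lambda>x. if x \<in> K then m1 x else m2 x)"
      using k by (simp_all add: mates_def)
    have "(x, y) \<in> adj (fst ?c @ fst (snd ?c)) \<longleftrightarrow> (x, y) \<in> ?R" for x y
      using mated_adj[OF M(1), of x y] mated_adj[OF M(2), of x y] mated_adj[OF kM(1), of x y] mated_adj[OF kM(2), of x y]
      by (cases "x \<in> K") auto
    then have "adj (fst ?c @ fst (snd ?c)) = ?R" by auto
    then have L': "L = component (adj (fst ?c @ fst (snd ?c))) v" by (simp add: L_def)
    have dj: "x \<notin> K" if "x \<in> L" for x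
    proof
      assume "x \<in> K"
      have "component ?R x = component ?R v" using that unfolding L_def by (rule component_sym[OF sym_adj])
      moreover have "component ?R x = component ?R u" using \<open>x \<in> K\<close> unfolding K_def by (rule component_sym[OF sym_adj])
      ultimately have "v \<in> K" using component_self[of v ?R] by (simp add: K_def)
      then show False using False by simp
    qed
    have f1: "(\<lambda>x. if x \<in> L then if x \<in> K then m1 x else m2 x else if x \<in> K then m2 x else m1 x) =
        (\<lambda>x. if x \<in> U then m2 x else m1 x)"
      and f2: "(\<lambda>x. if x \<in> L then if x \<in> K then m2 x else m1 x else if x \<in> K then m1 x else m2 x) =
        (\<lambda>x. if x \<in> U then m1 x else m2 x)"
      using dj unfolding U K_def[symmetric] L_def[symmetric] by (intro ext, simp)+
    have "mates (kempe vs v ?c) (\<lambda>x. if x \<in> U then m2 x else m1 x) (\<lambda>x. if x \<in> U then m1 x else m2 x) m3"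
      using mates_kempe[OF k vV L'] unfolding f1 f2 .
    then show ?thesis using kempe_moves[OF perm_id vV, of ?c] by (intro bexI[of _ "kempe vs v ?c"]) simp_all
  qed
qed

lemma not_betterD:
  assumes "\<not> better vs c s"
  shows "length (parts vs (factor13 s)) \<le> length (parts vs (factor13 c))"
    and "length (parts vs (factor13 c)) = length (parts vs (factor13 s)) \<Longrightarrow>
      length (parts vs (factor12 s)) \<le> length (parts vs (factor12 c))"
  using assms unfolding better_def by auto

text \<open>The optimality conditions come from different sequences of moves: exchanging 1 and 2
  must not lower the number of \<open>\<tau>\<close>-orbits; exchanging 1 and 3 preserves that
  number and so must not lower the number of \<open>\<sigma>\<close>-orbits; two exchanges of 1 and
  3 followed by one of 1 and 2 must again not lower the number of
  \<open>\<tau>\<close>-orbits.\<close>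

lemma stable_bound:
  assumes p: "proper es s" and stable: "\<And>c. c \<in> set (moves3 vs s) \<Longrightarrow> \<not> better vs c s"
  shows "7 * (length (parts vs (factor12 s)) + length (parts vs (factor13 s))) \<le> 4 * card X + 4"
proof -
  obtain m1 m2 m3 where m: "mates s m1 m2 m3" using ex_mates[OF p] by auto
  let ?\<sigma> = "\<lambda>a. m2 (m1 a)" and ?\<tau> = "\<lambda>a. m3 (m1 a)"
  let ?s = "(fst s, snd (snd s), fst (snd s))"
  have m': "mates ?s m1 m3 m2" by (rule mates_132[OF m])
  have M: "mated (fst s) m1" "mated (fst (snd s)) m2" "mated (snd (snd s)) m3" using m by (simp_all add: mates_def)
  note len = length_factors[OF m]
  have XV: "a \<in> X \<Longrightarrow> a \<in> set vs" "a \<in> Y \<Longrightarrow> a \<in> set vs" for a using V by auto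
  have m1V: "m1 a \<in> set vs" if "a \<in> X" for a using that XV mated_side[OF M(1)] by auto
  have bij: "bij_betw ?\<sigma> X X" "bij_betw ?\<tau> X X" by (rule mated_bij[OF M(1,2)], rule mated_bij[OF M(1,3)])
  have ne: "?\<sigma> a \<noteq> a" "?\<tau> a \<noteq> a" "?\<sigma> a \<noteq> ?\<tau> a" if a: "a \<in> X" for a
  proof -
    have "m1 (m1 a) = a" by (rule mated_invol[OF M(1) XV(1)[OF a]])
    then show "?\<sigma> a \<noteq> a" "?\<tau> a \<noteq> a" "?\<sigma> a \<noteq> ?\<tau> a" using mates_distinct[OF p m m1V[OF a]] by metis+
  qed
  have C: "cycle_opt X ?\<sigma> ?\<tau>"
  proof
    fix w assume w: "w \<in> X"
    obtain \<tau>' where t: "swapped X ?\<sigma> ?\<tau> (cls ?\<sigma> w) \<tau>'" "length (parts vs (factor13 (kempe vs w s))) = num_cls \<tau>' X"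
      using kempe_swapped[OF m w] by blast
    have "kempe vs w s \<in> set (moves3 vs s)"
      by (rule moves3I[OF perm_moves[OF perm_id] perm_moves[OF perm_id] kempe_moves[OF perm_id XV(1)[OF w]]])
    from not_betterD(1)[OF stable[OF this]] have "num_cls ?\<tau> X \<le> num_cls \<tau>' X" unfolding len t(2) .
    then show "\<exists>\<eta>'. swapped X ?\<sigma> ?\<tau> (cls ?\<sigma> w) \<eta>' \<and> num_cls ?\<tau> X \<le> num_cls \<eta>' X" using t(1) by blast
  qed (use finX bij ne in auto)
  have D: "cycle_opt X ?\<tau> ?\<sigma>"
  proof
    fix w assume w: "w \<in> X"
    obtain \<sigma>' where t: "swapped X ?\<tau> ?\<sigma> (cls ?\<tau> w) \<sigma>'" "length (parts vs (factor13 (kempe vs w ?s))) = num_cls \<sigma>' X"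
      using kempe_swapped[OF m' w] by blast
    let ?k = "kempe vs w ?s"
    let ?c = "(fst ?k, snd (snd ?k), fst (snd ?k))"
    have "?c \<in> set (moves3 vs s)"
      by (rule moves3I[OF kempe_moves[OF perm_132 XV(1)[OF w]] perm_moves[OF perm_132] perm_moves[OF perm_id]])
    then have nb: "\<not> better vs ?c s" by (rule stable)
    define K where "K = component (adj (fst ?s @ fst (snd ?s))) w"
    have mk: "mates ?k (\<lambda>x. if x \<in> K then m3 x else m1 x) (\<lambda>x. if x \<in> K then m1 x else m3 x) m2"
      by (rule mates_kempe[OF m' XV(1)[OF w] K_def])
    have kM: "mated (fst ?k) (\<lambda>x. if x \<in> K then m3 x else m1 x)" "mated (fst (snd ?k)) (\<lambda>x. if x \<in> K then m1 x else m3 x)"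
      using mk by (simp_all add: mates_def)
    have "(x, y) \<in> adj (fst ?k @ fst (snd ?k)) \<longleftrightarrow> (x, y) \<in> adj (factor13 s)" for x y
      using mated_adj[OF M(1), of x y] mated_adj[OF M(3), of x y] mated_adj[OF kM(1), of x y] mated_adj[OF kM(2), of x y]
      unfolding factor13_def by (cases "x \<in> K") auto
    \<comment> \<open>Exchanging colours 1 and 3 keeps their union, so the first coordinate of the
      comparison is a tie and the second one decides.\<close>
    then have a: "adj (factor13 ?c) = adj (factor13 s)" unfolding factor13_def by auto
    have "set (factor13 ?c) \<subseteq> set vs \<times> set vs" "set (factor13 s) \<subseteq> set vs \<times> set vs"
    proof -
      have "set (fst ?k) \<subseteq> set es" "set (fst (snd ?k)) \<subseteq> set es" "set (fst s) \<subseteq> set es" "set (snd (snd s)) \<subseteq> set es"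
        using kM M by (simp_all add: mated_def)
      then show "set (factor13 ?c) \<subseteq> set vs \<times> set vs" "set (factor13 s) \<subseteq> set vs \<times> set vs"
        using es_sub unfolding factor13_def by auto
    qed
    then have "length (parts vs (factor13 ?c)) = length (parts vs (factor13 s))"
      using a by (simp add: length_parts[OF dvs])
    from not_betterD(2)[OF nb this] have "num_cls ?\<sigma> X \<le> length (parts vs (factor12 ?c))" unfolding len .
    also have "factor12 ?c = factor13 ?k" by (simp add: factor12_def factor13_def)
    finally show "\<exists>\<eta>'. swapped X ?\<tau> ?\<sigma> (cls ?\<tau> w) \<eta>' \<and> num_cls ?\<sigma> X \<le> num_cls \<eta>' X"
      using t by auto
  next
    fix a assume a: "a \<in> X"
    show "?\<tau> a \<noteq> ?\<sigma> a" using ne(3)[OF a] by simp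
  qed (use finX bij ne in auto)
  have "mutual_opt X ?\<sigma> ?\<tau>"
  proof (rule mutual_opt.intro[OF C D])
    fix x y assume "x \<in> X" "y \<in> X"
    then show "(x, y) \<in> ({(a, ?\<sigma> a) |a. a \<in> X} \<union> {(a, ?\<tau> a) |a. a \<in> X})\<^sup>*"
      by (rule mates_trans[OF p m _ _ refl])
  next
    fix u v assume u: "u \<in> X" and v: "v \<in> X"
    let ?R = "adj (fst ?s @ fst (snd ?s))"
    define U where "U = component ?R u \<union> component ?R v"
    let ?m1 = "\<lambda>x. if x \<in> U then m3 x else m1 x" and ?m3 = "\<lambda>x. if x \<in> U then m1 x else m3 x"
    obtain c where c: "c \<in> set (moves vs (kempe vs u ?s))" "mates c ?m1 ?m3 m2"
      using double_kempe[OF m' u v U_def] by blast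
    let ?c = "(fst c, snd (snd c), fst (snd c))"
    have mc: "mates ?c ?m1 m2 ?m3" by (rule mates_132[OF c(2)])
    have cM: "mated (fst c) ?m1" "mated (snd (snd c)) m2" "mated (fst (snd c)) ?m3" using c(2) by (simp_all add: mates_def)
    have "component ?R u \<inter> X = cls ?\<tau> u" "component ?R v \<inter> X = cls ?\<tau> v"
      using mated_component[OF M(1,3) u] mated_component[OF M(1,3) v] by simp_all
    then have UX: "U \<inter> X = cls ?\<tau> u \<union> cls ?\<tau> v" unfolding U_def by blast
    \<comment> \<open>\<open>U\<close> is a union of components in colours 1 and 3, so it contains
      both ends of an edge of colour 1 or neither.\<close>
    have Um: "m1 a \<in> U \<longleftrightarrow> a \<in> U" if "a \<in> set vs" for a
    proof -
      have "(a, m1 a) \<in> ?R" using mated_adj[OF M(1), of a "m1 a"] that by simp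
      moreover have "(m1 a, a) \<in> ?R" by (rule symD[OF sym_adj calculation])
      ultimately show ?thesis unfolding U_def by (meson Un_iff component_step)
    qed
    have in_U: "m2 (?m1 (?\<tau> a)) = ?\<sigma> a \<and> ?m3 (?m1 (?\<tau> a)) = a" if a: "a \<in> cls ?\<tau> u \<union> cls ?\<tau> v" for a
    proof -
      have aU: "a \<in> U" "a \<in> X" using a UX by auto
      have "?\<tau> a \<in> cls ?\<tau> u \<union> cls ?\<tau> v" using a cls_step[of a ?\<tau> u] cls_step[of a ?\<tau> v] by blast
      then have tU: "?\<tau> a \<in> U" using UX by blast
      have i: "m3 (?\<tau> a) = m1 a" by (rule mated_invol[OF M(3) m1V[OF aU(2)]])
      have m1U: "m1 a \<in> U" using Um[OF XV(1)[OF aU(2)]] aU by simp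
      have j: "m1 (m1 a) = a" by (rule mated_invol[OF M(1) XV(1)[OF aU(2)]])
      show ?thesis using tU i m1U j by simp
    qed
    have out_U: "m2 (?m1 a) = ?\<sigma> a \<and> ?m3 (?m1 a) = ?\<tau> a" if a: "a \<in> X - (cls ?\<tau> u \<union> cls ?\<tau> v)" for a
    proof -
      have aU: "a \<notin> U" "a \<in> X" using a UX by auto
      have "m1 a \<notin> U" using Um[OF XV(1)[OF aU(2)]] aU by simp
      then show ?thesis using aU by simp
    qed
    have fin: "\<exists>\<tau>''. swapped X (\<lambda>a. m2 (?m1 a)) (\<lambda>a. ?m3 (?m1 a)) (cls (\<lambda>a. m2 (?m1 a)) w) \<tau>'' \<and>
      num_cls ?\<tau> X \<le> num_cls \<tau>'' X" if w: "w \<in> X" for w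
    proof -
      obtain \<tau>'' where t: "swapped X (\<lambda>a. m2 (?m1 a)) (\<lambda>a. ?m3 (?m1 a)) (cls (\<lambda>a. m2 (?m1 a)) w) \<tau>''"
        "length (parts vs (factor13 (kempe vs w ?c))) = num_cls \<tau>'' X"
        using kempe_swapped[OF mc w] by blast
      have "kempe vs w ?c \<in> set (moves3 vs s)"
        by (rule moves3I[OF kempe_moves[OF perm_132 XV(1)[OF u]] c(1) kempe_moves[OF perm_132 XV(1)[OF w]]])
      from not_betterD(1)[OF stable[OF this]] have "num_cls ?\<tau> X \<le> num_cls \<tau>'' X" unfolding len t(2) .
      then show ?thesis using t(1) by blast
    qed
    show "\<exists>\<sigma>' \<tau>'. bij_betw \<sigma>' X X \<and> bij_betw \<tau>' X X \<and>
      (\<forall>a\<in>cls ?\<tau> u \<union> cls ?\<tau> v. \<sigma>' (?\<tau> a) = ?\<sigma> a \<and> \<tau>' (?\<tau> a) = a) \<and>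
      (\<forall>a\<in>X - (cls ?\<tau> u \<union> cls ?\<tau> v). \<sigma>' a = ?\<sigma> a \<and> \<tau>' a = ?\<tau> a) \<and>
      (\<forall>w\<in>X. \<exists>\<tau>''. swapped X \<sigma>' \<tau>' (cls \<sigma>' w) \<tau>'' \<and> num_cls ?\<tau> X \<le> num_cls \<tau>'' X)"
    proof (rule exI[of _ "\<lambda>a. m2 (?m1 a)"], rule exI[of _ "\<lambda>a. ?m3 (?m1 a)"],
        rule conjI[OF mated_bij[OF cM(1,2)] conjI[OF mated_bij[OF cM(1,3)] conjI[OF _ conjI]]])
      show "\<forall>a\<in>cls ?\<tau> u \<union> cls ?\<tau> v. m2 (?m1 (?\<tau> a)) = ?\<sigma> a \<and> ?m3 (?m1 (?\<tau> a)) = a"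
        by (rule ballI, rule in_U)
      show "\<forall>a\<in>X - (cls ?\<tau> u \<union> cls ?\<tau> v). m2 (?m1 a) = ?\<sigma> a \<and> ?m3 (?m1 a) = ?\<tau> a"
        by (rule ballI, rule out_U)
      show "\<forall>w\<in>X. \<exists>\<tau>''. swapped X (\<lambda>a. m2 (?m1 a)) (\<lambda>a. ?m3 (?m1 a)) (cls (\<lambda>a. m2 (?m1 a)) w) \<tau>'' \<and>
        num_cls ?\<tau> X \<le> num_cls \<tau>'' X"
        by (rule ballI, rule fin)
    qed
  qed
  from mutual_opt.num_cls_bound[OF this] show ?thesis unfolding len .
qed

end

section \<open>Correctness of the tour\<close>

lemma improve_cases:
  obtains "improve vs s = s" "\<And>c. c \<in> set (moves3 vs s) \<Longrightarrow> \<not> better vs c s"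
  | "improve vs s \<in> set (moves3 vs s)" "better vs (improve vs s) s"
proof (cases "filter (\<lambda>c. better vs c s) (moves3 vs s)")
  case Nil
  then have "improve vs s = s" "\<And>c. c \<in> set (moves3 vs s) \<Longrightarrow> \<not> better vs c s"
    by (auto simp: improve_def filter_empty_conv)
  then show ?thesis by (rule that(1))
next
  case (Cons c cs)
  then have "c \<in> set (filter (\<lambda>c. better vs c s) (moves3 vs s))" by simp
  moreover have "improve vs s = c" using Cons by (simp add: improve_def)
  ultimately show ?thesis using that(2) by simp
qed

lemma length_fuel: "length (fuel vs) = 4 * length vs * length vs"
  by (simp add: fuel_def length_concat sum_list_triv comp_def algebra_simps)

context cubic_bip
begin

text \<open>The lexicographic pair as a single number: both lengths are at most
  \<open>length vs\<close>, so the weight \<open>length vs + 1\<close> outweighs any change of the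
  second coordinate.\<close>

definition potential :: "colouring \<Rightarrow> nat" where
  "potential s = length (parts vs (factor13 s)) * (length vs + 1) + length (parts vs (factor12 s))"

lemma factors_sub:
  assumes "proper es s"
  shows "set (factor12 s) \<subseteq> set vs \<times> set vs" "set (factor13 s) \<subseteq> set vs \<times> set vs"
  using proper_set[OF assms] es_sub unfolding factor12_def factor13_def by auto

lemma factors_le:
  assumes "proper es s"
  shows "length (parts vs (factor12 s)) \<le> length vs" "length (parts vs (factor13 s)) \<le> length vs"
  using factors_sub[OF assms] num_comps_le[of "set vs"] distinct_card[OF dvs]
  by (simp_all add: length_parts[OF dvs])

lemma better_potential:
  assumes p: "proper es c" and b: "better vs c s"
  shows "potential c < potential s"
proof -
  let ?n = "length vs + 1"
  have k: "length (parts vs (factor12 c)) < ?n" using factors_le[OF p] by simp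
  from b consider "length (parts vs (factor13 c)) < length (parts vs (factor13 s))"
    | "length (parts vs (factor13 c)) = length (parts vs (factor13 s))"
      "length (parts vs (factor12 c)) < length (parts vs (factor12 s))"
    unfolding better_def by linarith
  then show ?thesis
  proof cases
    case 1
    then have "(length (parts vs (factor13 c)) + 1) * ?n \<le> length (parts vs (factor13 s)) * ?n"
      by (intro mult_right_mono) auto
    then show ?thesis using k unfolding potential_def by (simp add: algebra_simps)
  qed (simp add: potential_def)
qed

lemma foldl_improve:
  assumes "proper es s" "potential s \<le> length l"
  shows "proper es (foldl (\<lambda>s x. improve vs s) s l) \<and>
    (\<forall>c\<in>set (moves3 vs (foldl (\<lambda>s x. improve vs s) s l)). \<not> better vs c (foldl (\<lambda>s x. improve vs s) s l))"
  using assms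
proof (induction l arbitrary: s)
  case Nil
  have "\<not> better vs c s" if "c \<in> set (moves3 vs s)" for c
    using better_potential[OF proper_moves3[OF Nil(1) subset_refl that], of s] Nil(2) by auto
  then show ?case using Nil by simp
next
  case (Cons x l)
  show ?case
  proof (cases rule: improve_cases[of vs s])
    case 1
    have "foldl (\<lambda>s x. improve vs s) s (x # l) = s" using 1(1) by (induction l) simp_all
    then show ?thesis using 1(2) Cons.prems(1) by simp
  next
    case 2
    have p: "proper es (improve vs s)" by (rule proper_moves3[OF Cons.prems(1) subset_refl 2(1)])
    have "potential (improve vs s) \<le> length l" using better_potential[OF p 2(2)] Cons.prems(2) by simp
    from Cons.IH[OF p this] show ?thesis by simp
  qed
qed

lemma optimise_stable:
  assumes "proper es s"
  shows "proper es (optimise vs s)" "\<And>c. c \<in> set (moves3 vs (optimise vs s)) \<Longrightarrow> \<not> better vs c (optimise vs s)"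
proof -
  let ?n = "length vs"
  have "?n \<ge> 1" using ne by (cases vs) auto
  then have n: "?n \<le> ?n * ?n" by simp
  have "length (parts vs (factor13 s)) * (?n + 1) \<le> ?n * (?n + 1)"
    using factors_le(2)[OF assms] by (rule mult_right_mono) simp
  then have "potential s \<le> ?n * ?n + 2 * ?n"
    unfolding potential_def using factors_le(1)[OF assms] by (simp add: algebra_simps)
  also have "\<dots> \<le> length (fuel vs)"
  proof -
    have "4 * ?n * ?n = 4 * (?n * ?n)" by simp
    then show ?thesis unfolding length_fuel using n by linarith
  qed
  finally have "potential s \<le> length (fuel vs)" .
  from foldl_improve[OF assms this]
  show "proper es (optimise vs s)" "\<And>c. c \<in> set (moves3 vs (optimise vs s)) \<Longrightarrow> \<not> better vs c (optimise vs s)"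
    unfolding optimise_def by auto
qed

text \<open>Summing degrees over one side counts every edge once, so the number of edges is twice
  the size of either side.\<close>

lemma two_factor_length:
  assumes sub: "set F \<subseteq> set es" and d: "\<And>v. v \<in> set vs \<Longrightarrow> deg F v = 2"
  shows "length F = length vs" "2 * card X = length vs"
proof -
  have FV: "set F \<subseteq> set vs \<times> set vs" using sub es_sub by blast
  have c: "closed_in (set vs) F" unfolding closed_in_def using FV by auto
  have f: "filter (\<lambda>e. fst e \<in> set vs) F = F" using FV by (intro filter_True) auto
  have s: "fst e \<in> X \<longleftrightarrow> snd e \<notin> X" "fst e \<in> Y \<longleftrightarrow> snd e \<notin> Y" if "e \<in> set F" for e
    using side[of e] that sub disj by auto
  have "(\<Sum>x\<in>set vs \<inter> X. deg F x) = length F" "(\<Sum>x\<in>set vs \<inter> Y. deg F x) = length F"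
    using sum_deg[OF _ c, of X] sum_deg[OF _ c, of Y] s f by simp_all
  moreover have "set vs \<inter> X = X" "set vs \<inter> Y = Y" using V by auto
  moreover have "(\<Sum>x\<in>X. deg F x) = 2 * card X" "(\<Sum>x\<in>Y. deg F x) = 2 * card Y"
    using d V by simp_all
  ultimately have "2 * card X = length F" "2 * card Y = length F" by simp_all
  moreover have "length vs = card X + card Y"
    using distinct_card[OF dvs] V card_Un_disjoint[OF finX finY disj] by simp
  ultimately show "length F = length vs" "2 * card X = length vs" by simp_all
qed

text \<open>Each accepted edge merges two parts and adds two copies, which keeps the weighted sum
  constant. A scanned edge ends with both endpoints in one component whether or not it was
  accepted.\<close>

lemma doubles_foldl:
  assumes P: "lists_comps P0 (set vs) (adj F)" and l: "set l \<subseteq> set es"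
    and f: "f = (\<lambda>s e. if joined (fst s) e then s else (join_parts (fst s) e, e # e # snd s))"
  shows "lists_comps (fst (foldl f (P0, []) l)) (set vs) (adj (F @ snd (foldl f (P0, []) l))) \<and>
    length (snd (foldl f (P0, []) l)) + 2 * length (fst (foldl f (P0, []) l)) = 2 * length P0 \<and>
    (\<forall>v. even (deg (snd (foldl f (P0, []) l)) v)) \<and> set (snd (foldl f (P0, []) l)) \<subseteq> set es \<and>
    (\<forall>e\<in>set l. snd e \<in> component (adj (F @ snd (foldl f (P0, []) l))) (fst e))"
  using l
proof (induction l rule: rev_induct)
  case Nil
  then show ?case using P by simp
next
  case (snoc e l)
  define s where "s = foldl f (P0, []) l"
  let ?R = "adj (F @ snd s)"
  have IH: "lists_comps (fst s) (set vs) ?R" "length (snd s) + 2 * length (fst s) = 2 * length P0"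
    "\<And>v. even (deg (snd s) v)" "set (snd s) \<subseteq> set es" "\<And>e. e \<in> set l \<Longrightarrow> snd e \<in> component ?R (fst e)"
    using snoc unfolding s_def by auto
  have fe: "foldl f (P0, []) (l @ [e]) = f s e" by (simp add: s_def)
  have e: "fst e \<in> set vs" "snd e \<in> set vs" using snoc.prems es_sub by auto
  show ?case
  proof (cases "joined (fst s) e")
    case True
    then have "f s e = s" by (simp add: f)
    moreover have "snd e \<in> component ?R (fst e)" using lists_comps_joined[OF IH(1) sym_adj e(1)] True by simp
    ultimately show ?thesis unfolding fe using IH by auto
  next
    case False
    then have fs: "f s e = (join_parts (fst s) e, e # e # snd s)" by (simp add: f)
    let ?R' = "?R \<union> {(fst e, snd e), (snd e, fst e)}"
    have R': "adj (F @ e # e # snd s) = ?R'" by (simp add: adj_Cons) blast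
    have lc: "lists_comps (join_parts (fst s) e) (set vs) ?R'" by (rule lists_comps_join[OF IH(1) sym_adj e])
    have "snd e \<notin> component ?R (fst e)" using lists_comps_joined[OF IH(1) sym_adj e(1)] False by simp
    from num_comps_insert[OF sym_adj _ e this]
    have len: "length (fst s) = length (join_parts (fst s) e) + 1"
      unfolding lists_comps_length[OF IH(1)] lists_comps_length[OF lc] by simp
    have mono: "component ?R x \<subseteq> component ?R' x" for x
      unfolding component_def by (intro Image_mono rtrancl_mono) auto
    have e': "snd e \<in> component ?R' (fst e)" by (rule component_step[OF component_self]) simp
    have all: "snd e' \<in> component ?R' (fst e')" if "e' \<in> set (l @ [e])" for e'
    proof (cases "e' = e")
      case False
      then have "e' \<in> set l" using that by simp
      then show ?thesis using IH(5) mono by blast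
    qed (use e' in simp)
    show ?thesis unfolding fe fs fst_conv snd_conv R'
      using lc len IH(2,3,4) snoc.prems all by (auto simp: deg_Cons)
  qed
qed

text \<open>When all edges of the connected graph have been scanned, a single part remains, so the
  doubled edges number twice the parts less two; adding 2 on the left avoids truncated
  subtraction.\<close>

lemma connect_spec:
  assumes F: "set F \<subseteq> set es"
  shows "set (connect vs es F) \<subseteq> set es"
    and "\<And>u v. u \<in> set vs \<Longrightarrow> v \<in> set vs \<Longrightarrow> (u, v) \<in> (adj (connect vs es F))\<^sup>*"
    and "length (connect vs es F) + 2 = length F + 2 * length (parts vs F)"
    and "even (deg (connect vs es F) v) \<longleftrightarrow> even (deg F v)"
proof -
  let ?f = "\<lambda>s e. if joined (fst s) e then s else (join_parts (fst s) e, e # e # snd s)"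
  let ?s = "foldl ?f (parts vs F, []) es"
  have FV: "set F \<subseteq> set vs \<times> set vs" using F es_sub by blast
  have co: "connect vs es F = F @ snd ?s" by (simp add: connect_def doubles_def)
  let ?R = "adj (F @ snd ?s)"
  have D: "lists_comps (fst ?s) (set vs) ?R" "length (snd ?s) + 2 * length (fst ?s) = 2 * length (parts vs F)"
    "even (deg (snd ?s) v)" "set (snd ?s) \<subseteq> set es" "\<And>e. e \<in> set es \<Longrightarrow> snd e \<in> component ?R (fst e)" for v
    using doubles_foldl[OF parts_comps[OF dvs FV] subset_refl refl] by blast+
  have reach: "y \<in> component ?R x" if xy: "x \<in> set vs" "y \<in> set vs" for x y
    using conn[OF xy]
  proof (induction rule: rtrancl_induct)
    case (step y z)
    have e: "component ?R y = component ?R x" by (rule component_sym[OF sym_adj step(3)])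
    from step(2) have "(y, z) \<in> set es \<or> (z, y) \<in> set es" by (auto simp: adj_def)
    then show ?case
    proof
      assume "(y, z) \<in> set es"
      then show ?thesis using D(5)[of "(y, z)"] e by simp
    next
      assume "(z, y) \<in> set es"
      then have "y \<in> component ?R z" using D(5)[of "(z, y)"] by simp
      then have "component ?R y = component ?R z" by (rule component_sym[OF sym_adj])
      then show ?thesis using e component_self[of z ?R] by simp
    qed
  qed simp
  obtain x where x: "x \<in> set vs" using ne by (cases vs) auto
  have "component ?R v = component ?R x" if v: "v \<in> set vs" for v
    by (rule component_sym[OF sym_adj reach[OF x v]])
  then have "component ?R ` set vs = {component ?R x}" using x by blast
  then have one: "length (fst ?s) = 1" unfolding lists_comps_length[OF D(1)] num_comps_def by simp
  show "set (connect vs es F) \<subseteq> set es" unfolding co using F D(4) by simp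
  show "(u, v) \<in> (adj (connect vs es F))\<^sup>*" if "u \<in> set vs" "v \<in> set vs" for u v
    unfolding co using reach[OF that] by (simp add: component_def)
  show "length (connect vs es F) + 2 = length F + 2 * length (parts vs F)" unfolding co using D(2) one by simp
  show "even (deg (connect vs es F) v) \<longleftrightarrow> even (deg F v)" unfolding co using D(3)[of v] by simp
qed

lemma tour_spec:
  shows "set (tour vs es) \<subseteq> set es"
    and "\<And>u v. u \<in> set vs \<Longrightarrow> v \<in> set vs \<Longrightarrow> (u, v) \<in> (adj (tour vs es))\<^sup>*"
    and "\<And>v. v \<in> set vs \<Longrightarrow> even (deg (tour vs es) v)"
    and "7 * length (tour vs es) \<le> 9 * length vs"
proof -
  define s where "s = optimise vs (colour vs es)"
  have p: "proper es s" unfolding s_def by (rule optimise_stable(1)[OF proper_colour])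
  have st: "\<And>c. c \<in> set (moves3 vs s) \<Longrightarrow> \<not> better vs c s"
    unfolding s_def by (rule optimise_stable(2)[OF proper_colour])
  define F where "F = best_factor vs s"
  have F: "F = factor12 s \<or> F = factor13 s" by (simp add: F_def best_factor_def)
  have sub: "set F \<subseteq> set es"
    using F proper_set[OF p] by (elim disjE) (auto simp: factor12_def factor13_def)
  have d: "deg F v = 2" if "v \<in> set vs" for v
    using F by (elim disjE) (simp_all add: factor12_def factor13_def full_deg[OF p that])
  have t: "tour vs es = connect vs es F" by (simp add: tour_def F_def s_def)
  note c = connect_spec[OF sub]
  show "set (tour vs es) \<subseteq> set es" "\<And>u v. u \<in> set vs \<Longrightarrow> v \<in> set vs \<Longrightarrow> (u, v) \<in> (adj (tour vs es))\<^sup>*"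
    unfolding t by (rule c(1), rule c(2))
  show "even (deg (tour vs es) v)" if "v \<in> set vs" for v unfolding t c(4) using d[OF that] by simp
  have "length (parts vs F) \<le> length (parts vs (factor12 s))" "length (parts vs F) \<le> length (parts vs (factor13 s))"
    unfolding F_def best_factor_def by auto
  moreover have "7 * (length (parts vs (factor12 s)) + length (parts vs (factor13 s))) \<le> 4 * card X + 4"
    by (rule stable_bound[OF p]) (rule st)
  \<comment> \<open>The chosen factor has at most as many cycles as each of the two, hence at most
    half of their sum.\<close>
  ultimately have "14 * length (parts vs F) \<le> 4 * card X + 4" unfolding distrib_left by linarith
  then have "14 * length (parts vs F) \<le> 2 * length vs + 4" using two_factor_length(2)[OF sub d] by linarith
  then show "7 * length (tour vs es) \<le> 9 * length vs"
    using c(3) two_factor_length(1)[OF sub d] unfolding t by linarith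
qed

end

section \<open>From presented graphs to edge lists\<close>

lemma edge_mset_map: "edge_mset es = mset (map (\<lambda>e. {fst e, snd e}) es)"
  by (simp add: edge_mset_def case_prod_unfold)

lemma multi_degree_deg: "multi_degree (edge_mset M) v = deg M v"
proof -
  have "filter_mset (\<lambda>e. v \<in> e) (edge_mset M) = mset (filter (\<lambda>e. v \<in> e) (map (\<lambda>e. {fst e, snd e}) M))"
    unfolding edge_mset_map by (simp only: mset_filter)
  then have "multi_degree (edge_mset M) v = length (filter (\<lambda>e. v \<in> e) (map (\<lambda>e. {fst e, snd e}) M))"
    by (simp only: multi_degree_def size_mset)
  also have "\<dots> = deg M v" by (simp add: deg_def filter_map comp_def)
  finally show ?thesis .
qed

lemma edge_mset_adj: "{(x, y). {x, y} \<in> set_mset (edge_mset M)} = adj M"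
proof -
  have "{x, y} \<in> set_mset (edge_mset M) \<longleftrightarrow> (x, y) \<in> adj M" for x y
  proof -
    have "{x, y} \<in> set_mset (edge_mset M) \<longleftrightarrow> (\<exists>e\<in>set M. {x, y} = {fst e, snd e})"
      unfolding edge_mset_map by auto
    also have "\<dots> \<longleftrightarrow> (\<exists>e\<in>set M. e = (x, y) \<or> e = (y, x))"
      by (intro bex_cong refl) (auto simp: doubleton_eq_iff prod_eq_iff)
    finally show ?thesis by (auto simp: adj_def)
  qed
  then show ?thesis by auto
qed

lemma distinct_if_mset_set:
  assumes "mset xs = mset_set A" "finite A"
  shows "distinct xs"
proof (rule card_distinct)
  have "set xs = A" using assms by (metis finite_set_mset_mset_set set_mset_mset)
  moreover have "length xs = card A" using assms by (metis size_mset size_mset_set)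
  ultimately show "card (set xs) = length xs" by simp
qed

lemma lists_graph_cubic_bip:
  assumes G: "simple_graph V E" "connected_graph V E" "cubic_graph V E" "bipartite_graph V E"
    and L: "lists_graph vs es V E"
  obtains X Y where "cubic_bip vs es X Y" "set vs = V" "length vs = card V" "set_mset (edge_mset es) = E"
proof -
  have fV: "finite V" using G(1) by (simp add: simple_graph_def)
  have "E \<subseteq> Pow V" using G(1) by (auto simp: simple_graph_def)
  then have fE: "finite E" using fV finite_subset by blast
  have vs: "mset vs = mset_set V" and es: "edge_mset es = mset_set E" using L by (simp_all add: lists_graph_def)
  have sV: "set vs = V" using fV by (metis finite_set_mset_mset_set set_mset_mset vs)
  have dvs: "distinct vs" by (rule distinct_if_mset_set[OF vs fV])
  have des: "distinct (map (\<lambda>e. {fst e, snd e}) es)"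
    by (rule distinct_if_mset_set[OF es[unfolded edge_mset_map] fE])
  have sE: "set_mset (edge_mset es) = E" using es fE by simp
  have em: "{fst e, snd e} \<in> E" if "e \<in> set es" for e
  proof -
    have "{fst e, snd e} \<in> (\<lambda>e. {fst e, snd e}) ` set es" using that by (rule imageI)
    then show ?thesis using sE unfolding edge_mset_map set_mset_mset set_map by simp
  qed
  obtain A B where AB: "A \<union> B = V" "A \<inter> B = {}" "\<forall>e\<in>E. \<exists>a\<in>A. \<exists>b\<in>B. e = {a, b}"
    using G(4) unfolding bipartite_graph_def by (elim exE conjE)
  have "cubic_bip vs es A B"
  proof
    show "distinct vs" by fact
    show "set vs = A \<union> B" using sV AB by simp
    show "A \<inter> B = {}" by fact
    show "distinct (map (\<lambda>e. {fst e, snd e}) es)" by fact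
    show "fst e \<in> A \<and> snd e \<in> B \<or> fst e \<in> B \<and> snd e \<in> A" if e: "e \<in> set es" for e
    proof -
      obtain a b where "a \<in> A" "b \<in> B" "{fst e, snd e} = {a, b}" using bspec[OF AB(3) em[OF e]] by blast
      then show ?thesis by (auto simp: doubleton_eq_iff)
    qed
    show "deg es v = 3" if "v \<in> set vs" for v
    proof -
      have "deg es v = size (filter_mset (\<lambda>e. v \<in> e) (mset_set E))"
        using multi_degree_deg[of es v] unfolding multi_degree_def es by simp
      also have "\<dots> = card {e \<in> E. v \<in> e}" using fE by (simp add: filter_mset_mset_set)
      finally show ?thesis using G(3) that sV by (simp add: cubic_graph_def)
    qed
    show "(u, v) \<in> (adj es)\<^sup>*" if "u \<in> set vs" "v \<in> set vs" for u v
      using G(2) that sV edge_mset_adj[of es] unfolding connected_graph_def sE by simp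
    show "vs \<noteq> []" using G(2) sV by (auto simp: connected_graph_def)
  qed
  moreover have "length vs = card V" using distinct_card[OF dvs] sV by simp
  ultimately show ?thesis using sV sE that by blast
qed

theorem theorem1:
  "\<exists>(p :: prog) (q :: nat poly). \<forall>(V :: nat set) (E :: nat set set) vs es.
     simple_graph V E \<and> connected_graph V E \<and> cubic_graph V E \<and> bipartite_graph V E \<and>
     lists_graph vs es V E \<longrightarrow>
     (\<exists>hs t.
        runs p (tree_of_graph vs es) (tree_of_edges hs) t \<and>
        t \<le> poly q (size (tree_of_graph vs es)) \<and>
        spanning_eulerian_multigraph V E (edge_mset hs) \<and>
        real (size (edge_mset hs)) \<le> 9 / 7 * real (card V))"
proof -
  obtain p q where pq: "\<And>vs es. \<exists>t. runs p (tree_of_graph vs es) (tree_of_edges (tour vs es)) t \<and>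
    t \<le> poly q (size (tree_of_graph vs es))"
    using tour_program by blast
  have "spanning_eulerian_multigraph V E (edge_mset (tour vs es)) \<and>
      real (size (edge_mset (tour vs es))) \<le> 9 / 7 * real (card V)"
    if G: "simple_graph V E" "connected_graph V E" "cubic_graph V E" "bipartite_graph V E" "lists_graph vs es V E"
    for V E vs es
  proof -
    obtain X Y where c: "cubic_bip vs es X Y" and vs: "set vs = V" "length vs = card V" and E: "set_mset (edge_mset es) = E"
      using lists_graph_cubic_bip[OF G] by blast
    interpret cubic_bip vs es X Y by (rule c)
    have "set_mset (edge_mset (tour vs es)) \<subseteq> E"
      using tour_spec(1) unfolding E[symmetric] edge_mset_map by auto
    moreover have "connected_graph V (set_mset (edge_mset (tour vs es)))"
      unfolding connected_graph_def edge_mset_adj using tour_spec(2) ne unfolding vs(1)[symmetric] by simp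
    moreover have "\<forall>v\<in>V. even (multi_degree (edge_mset (tour vs es)) v)"
      unfolding multi_degree_deg using tour_spec(3) unfolding vs(1)[symmetric] by simp
    moreover have "size (edge_mset (tour vs es)) = length (tour vs es)" by (simp add: edge_mset_def)
    moreover have "real (length (tour vs es)) \<le> 9 / 7 * real (card V)"
      using tour_spec(4) unfolding vs(2) by simp
    ultimately show ?thesis by (simp add: spanning_eulerian_multigraph_def)
  qed
  then show ?thesis using pq by blast
qed

end
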